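(* Let $(\lambda_N)_{N\ge1}$ be a sequence of transaction costs in $[0,1]$ with $$\lambda_N=o\left(\frac{\sqrt{\ln N}}{N^{(2H-\frac14)\wedge(H+\frac12)}}\right).$$ Then the self-financing strategies $(\psi^N(\lambda_N))_{N\ge1}$ (explicitly defined in the context) provide a strong asymptotic arbitrage in the large fractional binary market with transaction costs $(\lambda_N)_{N\ge1}$.
   Context: **Model.** Fix $H\in(\frac12,1)$, $\sigma>0$, $s_0>0$. Put $c_H:=\sqrt{\frac{2H\,\Gamma(\frac32-H)}{\Gamma(H+\frac12)\Gamma(2-2H)}}>0$ and $C_H:=(H-\frac12)c_H$. Let $(\xi_i)_{i\ge1}$ be i.i.d. random variables on a probability space $(\Omega,\mathcal{F},P)$ with $P(\xi_1=1)=P(\xi_1=-1)=\frac12$; $\mathcal{F}_0:=\{\emptyset,\Omega\}$, $\mathcal{F}_i:=\sigma(\xi_1,\dots,\xi_i)$ for $i\ge 1$. For $n\ge1$ and $1\le i\le n-1$ let $$j_n(i):=\sigma C_H\int_{i-1}^{i}x^{\frac12-H}\left(\int_0^1(v+n-1)^{H-\frac12}(v+n-1-x)^{H-\frac32}dv\right)dx,$$ $$g_n:=\sigma C_H\int_{n-1}^{n}x^{\frac12-H}(n-x)^{H-\frac12}\left(\int_0^1(y(n-x)+x)^{H-\frac12}y^{H-\frac32}dy\right)dx,$$ $\mathcal{Y}_n:=\sum_{i=1}^{n-1}j_n(i)\xi_i$ (so $\mathcal{Y}_1=0$) and $X_n:=\mathcal{Y}_n+g_n\xi_n$. The $N$-fractional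 binary market (with zero drift) has bond identically $1$ and stock $S_0^N=s_0$, $S_n^N=\left(1+\frac{X_n}{N^H}\right)S_{n-1}^N$, $1\le n\le N$. The sequence of markets $\{(\Omega,\mathcal{F},(\mathcal{F}_n)_{n=0}^N,P,S^N)\}_{N\ge1}$ is the large fractional binary market. Under transaction costs $\lambda_N$, the ask price of the stock is $S^N$ and the bid price is $(1-\lambda_N)S^N$. **Strategies.** For $\lambda\in[0,1]$, a $\lambda$-self-financing strategy for $S^N$ is an adapted process $\varphi^N=(\varphi^{0,N}_n,\varphi^{1,N}_n)_{n=-1}^N$ (bond units, stock units) with, for all $n\in\{0,\dots,N\}$, $$\varphi_n^{0,N}-\varphi_{n-1}^{0,N}\le-(\varphi_n^{1,N}-\varphi_{n-1}^{1,N})^+S_n^N+(1-\lambda)(\varphi_n^{1,N}-\varphi_{n-1}^{1,N})^-S_n^N .$$ Its liquidated value is $V_n^{\lambda}(\varphi^N):=\varphi_n^{0,N}+(1-\lambda)(\varphi_n^{1,N})^+S_n^N-(\varphi_n^{1,N})^-S_n^N$. Zero endowment means $\varphi^{0,N}_{-1}=\varphi^{1,N}_{-1}=0$. Given an adapted stock position $\varphi^{1,N}$ and $\varphi_{-1}^{0,N}=0$, the bond position determined by the $\lambda$-self-financing condition with equality is $$\varphi_n^{0,N}=-\sum_{k=0}^n(\varphi^{1,N}_k-\varphi^{1,N}_{k-1})^+S_k^N+(1-\lambda)\sum_{k=0}^n(\varphi^{1,N}_k-\varphi^{1,N}_{k-1})^-S_k^N .$$ **Strong asymptotic arbitrage (SAA)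 with transaction costs $\{\lambda_N\}$.** There exist a subsequence of markets (again denoted by $N$) and $\lambda_N$-self-financing strategies $\varphi^N$ with zero endowment, and positive reals $c_N\to0$, $C_N\to\infty$, such that (1) $V_i^{\lambda_N}(\varphi^N)\ge -c_N$ for all $i=0,\dots,N$; (2) $\lim_{N\to\infty}P(V_N^{\lambda_N}(\varphi^N)\ge C_N)=1$. A given sequence of strategies provides an SAA if it satisfies these conditions for some such $c_N,C_N$. **The strategies $\psi^N(\lambda_N)$.** Consider $N$ large enough that $S_k^N>0$ for all $0\le k\le N$ (this holds for all sufficiently large $N$). Let $\varphi_{-1}^{1,N}:=\varphi_0^{1,N}:=0$ and $\varphi_k^{1,N}:=N^{H-1}\frac{X_k}{S_k^N}$ for $1\le k\le N$. For $k\ge2$ let $$\theta_k^{(1)}:=g_{k-1}g_k\xi_{k-1}\xi_k,\quad \theta_k^{(2)}:=g_k\xi_k\mathcal{Y}_{k-1},\quad \theta_k^{(3)}:=g_{k-1}\xi_{k-1}\mathcal{Y}_k,\quad \theta_k^{(4)}:=\mathcal{Y}_{k-1}\mathcal{Y}_k,$$ $\theta_1^{(i)}:=0$, and $\mathcal{S}_n^{(i)}:=\sum_{k=1}^n\theta_k^{(i)}$. For $i=1,2$, let $C_i^\theta>0$ be constants with $\sup_{1\le n\le N}|\theta_n^{(i)}|\le C_i^\theta N^{H-\frac12}$ for all $N$ (such constants exist). Put $$\varepsilon_N:=\frac{\ln N}{N^{\frac12\wedge(2-2H)}},\qquad \hat c_N:=4\varepsilon_N+\frac{C_1^\theta+C_2^\theta}{N^{\frac32-H}},$$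 $$T^{(N,i)}_{\varepsilon_N}:=\inf\{k\in\{1,\dots,N\}:\tfrac1N\mathcal{S}_k^{(i)}<-\varepsilon_N\}\quad(\inf\emptyset=\infty),$$ $$T_N:=T^{(N,1)}_{\varepsilon_N}\wedge T^{(N,2)}_{\varepsilon_N}\wedge(T^{(N,3)}_{\varepsilon_N}-1)\wedge(T^{(N,4)}_{\varepsilon_N}-1).$$ The stock position of $\psi^N(\lambda_N)$ is $\psi_k^{1,N}:=\frac{1}{\sqrt{\hat c_N}}\mathbf{1}_{\{k<T_N\}}\varphi_k^{1,N}$, $k\in\{-1,0,\dots,N\}$; the bond position $\psi^{0,N}(\lambda_N)$ is determined from it by the $\lambda_N$-self-financing condition with equality, with $\psi_{-1}^{0,N}(\lambda_N)=0$. *)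

theory Defs
  imports "HOL-Probability.Probability" "HOL-Library.Landau_Symbols"
begin

definition c_H :: "real \<Rightarrow> real" where
  "c_H H = sqrt (2 * H * Gamma (3/2 - H) / (Gamma (H + 1/2) * Gamma (2 - 2 * H)))"

definition C_H :: "real \<Rightarrow> real" where
  "C_H H = (H - 1/2) * c_H H"

text \<open>The integrands below have integrable singularities at endpoints of the ranges of integration,
  where \<^term>\<open>0 powr a = 0\<close> is a harmless value on a null set.\<close>

definition jcoef :: "real \<Rightarrow> real \<Rightarrow> nat \<Rightarrow> nat \<Rightarrow> real" where
  "jcoef H \<sigma> n i = \<sigma> * C_H H *
     (LBINT x:{real i - 1..real i}. x powr (1/2 - H) *
        (LBINT v:{0..1}. (v + real n - 1) powr (H - 1/2) * (v + real n - 1 - x) powr (H - 3/2)))"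

definition gcoef :: "real \<Rightarrow> real \<Rightarrow> nat \<Rightarrow> real" where
  "gcoef H \<sigma> n = \<sigma> * C_H H *
     (LBINT x:{real n - 1..real n}. x powr (1/2 - H) * (real n - x) powr (H - 1/2) *
        (LBINT y:{0..1}. (y * (real n - x) + x) powr (H - 1/2) * y powr (H - 3/2)))"

definition Yproc :: "real \<Rightarrow> real \<Rightarrow> (nat \<Rightarrow> 'a \<Rightarrow> real) \<Rightarrow> nat \<Rightarrow> 'a \<Rightarrow> real" where
  "Yproc H \<sigma> \<xi> n \<omega> = (\<Sum>i = 1..<n. jcoef H \<sigma> n i * \<xi> i \<omega>)"

definition Xproc :: "real \<Rightarrow> real \<Rightarrow> (nat \<Rightarrow> 'a \<Rightarrow> real) \<Rightarrow> nat \<Rightarrow> 'a \<Rightarrow> real" where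
  "Xproc H \<sigma> \<xi> n \<omega> = Yproc H \<sigma> \<xi> n \<omega> + gcoef H \<sigma> n * \<xi> n \<omega>"

primrec stock ::
  "real \<Rightarrow> real \<Rightarrow> real \<Rightarrow> (nat \<Rightarrow> 'a \<Rightarrow> real) \<Rightarrow> nat \<Rightarrow> nat \<Rightarrow> 'a \<Rightarrow> real" where
  "stock H \<sigma> s0 \<xi> N 0 \<omega> = s0"
| "stock H \<sigma> s0 \<xi> N (Suc n) \<omega> =
     (1 + Xproc H \<sigma> \<xi> (Suc n) \<omega> / real N powr H) * stock H \<sigma> s0 \<xi> N n \<omega>"

definition nat_filtration :: "'a measure \<Rightarrow> (nat \<Rightarrow> 'a \<Rightarrow> real) \<Rightarrow> nat \<Rightarrow> 'a measure" where
  "nat_filtration M \<xi> n =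
     sigma (space M) (\<Union>i\<in>{1..n}. {\<xi> i -` B \<inter> space M | B. B \<in> sets borel})"

text \<open>Trading times are the integers \<open>-1, 0, \<dots>, N\<close>; \<open>\<phi>0\<close> and \<open>\<phi>1\<close> are the bond and the stock position.
  Time \<open>-1\<close> carries the \<sigma>-algebra of time \<open>0\<close>, since \<^term>\<open>nat (-1) = 0\<close>.\<close>

definition self_financing ::
  "'a measure \<Rightarrow> (nat \<Rightarrow> 'a measure) \<Rightarrow> (nat \<Rightarrow> 'a \<Rightarrow> real) \<Rightarrow> nat \<Rightarrow> real
    \<Rightarrow> (int \<Rightarrow> 'a \<Rightarrow> real) \<Rightarrow> (int \<Rightarrow> 'a \<Rightarrow> real) \<Rightarrow> bool" where
  "self_financing M F S N lam \<phi>0 \<phi>1 \<longleftrightarrow>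
     (\<forall>n\<in>{-1..int N}. \<phi>0 n \<in> borel_measurable (F (nat n)) \<and> \<phi>1 n \<in> borel_measurable (F (nat n))) \<and>
     (\<forall>n\<in>{0..int N}. \<forall>\<omega>\<in>space M.
        \<phi>0 n \<omega> - \<phi>0 (n - 1) \<omega>
          \<le> - max (\<phi>1 n \<omega> - \<phi>1 (n - 1) \<omega>) 0 * S (nat n) \<omega>
            + (1 - lam) * max (- (\<phi>1 n \<omega> - \<phi>1 (n - 1) \<omega>)) 0 * S (nat n) \<omega>)"

definition zero_endowment ::
  "'a measure \<Rightarrow> (int \<Rightarrow> 'a \<Rightarrow> real) \<Rightarrow> (int \<Rightarrow> 'a \<Rightarrow> real) \<Rightarrow> bool" where
  "zero_endowment M \<phi>0 \<phi>1 \<longleftrightarrow> (\<forall>\<omega>\<in>space M. \<phi>0 (-1) \<omega> = 0 \<and> \<phi>1 (-1) \<omega> = 0)"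

definition liquidation_value ::
  "(nat \<Rightarrow> 'a \<Rightarrow> real) \<Rightarrow> real \<Rightarrow> (int \<Rightarrow> 'a \<Rightarrow> real) \<Rightarrow> (int \<Rightarrow> 'a \<Rightarrow> real) \<Rightarrow> int \<Rightarrow> 'a \<Rightarrow> real" where
  "liquidation_value S lam \<phi>0 \<phi>1 n \<omega> =
     \<phi>0 n \<omega> + (1 - lam) * max (\<phi>1 n \<omega>) 0 * S (nat n) \<omega> - max (- \<phi>1 n \<omega>) 0 * S (nat n) \<omega>"

definition self_financing_bond ::
  "(nat \<Rightarrow> 'a \<Rightarrow> real) \<Rightarrow> real \<Rightarrow> (int \<Rightarrow> 'a \<Rightarrow> real) \<Rightarrow> int \<Rightarrow> 'a \<Rightarrow> real" where
  "self_financing_bond S lam \<phi>1 n \<omega> =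
     - (\<Sum>k\<in>{0..n}. max (\<phi>1 k \<omega> - \<phi>1 (k - 1) \<omega>) 0 * S (nat k) \<omega>)
     + (1 - lam) * (\<Sum>k\<in>{0..n}. max (- (\<phi>1 k \<omega> - \<phi>1 (k - 1) \<omega>)) 0 * S (nat k) \<omega>)"

text \<open>Here \<open>r\<close> selects the subsequence of markets; \<open>S N\<close>, \<open>lam N\<close>, \<open>\<phi>0 N\<close>, \<open>\<phi>1 N\<close> belong to the
  \<open>N\<close>-th market. The lower bound on the value is an almost sure one, as usual for
  inequalities between random variables: the law of the \<open>\<xi> i\<close> leaves their values on null sets
  unrestricted.\<close>

definition provides_SAA ::
  "'a measure \<Rightarrow> (nat \<Rightarrow> 'a measure) \<Rightarrow> (nat \<Rightarrow> nat \<Rightarrow> 'a \<Rightarrow> real) \<Rightarrow> (nat \<Rightarrow> real) \<Rightarrow> (nat \<Rightarrow> nat)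
    \<Rightarrow> (nat \<Rightarrow> int \<Rightarrow> 'a \<Rightarrow> real) \<Rightarrow> (nat \<Rightarrow> int \<Rightarrow> 'a \<Rightarrow> real) \<Rightarrow> bool" where
  "provides_SAA M F S lam r \<phi>0 \<phi>1 \<longleftrightarrow>
     strict_mono r \<and> (\<forall>m. r m \<ge> 1) \<and>
     (\<forall>m. self_financing M F (S (r m)) (r m) (lam (r m)) (\<phi>0 (r m)) (\<phi>1 (r m)) \<and>
          zero_endowment M (\<phi>0 (r m)) (\<phi>1 (r m))) \<and>
     (\<exists>c C :: nat \<Rightarrow> real.
        (\<forall>m. c m > 0) \<and> (\<forall>m. C m > 0) \<and> c \<longlonglongrightarrow> 0 \<and> filterlim C at_top sequentially \<and>
        (\<forall>m. AE \<omega> in M. \<forall>i\<in>{0..int (r m)}.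
           liquidation_value (S (r m)) (lam (r m)) (\<phi>0 (r m)) (\<phi>1 (r m)) i \<omega> \<ge> - c m) \<and>
        (\<lambda>m. measure M {\<omega>\<in>space M.
           liquidation_value (S (r m)) (lam (r m)) (\<phi>0 (r m)) (\<phi>1 (r m)) (int (r m)) \<omega> \<ge> C m})
          \<longlonglongrightarrow> 1)"

definition phi_stock ::
  "real \<Rightarrow> real \<Rightarrow> real \<Rightarrow> (nat \<Rightarrow> 'a \<Rightarrow> real) \<Rightarrow> nat \<Rightarrow> int \<Rightarrow> 'a \<Rightarrow> real" where
  "phi_stock H \<sigma> s0 \<xi> N k \<omega> =
     (if k \<ge> 1
      then real N powr (H - 1) * (Xproc H \<sigma> \<xi> (nat k) \<omega> / stock H \<sigma> s0 \<xi> N (nat k) \<omega>)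
      else 0)"

text \<open>The index \<open>i\<close> ranges over \<open>1, 2, 3, 4\<close>.\<close>

definition theta :: "real \<Rightarrow> real \<Rightarrow> (nat \<Rightarrow> 'a \<Rightarrow> real) \<Rightarrow> nat \<Rightarrow> nat \<Rightarrow> 'a \<Rightarrow> real" where
  "theta H \<sigma> \<xi> i k \<omega> =
     (if k < 2 then 0
      else if i = 1 then gcoef H \<sigma> (k - 1) * gcoef H \<sigma> k * \<xi> (k - 1) \<omega> * \<xi> k \<omega>
      else if i = 2 then gcoef H \<sigma> k * \<xi> k \<omega> * Yproc H \<sigma> \<xi> (k - 1) \<omega>
      else if i = 3 then gcoef H \<sigma> (k - 1) * \<xi> (k - 1) \<omega> * Yproc H \<sigma> \<xi> k \<omega>
      else Yproc H \<sigma> \<xi> (k - 1) \<omega> * Yproc H \<sigma> \<xi> k \<omega>)"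

definition theta_sum :: "real \<Rightarrow> real \<Rightarrow> (nat \<Rightarrow> 'a \<Rightarrow> real) \<Rightarrow> nat \<Rightarrow> nat \<Rightarrow> 'a \<Rightarrow> real" where
  "theta_sum H \<sigma> \<xi> i n \<omega> = (\<Sum>k = 1..n. theta H \<sigma> \<xi> i k \<omega>)"

definition eps :: "real \<Rightarrow> nat \<Rightarrow> real" where
  "eps H N = ln (real N) / real N powr (min (1/2) (2 - 2 * H))"

text \<open>\<open>C1\<close> and \<open>C2\<close> are the constants in the bounds \<open>\<bar>\<theta>\<^sub>n\<bar> \<le> C N powr (H - 1/2)\<close> on \<^term>\<open>theta H \<sigma> \<xi> 1\<close>
  and \<^term>\<open>theta H \<sigma> \<xi> 2\<close>.\<close>

definition c_hat :: "real \<Rightarrow> real \<Rightarrow> real \<Rightarrow> nat \<Rightarrow> real" where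
  "c_hat H C1 C2 N = 4 * eps H N + (C1 + C2) / real N powr (3/2 - H)"

text \<open>Extended real times, so that the infimum of the empty set is \<open>\<infinity>\<close> and \<open>\<infinity> - 1 = \<infinity>\<close>.\<close>

definition hitting_time ::
  "real \<Rightarrow> real \<Rightarrow> (nat \<Rightarrow> 'a \<Rightarrow> real) \<Rightarrow> nat \<Rightarrow> nat \<Rightarrow> 'a \<Rightarrow> ereal" where
  "hitting_time H \<sigma> \<xi> N i \<omega> =
     (INF k\<in>{k\<in>{1..N}. theta_sum H \<sigma> \<xi> i k \<omega> / real N < - eps H N}. ereal (real k))"

definition stop_time :: "real \<Rightarrow> real \<Rightarrow> (nat \<Rightarrow> 'a \<Rightarrow> real) \<Rightarrow> nat \<Rightarrow> 'a \<Rightarrow> ereal" where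
  "stop_time H \<sigma> \<xi> N \<omega> =
     min (min (hitting_time H \<sigma> \<xi> N 1 \<omega>) (hitting_time H \<sigma> \<xi> N 2 \<omega>))
         (min (hitting_time H \<sigma> \<xi> N 3 \<omega> - 1) (hitting_time H \<sigma> \<xi> N 4 \<omega> - 1))"

definition psi_stock ::
  "real \<Rightarrow> real \<Rightarrow> real \<Rightarrow> (nat \<Rightarrow> 'a \<Rightarrow> real) \<Rightarrow> real \<Rightarrow> real \<Rightarrow> nat \<Rightarrow> int \<Rightarrow> 'a \<Rightarrow> real" where
  "psi_stock H \<sigma> s0 \<xi> C1 C2 N k \<omega> =
     1 / sqrt (c_hat H C1 C2 N) *
     (if ereal (real_of_int k) < stop_time H \<sigma> \<xi> N \<omega> then 1 else 0) *
     phi_stock H \<sigma> s0 \<xi> N k \<omega>"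

definition psi_bond ::
  "real \<Rightarrow> real \<Rightarrow> real \<Rightarrow> (nat \<Rightarrow> 'a \<Rightarrow> real) \<Rightarrow> real \<Rightarrow> real \<Rightarrow> (nat \<Rightarrow> real)
    \<Rightarrow> nat \<Rightarrow> int \<Rightarrow> 'a \<Rightarrow> real" where
  "psi_bond H \<sigma> s0 \<xi> C1 C2 lam N =
     self_financing_bond (stock H \<sigma> s0 \<xi> N) (lam N) (psi_stock H \<sigma> s0 \<xi> C1 C2 N)"

end

theory Submission
  imports Defs
begin

text \<open>Why the strategies work. Without costs, the position \<open>N powr (H - 1) * X k / S k\<close> turns the next price increment
into \<open>X k * X (k + 1) / N\<close>, so the unscaled gain is \<open>1 / N\<close> times the sum of the four processes
\<open>theta_sum 1, \<dots>, theta_sum 4\<close>. The first two are martingales, the third is a martingale plus a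
nonnegative drift, and the fourth has mean at least of order \<open>N\<close>, because \<open>Y (k - 1)\<close> and \<open>Y k\<close> share the sign
\<open>\<xi> (k - 2)\<close> with coefficients that are bounded away from \<open>0\<close> (\<open>jcoef_ge\<close>, \<open>polar_mean_gap\<close>). Stopping keeps
the gain above \<open>- c_hat\<close>, so after scaling by \<open>1 / sqrt c_hat\<close> the loss is at most \<open>sqrt c_hat\<close>, which
tends to \<open>0\<close> (\<open>stopped_gain_ge\<close>), while a gain of order \<open>1\<close> becomes one of order \<open>1 / sqrt c_hat\<close>.

It remains to see that with probability tending to \<open>1\<close> no stopping occurs (\<open>good_event\<close>). For the
martingales this is Kolmogorov's maximal inequality, since their increments have bounded second moments
(\<open>maximal_inequality\<close>, \<open>sum_jcoef_sq_le\<close>). The fourth sum is not a martingale. By polarisation it is a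
difference of two increasing quadratic forms in the signs (\<open>theta4_eq\<close>). Off its diagonal a quadratic form in
signs is again a martingale transform, which bounds the variance of either form at time \<open>n\<close> by a multiple of
\<open>n powr (2 * H)\<close> (\<open>quadratic_form_deviation\<close>, \<open>polar_sum_deviation\<close>). Monotonicity reduces all times to an
equally spaced net, and the linear drift absorbs deviations that are proportional to the time of the net point
(\<open>net_lower_bound\<close>, \<open>net_fails_prob\<close>).

The transaction costs are negligible path by path: \<open>X n\<close> is at most of order \<open>n powr (H - 1/2)\<close> (\<open>abs_X_le\<close>), so
the total cost is at most of order \<open>lam N * N powr (2 * H - 1/2) / sqrt (c_hat N)\<close>, and the assumed rate of \<open>lam\<close> is
what makes this tend to \<open>0\<close> (\<open>cost_tendsto_0\<close>).\<close>

section \<open>Power sums and integrals of powers\<close>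

text \<open>As \<open>p \<le> 0\<close>, each summand is at most the integral of \<open>x powr p\<close> over the preceding unit interval.\<close>

lemma sum_powr_le:
  fixes p :: real
  assumes "-1 < p" "p \<le> 0"
  shows "(\<Sum>i=1..n. real i powr p) \<le> real n powr (p + 1) / (p + 1)"
proof (induction n)
  case (Suc n)
  have step: "real (Suc n) powr p * (p + 1) \<le> real (Suc n) powr (p + 1) - real n powr (p + 1)"
  proof (cases "n = 0")
    case True
    with assms show ?thesis by simp
  next
    case False
    have "\<exists>z. real n < z \<and> z < real (Suc n) \<and>
        real (Suc n) powr (p + 1) - real n powr (p + 1) = (real (Suc n) - real n) * ((p + 1) * z powr p)"
    proof (rule MVT2)
      fix x :: real assume "real n \<le> x" "x \<le> real (Suc n)"
      with False have "x > 0" by simp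
      then show "((\<lambda>x. x powr (p + 1)) has_real_derivative (p + 1) * x powr p) (at x)"
        by (auto intro!: derivative_eq_intros)
    qed simp
    then obtain z where z: "real n < z" "z < real (Suc n)"
      "real (Suc n) powr (p + 1) - real n powr (p + 1) = (p + 1) * z powr p" by auto
    have "real (Suc n) powr p \<le> z powr p"
      using z False assms by (intro powr_mono2') auto
    then show ?thesis using z(3) assms by (simp add: mult.commute mult_left_mono)
  qed
  have "real (Suc n) powr p \<le> (real (Suc n) powr (p + 1) - real n powr (p + 1)) / (p + 1)"
    using step assms by (subst pos_le_divide_eq) auto
  with Suc show ?case by (simp add: diff_divide_distrib)
qed simp

text \<open>The factor \<open>2 / (a + 1)\<close> serves all \<open>i\<close> at once: for \<open>i = 1\<close> the singularity is integrated
exactly, and for \<open>i \<ge> 2\<close> the interval lies to the right of \<open>i / 2\<close>.\<close>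

lemma powr_unit_interval:
  fixes a :: real and i :: nat
  assumes a: "-1 < a" "a \<le> 0" and i: "i \<ge> 1"
  shows "set_integrable lborel {real i - 1..real i} (\<lambda>x. x powr a)"
    and "(LBINT x:{real i - 1..real i}. x powr a) \<le> 2 / (a + 1) * real i powr a"
proof -
  have int0: "((\<lambda>x. x powr a) has_integral (c powr (a + 1) / (a + 1))) {0..c}" if "c \<ge> 0" for c
    using has_integral_powr_from_0[OF a(1) that] .
  have abs: "set_integrable lebesgue {0..c} (\<lambda>x. x powr a)" if "c \<ge> 0" for c
    using int0[OF that] by (intro nonnegative_absolutely_integrable_1) (auto simp: integrable_on_def)
  have bor: "set_integrable lborel {0..c} (\<lambda>x. x powr a)" if "c \<ge> 0" for c
    using abs[OF that] unfolding set_integrable_def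
    by (subst (asm) integrable_completion) auto
  show int: "set_integrable lborel {real i - 1..real i} (\<lambda>x. x powr a)"
    using i by (intro set_integrable_subset[OF bor[of "real i"]]) auto
  have "((\<lambda>x. x powr a) has_integral (LBINT x:{real i - 1..real i}. x powr a)) {real i - 1..real i}"
    using set_borel_integral_eq_integral[OF int] by (metis has_integral_integral)
  from has_integral_combine[OF _ _ int0 this]
  have "((\<lambda>x. x powr a) has_integral ((real i - 1) powr (a + 1) / (a + 1)
      + (LBINT x:{real i - 1..real i}. x powr a))) {0..real i}" using i by auto
  from has_integral_unique[OF this int0]
  have val: "(LBINT x:{real i - 1..real i}. x powr a)
      = (real i powr (a + 1) - (real i - 1) powr (a + 1)) / (a + 1)"
    by (simp add: diff_divide_distrib)
  show "(LBINT x:{real i - 1..real i}. x powr a) \<le> 2 / (a + 1) * real i powr a"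
  proof (cases "i = 1")
    case True
    with a show ?thesis unfolding val by (simp add: divide_right_mono)
  next
    case False
    with i have i2: "i \<ge> 2" by simp
    have "\<exists>z. real i - 1 < z \<and> z < real i \<and>
        real i powr (a + 1) - (real i - 1) powr (a + 1) = (real i - (real i - 1)) * ((a + 1) * z powr a)"
    proof (rule MVT2)
      fix x :: real assume "real i - 1 \<le> x" "x \<le> real i"
      with i2 have "x > 0" by simp
      then show "((\<lambda>x. x powr (a + 1)) has_real_derivative (a + 1) * x powr a) (at x)"
        by (auto intro!: derivative_eq_intros)
    qed simp
    then obtain z where z: "real i - 1 < z" "z < real i"
      "real i powr (a + 1) - (real i - 1) powr (a + 1) = (a + 1) * z powr a" by auto
    have "z powr a \<le> (real i / 2) powr a"
      using z i2 a by (intro powr_mono2') auto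
    also have "\<dots> = real i powr a * 2 powr (-a)"
      by (simp add: powr_divide powr_minus field_simps)
    also have "2 powr (-a) \<le> (2::real) powr 1"
      using a by (intro powr_mono) auto
    finally have zb: "z powr a \<le> real i powr a * 2" by (simp add: mult_left_mono)
    have "(LBINT x:{real i - 1..real i}. x powr a) = z powr a"
      unfolding val z(3) using a by simp
    also have "\<dots> \<le> 2 * real i powr a" using zb by simp
    also have "\<dots> \<le> 2 / (a + 1) * real i powr a"
      using a by (intro mult_right_mono) (auto simp: field_simps)
    finally show ?thesis .
  qed
qed

section \<open>Bounds on the coefficients of the market\<close>

locale fractional_kernel =
  fixes H \<sigma> :: real
  assumes H_gt: "1/2 < H" and H_lt: "H < 1" and sigma_pos: "\<sigma> > 0"
begin

definition prefactor :: real where "prefactor = \<sigma> * C_H H"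

lemma prefactor_pos: "prefactor > 0"
proof -
  have "Gamma (3/2 - H) > 0" "Gamma (H + 1/2) > 0" "Gamma (2 - 2 * H) > 0"
    using H_gt H_lt by (auto intro!: Gamma_real_pos)
  then show ?thesis
    unfolding prefactor_def C_H_def c_H_def using H_gt sigma_pos
    by (intro mult_pos_pos) auto
qed

lemma jcoef_nonneg: "jcoef H \<sigma> n i \<ge> 0"
proof -
  have "(LBINT x:{real i - 1..real i}. x powr (1/2 - H) *
        (LBINT v:{0..1}. (v + real n - 1) powr (H - 1/2) * (v + real n - 1 - x) powr (H - 3/2))) \<ge> 0"
    unfolding set_lebesgue_integral_def
    by (intro integral_nonneg_AE AE_I2) (auto intro!: mult_nonneg_nonneg integral_nonneg_AE)
  then show ?thesis
    unfolding jcoef_def using prefactor_pos by (simp add: prefactor_def)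
qed

lemma gcoef_nonneg: "gcoef H \<sigma> n \<ge> 0"
proof -
  have "(LBINT x:{real n - 1..real n}. x powr (1/2 - H) * (real n - x) powr (H - 1/2) *
        (LBINT y:{0..1}. (y * (real n - x) + x) powr (H - 1/2) * y powr (H - 3/2))) \<ge> 0"
    unfolding set_lebesgue_integral_def
    by (intro integral_nonneg_AE AE_I2) (auto intro!: mult_nonneg_nonneg integral_nonneg_AE)
  then show ?thesis
    unfolding gcoef_def using prefactor_pos by (simp add: prefactor_def)
qed

text \<open>As \<open>x \<le> i\<close>, the second factor is at most \<open>(v + (n - i) - 1) powr (H - 3/2)\<close>, a translate of the integrand
in \<open>powr_unit_interval\<close>.\<close>

lemma inner_integral:
  fixes x :: real
  assumes "1 \<le> i" "i < n" "real i - 1 \<le> x" "x \<le> real i"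
  shows "set_integrable lborel {0..1} (\<lambda>v. (v + real n - 1) powr (H - 1/2) * (v + real n - 1 - x) powr (H - 3/2))"
    and "(LBINT v:{0..1}. (v + real n - 1) powr (H - 1/2) * (v + real n - 1 - x) powr (H - 3/2))
      \<le> real n powr (H - 1/2) * (2 / (H - 1/2) * real (n - i) powr (H - 3/2))"
proof -
  define m where "m = n - i"
  have m: "m \<ge> 1" "real m = real n - real i" using assms by (auto simp: m_def)
  have a: "-1 < H - 3/2" "H - 3/2 \<le> 0" using H_gt H_lt by auto
  let ?g = "\<lambda>v. real n powr (H - 1/2) * (v + (real m - 1)) powr (H - 3/2)"
  have int: "integrable lborel (\<lambda>x. indicator {real m - 1..real m} x *\<^sub>R (x powr (H - 3/2)))"
    using powr_unit_interval(1)[OF a m(1)] by (simp add: set_integrable_def)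
  have shift: "(\<lambda>v. indicator {real m - 1..real m} ((real m - 1) + 1 * v) *\<^sub>R (((real m - 1) + 1 * v) powr (H - 3/2)))
      = (\<lambda>v. indicator {0..1} v *\<^sub>R ((v + (real m - 1)) powr (H - 3/2)))"
    by (auto simp: indicator_def fun_eq_iff add.commute)
  have int2: "integrable lborel (\<lambda>v. indicator {0..1} v *\<^sub>R ((v + (real m - 1)) powr (H - 3/2)))"
    using lborel_integrable_real_affine[OF int, of 1 "real m - 1"] unfolding shift by simp
  have val2: "(LBINT v:{0..1}. (v + (real m - 1)) powr (H - 3/2)) = (LBINT x:{real m - 1..real m}. x powr (H - 3/2))"
    using lborel_integral_real_affine[of 1 "\<lambda>x. indicator {real m - 1..real m} x *\<^sub>R (x powr (H - 3/2))" "real m - 1"]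
    unfolding shift by (simp add: set_lebesgue_integral_def)
  have int3: "integrable lborel (\<lambda>v. indicator {0..1} v *\<^sub>R ?g v)"
    using integrable_mult_right[OF int2, of "real n powr (H - 1/2)"]
    by (simp add: mult.left_commute)
  \<comment> \<open>At \<open>v = 0\<close> the bound may fail, because there the dominating function can be \<open>0 powr (H - 3/2) = 0\<close>.\<close>
  have ae: "AE v in lborel. indicator {0..1} v *\<^sub>R ((v + real n - 1) powr (H - 1/2) * (v + real n - 1 - x) powr (H - 3/2))
      \<le> indicator {0..1} v *\<^sub>R ?g v"
    using AE_lborel_singleton[of "0::real"]
  proof eventually_elim
    case (elim v)
    show ?case
    proof (cases "v \<in> {0..1}")
      case True
      with elim have v: "0 < v" "v \<le> 1" by auto
      have "(v + real n - 1) powr (H - 1/2) \<le> real n powr (H - 1/2)"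
        using v assms H_gt by (intro powr_mono2) auto
      moreover have "(v + real n - 1 - x) powr (H - 3/2) \<le> (v + (real m - 1)) powr (H - 3/2)"
        using v assms a m by (intro powr_mono2') auto
      ultimately show ?thesis using True by (auto intro!: mult_mono)
    qed simp
  qed
  show "set_integrable lborel {0..1} (\<lambda>v. (v + real n - 1) powr (H - 1/2) * (v + real n - 1 - x) powr (H - 3/2))"
    unfolding set_integrable_def
    by (rule Bochner_Integration.integrable_bound[OF int3]) (use ae in \<open>auto simp: abs_mult\<close>)
  have "(LBINT v:{0..1}. (v + real n - 1) powr (H - 1/2) * (v + real n - 1 - x) powr (H - 3/2))
      \<le> (LBINT v:{0..1}. ?g v)"
    unfolding set_lebesgue_integral_def
    by (rule integral_mono_AE'[OF int3 ae]) auto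
  also have "\<dots> = real n powr (H - 1/2) * (LBINT x:{real m - 1..real m}. x powr (H - 3/2))"
    by (simp flip: val2)
  also have "\<dots> \<le> real n powr (H - 1/2) * (2 / (H - 1/2) * real (n - i) powr (H - 3/2))"
    using powr_unit_interval(2)[OF a m(1)]
    by (intro mult_left_mono) (auto simp: m_def algebra_simps)
  finally show "(LBINT v:{0..1}. (v + real n - 1) powr (H - 1/2) * (v + real n - 1 - x) powr (H - 3/2))
      \<le> real n powr (H - 1/2) * (2 / (H - 1/2) * real (n - i) powr (H - 3/2))" .
qed

definition coef_const :: real where "coef_const = prefactor * (2 / (H - 1/2)) * (2 / (3/2 - H))"

lemma coef_const_pos: "coef_const > 0" unfolding coef_const_def using prefactor_pos H_gt H_lt by simp

text \<open>On the domain of integration \<open>x\<close> is of order \<open>i\<close>, \<open>v + n - 1\<close> of order \<open>n\<close> and \<open>v + n - 1 - x\<close> of order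
\<open>n - i\<close>; each power becomes one factor of the bound.\<close>

lemma jcoef_le:
  assumes "1 \<le> i" "i < n"
  shows "set_integrable lborel {real i - 1..real i} (\<lambda>x. x powr (1/2 - H) *
      (LBINT v:{0..1}. (v + real n - 1) powr (H - 1/2) * (v + real n - 1 - x) powr (H - 3/2)))"
    and "jcoef H \<sigma> n i \<le> coef_const * real n powr (H - 1/2) * real i powr (1/2 - H) * real (n - i) powr (H - 3/2)"
proof -
  have a: "-1 < 1/2 - H" "1/2 - H \<le> 0" using H_gt H_lt by auto
  define R where "R = real n powr (H - 1/2) * (2 / (H - 1/2) * real (n - i) powr (H - 3/2))"
  have R: "R \<ge> 0" unfolding R_def using H_gt by simp
  note int = powr_unit_interval[OF a assms(1)]
  have intR: "integrable lborel (\<lambda>x. indicator {real i - 1..real i} x *\<^sub>R (x powr (1/2 - H) * R))"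
      using integrable_mult_left[OF int(1)[unfolded set_integrable_def], of R] by (simp add: mult.assoc)
  let ?I = "\<lambda>x. LBINT v:{0..1}. (v + real n - 1) powr (H - 1/2) * (v + real n - 1 - x) powr (H - 3/2)"
  have up: "indicator {real i - 1..real i} x *\<^sub>R (x powr (1/2 - H) * ?I x)
       \<le> indicator {real i - 1..real i} x *\<^sub>R (x powr (1/2 - H) * R)" for x
    using mult_left_mono[OF inner_integral(2)[OF assms, of x, folded R_def], of "x powr (1/2 - H)"]
    by (auto simp: indicator_def)
  have I_nonneg: "0 \<le> ?I x" for x
    by (auto simp: set_lebesgue_integral_def intro!: integral_nonneg_AE)
  have [measurable]: "?I \<in> borel_measurable borel"
    unfolding set_lebesgue_integral_def by measurable
  show "set_integrable lborel {real i - 1..real i} (\<lambda>x. x powr (1/2 - H) * ?I x)"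
    unfolding set_integrable_def
    by (rule Bochner_Integration.integrable_bound[OF intR])
       (use up I_nonneg R in \<open>auto simp: abs_mult\<close>)
  have "(LBINT x:{real i - 1..real i}. x powr (1/2 - H) * ?I x)
      \<le> (LBINT x:{real i - 1..real i}. x powr (1/2 - H) * R)"
    unfolding set_lebesgue_integral_def[of _ "{real i - 1..real i}"]
  proof (rule integral_mono'[OF intR])
    fix x :: real
    show "0 \<le> indicator {real i - 1..real i} x *\<^sub>R (x powr (1/2 - H) * R)" using R by simp
    show "indicator {real i - 1..real i} x *\<^sub>R (x powr (1/2 - H) *
        (LBINT v:{0..1}. (v + real n - 1) powr (H - 1/2) * (v + real n - 1 - x) powr (H - 3/2)))
       \<le> indicator {real i - 1..real i} x *\<^sub>R (x powr (1/2 - H) * R)"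
      using up[of x] by simp
  qed
  also have "\<dots> = (LBINT x:{real i - 1..real i}. x powr (1/2 - H)) * R" by simp
  also have "\<dots> \<le> 2 / (1/2 - H + 1) * real i powr (1/2 - H) * R"
    using int(2) R by (intro mult_right_mono) auto
  finally have "jcoef H \<sigma> n i \<le> prefactor * (2 / (1/2 - H + 1) * real i powr (1/2 - H) * R)"
    unfolding jcoef_def prefactor_def[symmetric] using prefactor_pos by (intro mult_left_mono) auto
  also have "1/2 - H + 1 = 3/2 - H" by simp
  finally show "jcoef H \<sigma> n i \<le> coef_const * real n powr (H - 1/2) * real i powr (1/2 - H) * real (n - i) powr (H - 3/2)"
    by (simp add: R_def coef_const_def ac_simps)
qed

text \<open>The power of \<open>x\<close> contributes \<open>n powr (1/2 - H)\<close> and the inner integral \<open>n powr (H - 1/2)\<close>, so that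
the orders cancel.\<close>

lemma gcoef_le:
  assumes "1 \<le> n"
  shows "gcoef H \<sigma> n \<le> coef_const"
proof -
  have a: "-1 < 1/2 - H" "1/2 - H \<le> 0" using H_gt H_lt by auto
  have b: "-1 < H - 3/2" "H - 3/2 \<le> 0" using H_gt H_lt by auto
  note int = powr_unit_interval[OF a assms(1)]
  note intb = powr_unit_interval[OF b order_refl, simplified]
  define R where "R = real n powr (H - 1/2) * (2 / (H - 1/2))"
  have R: "R \<ge> 0" unfolding R_def using H_gt by simp
  have inner: "(LBINT y:{0..1}. (y * (real n - x) + x) powr (H - 1/2) * y powr (H - 3/2)) \<le> R"
    if x: "real n - 1 \<le> x" "x \<le> real n" for x
  proof -
    have "(LBINT y:{0..1}. (y * (real n - x) + x) powr (H - 1/2) * y powr (H - 3/2))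
       \<le> (LBINT y:{0..1}. real n powr (H - 1/2) * y powr (H - 3/2))"
      unfolding set_lebesgue_integral_def
    proof (rule integral_mono')
      show "integrable lborel (\<lambda>y. indicator {0..1} y *\<^sub>R (real n powr (H - 1/2) * y powr (H - 3/2)))"
        using integrable_mult_right[OF intb(1)[unfolded set_integrable_def], of "real n powr (H - 1/2)"]
        by (simp add: mult.left_commute)
      fix y :: real
      have "(y * (real n - x) + x) powr (H - 1/2) \<le> real n powr (H - 1/2)" if y: "0 \<le> y" "y \<le> 1"
      proof (rule powr_mono2)
        have "y * (real n - x) \<le> 1 * (real n - x)" using x y by (intro mult_right_mono) auto
        then show "y * (real n - x) + x \<le> real n" by simp
        show "0 \<le> y * (real n - x) + x" using x y assms by (intro add_nonneg_nonneg mult_nonneg_nonneg) auto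
      qed (use H_gt in auto)
      then show "indicator {0..1} y *\<^sub>R ((y * (real n - x) + x) powr (H - 1/2) * y powr (H - 3/2))
         \<le> indicator {0..1} y *\<^sub>R (real n powr (H - 1/2) * y powr (H - 3/2))"
        by (auto simp: indicator_def intro!: mult_right_mono)
    qed auto
    also have "\<dots> = real n powr (H - 1/2) * (LBINT y:{0..1}. y powr (H - 3/2))" by simp
    also have "\<dots> \<le> R" unfolding R_def using intb(2)
      by (intro mult_left_mono) (auto simp: algebra_simps)
    finally show ?thesis .
  qed
  have "(LBINT x:{real n - 1..real n}. x powr (1/2 - H) * (real n - x) powr (H - 1/2) *
        (LBINT y:{0..1}. (y * (real n - x) + x) powr (H - 1/2) * y powr (H - 3/2)))
      \<le> (LBINT x:{real n - 1..real n}. x powr (1/2 - H) * R)"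
    unfolding set_lebesgue_integral_def[of _ "{real n - 1..real n}"]
  proof (rule integral_mono')
    show "integrable lborel (\<lambda>x. indicator {real n - 1..real n} x *\<^sub>R (x powr (1/2 - H) * R))"
      using integrable_mult_left[OF int(1)[unfolded set_integrable_def], of R] by (simp add: mult.assoc)
    fix x :: real
    show "0 \<le> indicator {real n - 1..real n} x *\<^sub>R (x powr (1/2 - H) * R)" using R by simp
    show "indicator {real n - 1..real n} x *\<^sub>R (x powr (1/2 - H) * (real n - x) powr (H - 1/2) *
        (LBINT y:{0..1}. (y * (real n - x) + x) powr (H - 1/2) * y powr (H - 3/2)))
       \<le> indicator {real n - 1..real n} x *\<^sub>R (x powr (1/2 - H) * R)"
    proof (cases "x \<in> {real n - 1..real n}")
      case True
      have "(real n - x) powr (H - 1/2) \<le> 1 powr (H - 1/2)"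
        using True H_gt by (intro powr_mono2) auto
      then have "(x powr (1/2 - H) * (real n - x) powr (H - 1/2)) *
        (LBINT y:{0..1}. (y * (real n - x) + x) powr (H - 1/2) * y powr (H - 3/2))
         \<le> (x powr (1/2 - H) * 1) * R"
        using inner[of x] True R
        by (intro mult_mono mult_nonneg_nonneg)
           (auto simp: set_lebesgue_integral_def intro!: integral_nonneg_AE)
      with True show ?thesis by simp
    qed simp
  qed
  also have "\<dots> = (LBINT x:{real n - 1..real n}. x powr (1/2 - H)) * R" by simp
  also have "\<dots> \<le> 2 / (1/2 - H + 1) * real n powr (1/2 - H) * R"
    using int(2) R by (intro mult_right_mono) auto
  finally have "gcoef H \<sigma> n \<le> prefactor * (2 / (1/2 - H + 1) * real n powr (1/2 - H) * R)"
    unfolding gcoef_def prefactor_def[symmetric] using prefactor_pos by (intro mult_left_mono) auto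
  also have "\<dots> = coef_const * (real n powr (1/2 - H) * real n powr (H - 1/2))"
    by (simp add: R_def coef_const_def ac_simps)
  also have "real n powr (1/2 - H) * real n powr (H - 1/2) = 1"
    using assms by (simp flip: powr_add)
  finally show ?thesis by simp
qed

definition coef_low :: real where "coef_low = prefactor * (2 powr (1/2 - H) * 3 powr (H - 3/2))"

lemma coef_low_pos: "coef_low > 0" unfolding coef_low_def using prefactor_pos by simp

text \<open>The last two coefficients of every row stay away from \<open>0\<close>: there \<open>v + n - 1 - x \<le> 3\<close>, while \<open>x \<le> n\<close> and
\<open>v + n - 1 \<ge> n / 2\<close>, and the powers of \<open>n\<close> cancel. This is the source of the positive drift.\<close>

lemma jcoef_ge:
  assumes "1 \<le> i" "i < n" "n \<le> i + 2"
  shows "jcoef H \<sigma> n i \<ge> coef_low"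
proof -
  let ?I = "\<lambda>x. LBINT v:{0..1}. (v + real n - 1) powr (H - 1/2) * (v + real n - 1 - x) powr (H - 3/2)"
  define c where "c = (real n / 2) powr (H - 1/2) * 3 powr (H - 3/2)"
  have c: "c \<ge> 0" unfolding c_def by simp
  have in_ge: "c \<le> ?I x" if x: "real i - 1 \<le> x" "x \<le> real i" for x
  proof -
    have "c = (LBINT v:{0::real..1}. c)" by (simp add: set_lebesgue_integral_def)
    also have "\<dots> \<le> ?I x"
    proof (rule set_integral_mono_AE)
      show "set_integrable lborel {0::real..1} (\<lambda>v. c)" by (simp add: set_integrable_def integrable_mult_left)
      show "AE v\<in>{0..1} in lborel. c \<le> (v + real n - 1) powr (H - 1/2) * (v + real n - 1 - x) powr (H - 3/2)"
        using AE_lborel_singleton[of "0::real"]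
      proof eventually_elim
        case (elim v)
        show ?case unfolding c_def
        proof (intro impI mult_mono)
          assume v: "v \<in> {0..1}"
          show "(real n / 2) powr (H - 1/2) \<le> (v + real n - 1) powr (H - 1/2)"
            using v assms H_gt by (intro powr_mono2) auto
          show "3 powr (H - 3/2) \<le> (v + real n - 1 - x) powr (H - 3/2)"
            using v elim x assms H_lt by (intro powr_mono2') auto
        qed auto
      qed
    qed (rule inner_integral(1)[OF assms(1,2) x])
    finally show ?thesis .
  qed
  have "real n powr (1/2 - H) * c = (LBINT x:{real i - 1..real i}. real n powr (1/2 - H) * c)"
    by (simp add: set_lebesgue_integral_def)
  also have "\<dots> \<le> (LBINT x:{real i - 1..real i}. x powr (1/2 - H) * ?I x)"
  proof (rule set_integral_mono_AE)
    show "set_integrable lborel {real i - 1..real i} (\<lambda>v. real n powr (1/2 - H) * c)" by (simp add: set_integrable_def)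
    show "AE x\<in>{real i - 1..real i} in lborel. real n powr (1/2 - H) * c \<le> x powr (1/2 - H) * ?I x"
      using AE_lborel_singleton[of "0::real"]
    proof eventually_elim
      case (elim x)
      show ?case
      proof (intro impI mult_mono)
        assume x: "x \<in> {real i - 1..real i}"
        show "real n powr (1/2 - H) \<le> x powr (1/2 - H)"
          using x elim assms H_gt by (intro powr_mono2') auto
      qed (use in_ge c in auto)
    qed
  qed (rule jcoef_le(1)[OF assms(1,2)])
  finally have "prefactor * (real n powr (1/2 - H) * c) \<le> jcoef H \<sigma> n i"
    unfolding jcoef_def prefactor_def[symmetric] using prefactor_pos by (intro mult_left_mono) auto
  moreover have "real n powr (1/2 - H) * c = 2 powr (1/2 - H) * 3 powr (H - 3/2)"
  proof -
    have "real n powr (1/2 - H) * c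
       = (real n powr (1/2 - H) * real n powr (H - 1/2)) * (1 / 2 powr (H - 1/2)) * 3 powr (H - 3/2)"
      using assms by (simp add: c_def powr_divide)
    also have "real n powr (1/2 - H) * real n powr (H - 1/2) = 1"
      using assms by (simp flip: powr_add)
    also have "1 / 2 powr (H - 1/2) = (2::real) powr (1/2 - H)"
      by (simp flip: powr_minus_divide)
    finally show ?thesis by simp
  qed
  ultimately show ?thesis by (simp add: coef_low_def)
qed

text \<open>Coefficients on all of \<open>\<nat> \<times> \<nat>\<close>, so that \<open>\<Sum>i\<close> may range over any common index set.\<close>

definition J :: "nat \<Rightarrow> nat \<Rightarrow> real" where
  "J k i = (if 1 \<le> i \<and> i < k then jcoef H \<sigma> k i else 0)"

lemma J_nonneg: "J k i \<ge> 0" by (simp add: J_def jcoef_nonneg)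

lemma J_zero: "k \<le> i \<Longrightarrow> J k i = 0" "J k 0 = 0" by (auto simp: J_def)

text \<open>One of the distances \<open>i\<close> and \<open>n - i\<close> is at least \<open>n / 2\<close>, which freezes one of the two powers. Discrete
beta sums thus reduce to power sums.\<close>

lemma powr_split:
  fixes p q :: real
  assumes "p \<le> 0" "q \<le> 0" "1 \<le> i" "i < n"
  shows "real i powr p * real (n - i) powr q
    \<le> (real n / 2) powr p * real (n - i) powr q + real i powr p * (real n / 2) powr q"
proof (cases "real n / 2 \<le> real i")
  case True
  then have "real i powr p \<le> (real n / 2) powr p"
    using assms by (intro powr_mono2') auto
  then have "real i powr p * real (n - i) powr q \<le> (real n / 2) powr p * real (n - i) powr q"
    by (intro mult_right_mono) auto
  then show ?thesis by (simp add: add_increasing2)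
next
  case False
  then have "real (n - i) powr q \<le> (real n / 2) powr q"
    using assms by (intro powr_mono2') (auto simp: of_nat_diff)
  then have "real i powr p * real (n - i) powr q \<le> real i powr p * (real n / 2) powr q"
    by (intro mult_left_mono) auto
  then show ?thesis by (simp add: add_increasing)
qed

lemma sum_reflect: "(\<Sum>i=1..<n. f (n - i)) = (\<Sum>i=1..<n. f i)" for f :: "nat \<Rightarrow> real"
  by (rule sum.reindex_bij_witness[of _ "\<lambda>i. n - i" "\<lambda>i. n - i"]) auto

lemma sum_powr_less_le:
  fixes p :: real
  assumes "-1 < p" "p \<le> 0"
  shows "(\<Sum>i=1..<n. real i powr p) \<le> real n powr (p + 1) / (p + 1)"
  by (rule order_trans[OF sum_mono2 sum_powr_le[OF assms]]) auto

lemma half_powr: "(real n / 2) powr p = real n powr p * 2 powr (- p)"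
  by (simp add: powr_divide powr_minus field_simps)

definition row_sum_const :: real where
  "row_sum_const = coef_const * (2 powr (H - 1/2) / (H - 1/2) + 2 powr (3/2 - H) / (3/2 - H))"

text \<open>The exponents \<open>1/2 - H\<close> and \<open>H - 3/2\<close> of \<open>jcoef_le\<close> exceed \<open>-1\<close> and add up to \<open>-1\<close>, so their beta sum is
bounded and only the factor \<open>n powr (H - 1/2)\<close> is left.\<close>

lemma sum_jcoef_le:
  assumes "n \<ge> 1"
  shows "(\<Sum>i=1..<n. jcoef H \<sigma> n i) \<le> row_sum_const * real n powr (H - 1/2)"
proof -
  let ?p = "1/2 - H" let ?q = "H - 3/2"
  have "(\<Sum>i=1..<n. real i powr ?p * real (n - i) powr ?q)
     \<le> (\<Sum>i=1..<n. (real n / 2) powr ?p * real (n - i) powr ?q + real i powr ?p * (real n / 2) powr ?q)"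
    using H_gt H_lt by (intro sum_mono powr_split) auto
  also have "\<dots> = (real n / 2) powr ?p * (\<Sum>i=1..<n. real i powr ?q) + (\<Sum>i=1..<n. real i powr ?p) * (real n / 2) powr ?q"
    by (simp only: sum.distrib sum_distrib_left[symmetric] sum_distrib_right[symmetric] sum_reflect[of "\<lambda>i. real i powr ?q"])
  also have "\<dots> \<le> (real n / 2) powr ?p * (real n powr (?q + 1) / (?q + 1))
      + (real n powr (?p + 1) / (?p + 1)) * (real n / 2) powr ?q"
    using H_gt H_lt by (intro add_mono mult_left_mono mult_right_mono sum_powr_less_le) auto
  also have "\<dots> = (real n powr ?p * real n powr (?q + 1)) * (2 powr (- ?p) / (?q + 1))
      + (real n powr (?p + 1) * real n powr ?q) * (2 powr (- ?q) / (?p + 1))"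
    unfolding half_powr by (simp add: ac_simps)
  also have "\<dots> = 2 powr (H - 1/2) / (H - 1/2) + 2 powr (3/2 - H) / (3/2 - H)"
    using assms by (simp flip: powr_add)
  finally have s: "(\<Sum>i=1..<n. real i powr ?p * real (n - i) powr ?q)
     \<le> 2 powr (H - 1/2) / (H - 1/2) + 2 powr (3/2 - H) / (3/2 - H)" .
  have "(\<Sum>i=1..<n. jcoef H \<sigma> n i) \<le> (\<Sum>i=1..<n. coef_const * real n powr (H - 1/2) * real i powr ?p * real (n - i) powr ?q)"
    by (intro sum_mono jcoef_le) auto
  also have "\<dots> = coef_const * real n powr (H - 1/2) * (\<Sum>i=1..<n. real i powr ?p * real (n - i) powr ?q)"
    by (simp add: sum_distrib_left mult.assoc)
  also have "\<dots> \<le> coef_const * real n powr (H - 1/2) * (2 powr (H - 1/2) / (H - 1/2) + 2 powr (3/2 - H) / (3/2 - H))"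
    using s coef_const_pos by (intro mult_left_mono) auto
  finally show ?thesis by (simp add: row_sum_const_def ac_simps)
qed

definition row_sq_const :: real where
  "row_sq_const = coef_const\<^sup>2 * (2 powr (2 * H - 1) * (\<Sum>m. real m powr (2 * H - 3)) + 2 powr (3 - 2 * H) / (2 - 2 * H))"

text \<open>Unlike the row sums, the sums of squares are bounded in \<open>n\<close>, because the squared kernel
\<open>(n - i) powr (2 * H - 3)\<close> is summable. They are the second moments of \<open>Y n\<close>.\<close>

lemma sum_jcoef_sq_le:
  assumes "n \<ge> 1"
  shows "(\<Sum>i=1..<n. (jcoef H \<sigma> n i)\<^sup>2) \<le> row_sq_const"
proof -
  let ?p = "1 - 2 * H" let ?q = "2 * H - 3"
  have summ: "summable (\<lambda>m. real m powr ?q)"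
    using H_lt by (simp add: summable_real_powr_iff)
  have sm: "(\<Sum>i=1..<n. real i powr ?q) \<le> (\<Sum>m. real m powr ?q)"
    by (rule sum_le_suminf[OF summ]) auto
  have sqp: "(real m powr a)\<^sup>2 = real m powr (2 * a)" for m a
    by (simp add: power2_eq_square flip: powr_add)
  have "(\<Sum>i=1..<n. real i powr ?p * real (n - i) powr ?q)
     \<le> (\<Sum>i=1..<n. (real n / 2) powr ?p * real (n - i) powr ?q + real i powr ?p * (real n / 2) powr ?q)"
    using H_gt H_lt by (intro sum_mono powr_split) auto
  also have "\<dots> = (real n / 2) powr ?p * (\<Sum>i=1..<n. real i powr ?q) + (\<Sum>i=1..<n. real i powr ?p) * (real n / 2) powr ?q"
    by (simp only: sum.distrib sum_distrib_left[symmetric] sum_distrib_right[symmetric] sum_reflect[of "\<lambda>i. real i powr ?q"])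
  also have "\<dots> \<le> (real n / 2) powr ?p * (\<Sum>m. real m powr ?q)
      + (real n powr (?p + 1) / (?p + 1)) * (real n / 2) powr ?q"
    using H_gt H_lt sm by (intro add_mono mult_left_mono mult_right_mono sum_powr_less_le) auto
  finally have s: "(\<Sum>i=1..<n. real i powr ?p * real (n - i) powr ?q)
     \<le> (real n / 2) powr ?p * (\<Sum>m. real m powr ?q) + (real n powr (?p + 1) / (?p + 1)) * (real n / 2) powr ?q" .
  have "(\<Sum>i=1..<n. (jcoef H \<sigma> n i)\<^sup>2)
     \<le> (\<Sum>i=1..<n. (coef_const * real n powr (H - 1/2) * real i powr (1/2 - H) * real (n - i) powr (H - 3/2))\<^sup>2)"
    by (intro sum_mono power_mono jcoef_le jcoef_nonneg) auto
  also have "\<dots> = coef_const\<^sup>2 * real n powr (2 * H - 1) * (\<Sum>i=1..<n. real i powr ?p * real (n - i) powr ?q)"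
    by (simp only: sum_distrib_left power_mult_distrib sqp) (simp add: algebra_simps)
  also have "\<dots> \<le> coef_const\<^sup>2 * real n powr (2 * H - 1) * ((real n / 2) powr ?p * (\<Sum>m. real m powr ?q)
      + (real n powr (?p + 1) / (?p + 1)) * (real n / 2) powr ?q)"
    using s by (intro mult_left_mono) auto
  also have "\<dots> = coef_const\<^sup>2 * ((real n powr (2 * H - 1) * real n powr ?p) * (2 powr (- ?p) * (\<Sum>m. real m powr ?q))
      + (real n powr (2 * H - 1) * real n powr (?p + 1) * real n powr ?q) * (2 powr (- ?q) / (?p + 1)))"
    unfolding half_powr by (simp add: algebra_simps)
  also have "\<dots> = coef_const\<^sup>2 * (2 powr (- ?p) * (\<Sum>m. real m powr ?q) + real n powr (2 * H - 2) * (2 powr (- ?q) / (?p + 1)))"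
  proof -
    have "real n powr (2 * H - 1) * real n powr ?p = 1"
      using assms by (simp flip: powr_add)
    moreover have "real n powr (2 * H - 1) * real n powr (?p + 1) * real n powr ?q = real n powr (2 * H - 2)"
      by (simp only: powr_add[symmetric]) simp
    ultimately show ?thesis by (simp only: mult_1_left)
  qed
  also have "\<dots> \<le> coef_const\<^sup>2 * (2 powr (- ?p) * (\<Sum>m. real m powr ?q) + 1 * (2 powr (- ?q) / (?p + 1)))"
  proof -
    have "real n powr (2 * H - 2) \<le> 1 powr (2 * H - 2)"
      using assms H_lt by (intro powr_mono2') auto
    then show ?thesis using H_lt by (intro mult_left_mono add_left_mono mult_right_mono) auto
  qed
  finally show ?thesis by (simp add: row_sq_const_def algebra_simps)
qed

lemma sum_J_sq_le:
  assumes "n \<ge> k"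
  shows "(\<Sum>i=1..n. (J k i)\<^sup>2) \<le> row_sq_const"
proof (cases "k \<ge> 1")
  case True
  have "(\<Sum>i=1..n. (J k i)\<^sup>2) = (\<Sum>i=1..<k. (jcoef H \<sigma> k i)\<^sup>2)"
    using assms by (intro sum.mono_neutral_cong_right) (auto simp: J_def)
  with sum_jcoef_sq_le[OF True] show ?thesis by simp
next
  case False
  have "row_sq_const \<ge> 0" using sum_jcoef_sq_le[of 1] by simp
  then show ?thesis using False by (simp add: J_def)
qed

definition col_sq_const :: real where "col_sq_const = 4 * (coef_const / (H - 1/2))\<^sup>2 / (2 - 2 * H)"

lemma sum_J_col_le:
  assumes "1 \<le> i" "i \<le> n"
  shows "(\<Sum>k=1..n. J k i) \<le> coef_const / (H - 1/2) * real i powr (1/2 - H) * real n powr (2 * H - 1)"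
proof -
  have "(\<Sum>k=1..n. J k i) = (\<Sum>k=i+1..n. jcoef H \<sigma> k i)"
    using assms by (intro sum.mono_neutral_cong_right) (auto simp: J_def)
  also have "\<dots> \<le> (\<Sum>k=i+1..n. coef_const * real n powr (H - 1/2) * real i powr (1/2 - H) * real (k - i) powr (H - 3/2))"
  proof (rule sum_mono)
    fix k assume k: "k \<in> {i+1..n}"
    have "jcoef H \<sigma> k i \<le> coef_const * real k powr (H - 1/2) * real i powr (1/2 - H) * real (k - i) powr (H - 3/2)"
      using k assms by (intro jcoef_le) auto
    also have "\<dots> \<le> coef_const * real n powr (H - 1/2) * real i powr (1/2 - H) * real (k - i) powr (H - 3/2)"
      using k H_gt coef_const_pos by (intro mult_right_mono mult_left_mono powr_mono2) auto
    finally show "jcoef H \<sigma> k i \<le> coef_const * real n powr (H - 1/2) * real i powr (1/2 - H) * real (k - i) powr (H - 3/2)" .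
  qed
  also have "\<dots> = coef_const * real n powr (H - 1/2) * real i powr (1/2 - H) * (\<Sum>k=i+1..n. real (k - i) powr (H - 3/2))"
    by (simp add: sum_distrib_left)
  also have "(\<Sum>k=i+1..n. real (k - i) powr (H - 3/2)) = (\<Sum>m=1..n-i. real m powr (H - 3/2))"
    using assms by (intro sum.reindex_bij_witness[of _ "\<lambda>m. m + i" "\<lambda>k. k - i"]) auto
  also have "coef_const * real n powr (H - 1/2) * real i powr (1/2 - H) * (\<Sum>m=1..n-i. real m powr (H - 3/2))
      \<le> coef_const * real n powr (H - 1/2) * real i powr (1/2 - H) * (real n powr (H - 1/2) / (H - 1/2))"
  proof (intro mult_left_mono)
    have "(\<Sum>m=1..n-i. real m powr (H - 3/2)) \<le> (\<Sum>m=1..n. real m powr (H - 3/2))"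
      by (intro sum_mono2) auto
    also have "\<dots> \<le> real n powr (H - 3/2 + 1) / (H - 3/2 + 1)"
      using H_gt H_lt by (intro sum_powr_le) auto
    finally show "(\<Sum>m=1..n-i. real m powr (H - 3/2)) \<le> real n powr (H - 1/2) / (H - 1/2)" by simp
  qed (use coef_const_pos in auto)
  also have "\<dots> = coef_const / (H - 1/2) * real i powr (1/2 - H) * (real n powr (H - 1/2) * real n powr (H - 1/2))"
    by simp
  also have "real n powr (H - 1/2) * real n powr (H - 1/2) = real n powr (2 * H - 1)"
    by (simp flip: powr_add)
  finally show ?thesis .
qed

text \<open>The left-hand side is the second moment of the sum of all \<open>Y k + Y (k - 1)\<close> with \<open>k \<le> n\<close>; the order
\<open>n powr (2 * H)\<close> is that of the variance of fractional Brownian motion at time \<open>n\<close>.\<close>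

lemma sum_J_col_sq_le:
  "(\<Sum>i=1..n. (\<Sum>k=1..n. J k i + J (k - 1) i)\<^sup>2) \<le> col_sq_const * real n powr (2 * H)"
proof (cases "n \<ge> 1")
  case True
  define c where "c = 2 * (coef_const / (H - 1/2))"
  have sqp: "(real m powr a)\<^sup>2 = real m powr (2 * a)" for m a
    by (simp add: power2_eq_square flip: powr_add)
  have "(\<Sum>i=1..n. (\<Sum>k=1..n. J k i + J (k - 1) i)\<^sup>2)
     \<le> (\<Sum>i=1..n. (c * real i powr (1/2 - H) * real n powr (2 * H - 1))\<^sup>2)"
  proof (intro sum_mono power_mono)
    fix i assume i: "i \<in> {1..n}"
    have "(\<Sum>k=1..n. J (k - 1) i) = (\<Sum>k=0..n-1. J k i)"
      using True by (intro sum.reindex_bij_witness[of _ "\<lambda>k. k + 1" "\<lambda>k. k - 1"]) auto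
    also have "\<dots> \<le> (\<Sum>k=0..n. J k i)"
      by (intro sum_mono2) (auto simp: J_nonneg)
    also have "\<dots> = (\<Sum>k=1..n. J k i)"
      by (intro sum.mono_neutral_right) (auto simp: J_def)
    finally have "(\<Sum>k=1..n. J k i + J (k - 1) i) \<le> 2 * (\<Sum>k=1..n. J k i)"
      by (simp add: sum.distrib)
    with sum_J_col_le[of i n] i
    show "(\<Sum>k=1..n. J k i + J (k - 1) i) \<le> c * real i powr (1/2 - H) * real n powr (2 * H - 1)"
      unfolding c_def by simp
  qed (auto intro!: sum_nonneg add_nonneg_nonneg J_nonneg)
  also have "\<dots> = c\<^sup>2 * real n powr (4 * H - 2) * (\<Sum>i=1..n. real i powr (1 - 2 * H))"
    by (simp only: power_mult_distrib sqp sum_distrib_left) (simp add: algebra_simps)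
  also have "\<dots> \<le> c\<^sup>2 * real n powr (4 * H - 2) * (real n powr (1 - 2 * H + 1) / (1 - 2 * H + 1))"
    using H_gt H_lt by (intro mult_left_mono sum_powr_le) auto
  also have "\<dots> = c\<^sup>2 / (2 - 2 * H) * (real n powr (4 * H - 2) * real n powr (1 - 2 * H + 1))"
    by simp
  also have "real n powr (4 * H - 2) * real n powr (1 - 2 * H + 1) = real n powr (2 * H)"
    by (simp flip: powr_add)
  also have "c\<^sup>2 / (2 - 2 * H) = col_sq_const" unfolding col_sq_const_def c_def by (simp only: power_mult_distrib) simp
  finally show ?thesis .
qed (use H_lt in \<open>simp add: col_sq_const_def\<close>)

end

section \<open>Gram matrices\<close>

text \<open>When the \<open>c i\<close> are multiples of random signs, the first sum on the right is deterministic and the second is a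
martingale transform.\<close>

lemma square_of_sum:
  fixes c :: "nat \<Rightarrow> real"
  shows "(\<Sum>i=1..n. c i)\<^sup>2 = (\<Sum>i=1..n. (c i)\<^sup>2) + (\<Sum>l=1..n. c l * (2 * (\<Sum>i=1..l-1. c i)))"
proof (induction n)
  case (Suc n)
  have "(\<Sum>i=1..Suc n. c i)\<^sup>2 = (\<Sum>i=1..n. c i)\<^sup>2 + (c (Suc n))\<^sup>2 + c (Suc n) * (2 * (\<Sum>i=1..n. c i))"
    by (simp add: power2_sum)
  with Suc show ?case by simp
qed simp

text \<open>The Gram matrices of the columns and of the rows of \<open>a\<close> have the same Frobenius norm.\<close>

lemma gram_frobenius:
  fixes a :: "nat \<Rightarrow> nat \<Rightarrow> real"
  shows "(\<Sum>i\<in>A. \<Sum>l\<in>A. (\<Sum>k\<in>B. a k i * a k l)\<^sup>2) = (\<Sum>k\<in>B. \<Sum>k'\<in>B. (\<Sum>i\<in>A. a k i * a k' i)\<^sup>2)"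
proof -
  have "(\<Sum>i\<in>A. \<Sum>l\<in>A. (\<Sum>k\<in>B. a k i * a k l)\<^sup>2)
     = (\<Sum>i\<in>A. \<Sum>l\<in>A. \<Sum>k\<in>B. \<Sum>k'\<in>B. (a k i * a k l) * (a k' i * a k' l))"
    by (simp add: power2_eq_square sum_product)
  also have "\<dots> = (\<Sum>i\<in>A. \<Sum>k\<in>B. \<Sum>l\<in>A. \<Sum>k'\<in>B. (a k i * a k l) * (a k' i * a k' l))"
    by (intro sum.cong refl sum.swap)
  also have "\<dots> = (\<Sum>k\<in>B. \<Sum>i\<in>A. \<Sum>l\<in>A. \<Sum>k'\<in>B. (a k i * a k l) * (a k' i * a k' l))"
    by (rule sum.swap)
  also have "\<dots> = (\<Sum>k\<in>B. \<Sum>i\<in>A. \<Sum>k'\<in>B. \<Sum>l\<in>A. (a k i * a k l) * (a k' i * a k' l))"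
    by (intro sum.cong refl sum.swap)
  also have "\<dots> = (\<Sum>k\<in>B. \<Sum>k'\<in>B. \<Sum>i\<in>A. \<Sum>l\<in>A. (a k i * a k l) * (a k' i * a k' l))"
    by (intro sum.cong refl sum.swap)
  also have "\<dots> = (\<Sum>k\<in>B. \<Sum>k'\<in>B. (\<Sum>i\<in>A. a k i * a k' i)\<^sup>2)"
    unfolding power2_eq_square sum_product by (intro sum.cong refl) (simp add: ac_simps)
  finally show ?thesis .
qed

text \<open>The entries of the Gram matrix of the rows of \<open>b\<close> lie between \<open>0\<close> and \<open>R\<close>, so that their squares are at most
\<open>R\<close> times the entries, and the entries add up to the sum of the squared column sums.\<close>

lemma gram_sq_le:
  fixes a b :: "nat \<Rightarrow> nat \<Rightarrow> real"
  assumes ab: "\<And>k i. k \<in> B \<Longrightarrow> i \<in> A \<Longrightarrow> \<bar>a k i\<bar> \<le> b k i"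
    and R: "\<And>k. k \<in> B \<Longrightarrow> (\<Sum>i\<in>A. (b k i)\<^sup>2) \<le> R"
  shows "(\<Sum>k\<in>B. \<Sum>k'\<in>B. (\<Sum>i\<in>A. a k i * a k' i)\<^sup>2) \<le> R * (\<Sum>i\<in>A. (\<Sum>k\<in>B. b k i)\<^sup>2)"
proof -
  have b0: "b k i \<ge> 0" if "k \<in> B" "i \<in> A" for k i using ab[OF that] by simp
  have step: "(\<Sum>i\<in>A. a k i * a k' i)\<^sup>2 \<le> R * (\<Sum>i\<in>A. b k i * b k' i)" if k: "k \<in> B" "k' \<in> B" for k k'
  proof -
    let ?r = "\<Sum>i\<in>A. b k i * b k' i"
    have r0: "?r \<ge> 0" using k b0 by (intro sum_nonneg mult_nonneg_nonneg) auto
    have "\<bar>\<Sum>i\<in>A. a k i * a k' i\<bar> \<le> (\<Sum>i\<in>A. \<bar>a k i * a k' i\<bar>)" by (rule sum_abs)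
    also have "\<dots> \<le> ?r"
      unfolding abs_mult using k by (intro sum_mono mult_mono ab b0) auto
    finally have 1: "\<bar>\<Sum>i\<in>A. a k i * a k' i\<bar> \<le> ?r" .
    have "?r \<le> (\<Sum>i\<in>A. ((b k i)\<^sup>2 + (b k' i)\<^sup>2) / 2)"
    proof (rule sum_mono)
      fix i
      have "0 \<le> (b k i - b k' i)\<^sup>2" by simp
      then show "b k i * b k' i \<le> ((b k i)\<^sup>2 + (b k' i)\<^sup>2) / 2" by (simp add: power2_diff)
    qed
    also have "\<dots> = ((\<Sum>i\<in>A. (b k i)\<^sup>2) + (\<Sum>i\<in>A. (b k' i)\<^sup>2)) / 2"
      by (simp add: sum.distrib flip: sum_divide_distrib)
    also have "\<dots> \<le> R" using R[OF k(1)] R[OF k(2)] by simp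
    finally have 2: "?r \<le> R" .
    have "(\<Sum>i\<in>A. a k i * a k' i)\<^sup>2 = \<bar>\<Sum>i\<in>A. a k i * a k' i\<bar> * \<bar>\<Sum>i\<in>A. a k i * a k' i\<bar>"
      by (simp add: power2_eq_square)
    also have "\<dots> \<le> R * ?r" using 1 2 r0 by (intro mult_mono) auto
    finally show ?thesis .
  qed
  have "(\<Sum>k\<in>B. \<Sum>k'\<in>B. (\<Sum>i\<in>A. a k i * a k' i)\<^sup>2) \<le> (\<Sum>k\<in>B. \<Sum>k'\<in>B. R * (\<Sum>i\<in>A. b k i * b k' i))"
    using step by (intro sum_mono) auto
  also have "\<dots> = R * (\<Sum>k\<in>B. \<Sum>k'\<in>B. \<Sum>i\<in>A. b k i * b k' i)"
    by (simp add: sum_distrib_left)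
  also have "(\<Sum>k\<in>B. \<Sum>k'\<in>B. \<Sum>i\<in>A. b k i * b k' i) = (\<Sum>k\<in>B. \<Sum>i\<in>A. \<Sum>k'\<in>B. b k i * b k' i)"
    by (intro sum.cong refl sum.swap)
  also have "\<dots> = (\<Sum>i\<in>A. \<Sum>k\<in>B. \<Sum>k'\<in>B. b k i * b k' i)" by (rule sum.swap)
  also have "\<dots> = (\<Sum>i\<in>A. (\<Sum>k\<in>B. b k i)\<^sup>2)" by (simp add: power2_eq_square sum_product)
  finally show ?thesis .
qed

section \<open>Martingale transforms of random signs\<close>

locale rademacher = prob_space M for M :: "'a measure" +
  fixes \<xi> :: "nat \<Rightarrow> 'a \<Rightarrow> real"
  assumes indep: "indep_vars (\<lambda>_. borel) \<xi> {1..}"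
    and prob_pos: "\<And>i. i \<ge> 1 \<Longrightarrow> measure M {\<omega>\<in>space M. \<xi> i \<omega> = 1} = 1/2"
    and prob_neg: "\<And>i. i \<ge> 1 \<Longrightarrow> measure M {\<omega>\<in>space M. \<xi> i \<omega> = -1} = 1/2"
begin

abbreviation F :: "nat \<Rightarrow> 'a measure" where "F \<equiv> nat_filtration M \<xi>"

lemma xi_measurable: "i \<ge> 1 \<Longrightarrow> \<xi> i \<in> borel_measurable M"
  using indep unfolding indep_vars_def by auto

lemma AE_sign: "AE \<omega> in M. \<forall>i\<ge>1. \<xi> i \<omega> = 1 \<or> \<xi> i \<omega> = -1"
proof -
  have "AE \<omega> in M. \<xi> i \<omega> = 1 \<or> \<xi> i \<omega> = -1" if "i \<ge> 1" for i
  proof -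
    note [measurable] = xi_measurable[OF that]
    have "measure M ({\<omega>\<in>space M. \<xi> i \<omega> = 1} \<union> {\<omega>\<in>space M. \<xi> i \<omega> = -1})
       = measure M {\<omega>\<in>space M. \<xi> i \<omega> = 1} + measure M {\<omega>\<in>space M. \<xi> i \<omega> = -1}"
      by (intro finite_measure_Union) auto
    then have "prob {\<omega>\<in>space M. \<xi> i \<omega> = 1 \<or> \<xi> i \<omega> = -1} = 1"
      using prob_pos[OF that] prob_neg[OF that]
      by (simp add: Collect_disj_eq[symmetric] Un_def conj_disj_distribL)
    then show ?thesis by (subst prob_Collect_eq_1[symmetric]) auto
  qed
  then have "AE \<omega> in M. i \<ge> 1 \<longrightarrow> (\<xi> i \<omega> = 1 \<or> \<xi> i \<omega> = -1)" for i by (cases "i \<ge> 1") auto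
  then show ?thesis by (simp add: AE_all_countable)
qed

lemma AE_abs_xi: "i \<ge> 1 \<Longrightarrow> AE \<omega> in M. \<bar>\<xi> i \<omega>\<bar> = 1"
  using AE_sign by eventually_elim auto

lemma AE_xi_sq: "i \<ge> 1 \<Longrightarrow> AE \<omega> in M. (\<xi> i \<omega>)\<^sup>2 = 1"
  using AE_sign by eventually_elim auto

lemma expectation_xi: assumes i: "i \<ge> 1" shows "expectation (\<xi> i) = 0"
proof -
  note [measurable] = xi_measurable[OF i]
  let ?A = "{\<omega>\<in>space M. \<xi> i \<omega> = 1}" and ?B = "{\<omega>\<in>space M. \<xi> i \<omega> = -1}"
  have "expectation (\<xi> i) = expectation (\<lambda>\<omega>. indicator ?A \<omega> - indicator ?B \<omega>)"
  proof (rule integral_cong_AE)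
    show "AE \<omega> in M. \<xi> i \<omega> = indicator ?A \<omega> - indicator ?B \<omega>"
      using AE_sign AE_space by eventually_elim (use i in \<open>force simp: indicator_def\<close>)
  qed auto
  also have "\<dots> = prob ?A - prob ?B"
    by (subst Bochner_Integration.integral_diff)
       (auto intro!: integrable_real_indicator simp: emeasure_eq_measure)
  finally show ?thesis using prob_pos[OF i] prob_neg[OF i] by simp
qed

lemma space_F: "space (F n) = space M"
  unfolding nat_filtration_def by (rule space_measure_of) auto

lemma sets_F: "sets (F n) = sigma_sets (space M) (\<Union>i\<in>{1..n}. {\<xi> i -` B \<inter> space M | B. B \<in> sets borel})"
  unfolding nat_filtration_def by (rule sets_measure_of) auto

lemma F_mono: "n \<le> m \<Longrightarrow> f \<in> borel_measurable (F n) \<Longrightarrow> f \<in> borel_measurable (F m)"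
proof (rule subsetD[OF measurable_mono[OF order_refl refl]])
  assume "n \<le> m"
  then have "{1..n} \<subseteq> {1..m}" by auto
  then show "sets (F n) \<subseteq> sets (F m)" unfolding sets_F by (intro sigma_sets_mono' UN_mono) auto
qed (auto simp: space_F)

lemma F_M: assumes "f \<in> borel_measurable (F n)" shows "f \<in> borel_measurable M"
proof -
  have "sets (F n) \<subseteq> sets M" unfolding sets_F
    by (intro sets.sigma_sets_subset) (auto intro: measurable_sets[OF xi_measurable])
  then have "borel_measurable (F n) \<subseteq> borel_measurable M"
    by (intro measurable_mono) (auto simp: space_F)
  then show ?thesis using assms by blast
qed

lemma xi_F: assumes "1 \<le> i" "i \<le> n" shows "\<xi> i \<in> borel_measurable (F n)"
proof (rule measurableI)
  fix A :: "real set" assume "A \<in> sets borel"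
  then show "\<xi> i -` A \<inter> space (F n) \<in> sets (F n)"
    unfolding sets_F space_F using assms by (intro sigma_sets.Basic UN_I[of i]) auto
qed auto

text \<open>Almost sure boundedness makes all products of such variables integrable.\<close>

definition bounded_adapted :: "nat \<Rightarrow> ('a \<Rightarrow> real) \<Rightarrow> bool" where
  "bounded_adapted n f \<longleftrightarrow> f \<in> borel_measurable (F n) \<and> (\<exists>B. AE \<omega> in M. \<bar>f \<omega>\<bar> \<le> B)"

lemma bounded_adapted_mono: "bounded_adapted n f \<Longrightarrow> n \<le> m \<Longrightarrow> bounded_adapted m f"
  unfolding bounded_adapted_def by (blast intro: F_mono)

lemma bounded_adapted_const: "bounded_adapted n (\<lambda>_. c)"
  unfolding bounded_adapted_def by auto

lemma bounded_adapted_xi: "1 \<le> i \<Longrightarrow> i \<le> n \<Longrightarrow> bounded_adapted n (\<xi> i)"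
  unfolding bounded_adapted_def
proof (intro conjI exI[of _ 1])
  assume "1 \<le> i" "i \<le> n"
  then show "\<xi> i \<in> borel_measurable (F n)" "AE \<omega> in M. \<bar>\<xi> i \<omega>\<bar> \<le> 1"
    using xi_F AE_abs_xi[of i] by auto
qed

lemma bounded_adapted_add:
  assumes "bounded_adapted n f" "bounded_adapted n g"
  shows "bounded_adapted n (\<lambda>\<omega>. f \<omega> + g \<omega>)"
proof -
  from assms obtain B C where B: "AE \<omega> in M. \<bar>f \<omega>\<bar> \<le> B" "AE \<omega> in M. \<bar>g \<omega>\<bar> \<le> C"
    and [measurable]: "f \<in> borel_measurable (F n)" "g \<in> borel_measurable (F n)"
    unfolding bounded_adapted_def by blast
  from B have "AE \<omega> in M. \<bar>f \<omega> + g \<omega>\<bar> \<le> B + C" by eventually_elim auto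
  then show ?thesis unfolding bounded_adapted_def by (intro conjI exI) measurable
qed

lemma bounded_adapted_mult:
  assumes "bounded_adapted n f" "bounded_adapted n g"
  shows "bounded_adapted n (\<lambda>\<omega>. f \<omega> * g \<omega>)"
proof -
  from assms obtain B C where B: "AE \<omega> in M. \<bar>f \<omega>\<bar> \<le> B" "AE \<omega> in M. \<bar>g \<omega>\<bar> \<le> C"
    and [measurable]: "f \<in> borel_measurable (F n)" "g \<in> borel_measurable (F n)"
    unfolding bounded_adapted_def by blast
  from B have "AE \<omega> in M. \<bar>f \<omega> * g \<omega>\<bar> \<le> B * C"
    by eventually_elim (auto simp: abs_mult intro!: mult_mono)
  then show ?thesis unfolding bounded_adapted_def by (intro conjI exI) measurable
qed

lemma bounded_adapted_sum:
  "finite A \<Longrightarrow> (\<And>i. i \<in> A \<Longrightarrow> bounded_adapted n (f i)) \<Longrightarrow> bounded_adapted n (\<lambda>\<omega>. \<Sum>i\<in>A. f i \<omega>)"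
proof (induction rule: finite_induct)
  case empty
  show ?case by (simp add: bounded_adapted_const)
next
  case (insert x A)
  then have "bounded_adapted n (\<lambda>\<omega>. f x \<omega> + (\<Sum>i\<in>A. f i \<omega>))"
    by (intro bounded_adapted_add) simp_all
  with insert.hyps show ?case by simp
qed

lemma bounded_adapted_indicator:
  assumes "{\<omega>\<in>space M. P \<omega>} \<in> sets (F n)"
  shows "bounded_adapted n (\<lambda>\<omega>. if P \<omega> then 1 else 0)"
  unfolding bounded_adapted_def
proof (intro conjI exI[of _ 1] AE_I2)
  show "(\<lambda>\<omega>. if P \<omega> then 1 else 0 :: real) \<in> borel_measurable (F n)"
    using assms by (intro measurable_If) (auto simp: space_F)
qed auto

lemma bounded_adapted_integrable: assumes "bounded_adapted n f" shows "integrable M f"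
proof -
  from assms obtain B where "AE \<omega> in M. \<bar>f \<omega>\<bar> \<le> B" "f \<in> borel_measurable (F n)"
    unfolding bounded_adapted_def by auto
  then show ?thesis by (intro integrable_const_bound[of _ B] F_M) auto
qed

text \<open>The sign \<open>\<xi> k\<close> is centred and independent of the \<open>\<sigma>\<close>-algebra of \<open>\<xi> 1, \<dots>, \<xi> (k - 1)\<close>.\<close>

lemma expectation_xi_mult:
  assumes k: "k \<ge> 1" and f: "bounded_adapted (k - 1) f"
  shows "expectation (\<lambda>\<omega>. \<xi> k \<omega> * f \<omega>) = 0"
proof -
  define E where "E = (\<lambda>i. {\<xi> i -` A \<inter> space M | A. A \<in> sets (borel :: real measure)})"
  let ?E = E
  \<comment> \<open>Independence of disjoint blocks of the signs: the block \<open>{k}\<close> and the block of the past.\<close>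
  let ?I = "case_bool {k} {1..k - 1}"
  have "indep_sets ?E {1..}" using indep unfolding indep_vars_def2 E_def by (rule conjunct2)
  moreover have "(\<Union>j\<in>UNIV. ?I j) \<subseteq> {1..}" using k by (auto simp: UNIV_bool)
  ultimately have "indep_sets ?E (\<Union>j\<in>UNIV. ?I j)" by (rule indep_sets_mono_index[rotated])
  then have "indep_sets (\<lambda>j. sigma_sets (space M) (\<Union>i\<in>?I j. ?E i)) UNIV"
  proof (rule indep_sets_collect_sigma)
    show "disjoint_family_on ?I UNIV"
      unfolding disjoint_family_on_def using k by (auto split: bool.splits)
    fix i show "Int_stable (?E i)"
    proof (rule Int_stableI)
      fix a b assume "a \<in> ?E i" "b \<in> ?E i"
      then obtain A B where AB: "a = \<xi> i -` A \<inter> space M" "b = \<xi> i -` B \<inter> space M" "A \<in> sets borel" "B \<in> sets borel"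
        unfolding E_def by blast
      have "a \<inter> b = \<xi> i -` (A \<inter> B) \<inter> space M" unfolding AB by blast
      moreover have "A \<inter> B \<in> sets borel" using AB by blast
      ultimately show "a \<inter> b \<in> ?E i" unfolding E_def by blast
    qed
  qed
  then have ind: "indep_set (sigma_sets (space M) (?E k)) (sets (F (k - 1)))"
    unfolding indep_set_def sets_F
    by (rule indep_sets_mono_sets) (simp add: E_def split: bool.splits)
  have fF: "f \<in> borel_measurable (F (k - 1))" using f by (simp add: bounded_adapted_def)
  have sub: "sigma_sets (space M) {f -` A \<inter> space M |A. A \<in> sets borel} \<subseteq> sets (F (k - 1))"
    using sets.sigma_sets_subset[of "{f -` A \<inter> space M |A. A \<in> sets borel}" "F (k - 1)"]
      measurable_sets[OF fF] unfolding space_F by blast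
  have "indep_var borel (\<xi> k) borel f"
    unfolding indep_var_eq
  proof (intro conjI)
    show "random_variable borel (\<xi> k)" using xi_measurable[OF k] .
    show "random_variable borel f" using F_M[OF fF] .
    show "indep_set (sigma_sets (space M) {\<xi> k -` A \<inter> space M |A. A \<in> sets borel}) (sigma_sets (space M) {f -` A \<inter> space M |A. A \<in> sets borel})"
      using ind unfolding indep_set_def E_def
      by (rule indep_sets_mono_sets) (use sub in \<open>simp split: bool.splits\<close>)
  qed
  then have "expectation (\<lambda>\<omega>. \<xi> k \<omega> * f \<omega>) = expectation (\<xi> k) * expectation f"
    using bounded_adapted_integrable[OF f] bounded_adapted_integrable[OF bounded_adapted_xi[OF k order_refl]]
    by (intro indep_var_lebesgue_integral)
  then show ?thesis by (simp add: expectation_xi[OF k])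
qed

lemma bounded_adapted_transform:
  assumes "\<And>k. 1 \<le> k \<Longrightarrow> k \<le> n \<Longrightarrow> bounded_adapted (k - 1) (f k)"
  shows "bounded_adapted n (\<lambda>\<omega>. \<Sum>k=1..n. \<xi> k \<omega> * f k \<omega>)"
  by (intro bounded_adapted_sum bounded_adapted_mult bounded_adapted_xi)
     (auto intro: bounded_adapted_mono[OF assms])

text \<open>The increments of a martingale transform are orthogonal, and \<open>(\<xi> k)\<^sup>2 = 1\<close>.\<close>

lemma second_moment_transform:
  assumes "\<And>k. 1 \<le> k \<Longrightarrow> k \<le> n \<Longrightarrow> bounded_adapted (k - 1) (f k)"
  shows "expectation (\<lambda>\<omega>. (\<Sum>k=1..n. \<xi> k \<omega> * f k \<omega>)\<^sup>2) = (\<Sum>k=1..n. expectation (\<lambda>\<omega>. (f k \<omega>)\<^sup>2))"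
  using assms
proof (induction n)
  case (Suc n)
  let ?D = "\<lambda>\<omega>. \<Sum>k=1..n. \<xi> k \<omega> * f k \<omega>"
  have D: "bounded_adapted n ?D" using Suc.prems by (intro bounded_adapted_transform) auto
  have f: "bounded_adapted n (f (Suc n))" using Suc.prems[of "Suc n"] by simp
  have i1: "integrable M (\<lambda>\<omega>. (?D \<omega>)\<^sup>2)" unfolding power2_eq_square
    using D bounded_adapted_mult bounded_adapted_integrable by blast
  have i2: "integrable M (\<lambda>\<omega>. (f (Suc n) \<omega>)\<^sup>2)" unfolding power2_eq_square
    using f bounded_adapted_mult bounded_adapted_integrable by blast
  have c: "bounded_adapted n (\<lambda>\<omega>. 2 * (?D \<omega> * f (Suc n) \<omega>))"
    using D f bounded_adapted_mult bounded_adapted_const by blast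
  have i3: "integrable M (\<lambda>\<omega>. \<xi> (Suc n) \<omega> * (2 * (?D \<omega> * f (Suc n) \<omega>)))"
    by (intro bounded_adapted_integrable[of "Suc n"] bounded_adapted_mult bounded_adapted_xi bounded_adapted_mono[OF c]) auto
  have z: "expectation (\<lambda>\<omega>. \<xi> (Suc n) \<omega> * (2 * (?D \<omega> * f (Suc n) \<omega>))) = 0"
    using c by (intro expectation_xi_mult) auto
  have i4: "integrable M (\<lambda>\<omega>. (\<Sum>k=1..Suc n. \<xi> k \<omega> * f k \<omega>)\<^sup>2)"
    unfolding power2_eq_square
    using bounded_adapted_transform[of "Suc n" f] Suc.prems bounded_adapted_mult bounded_adapted_integrable by blast
  have "expectation (\<lambda>\<omega>. (\<Sum>k=1..Suc n. \<xi> k \<omega> * f k \<omega>)\<^sup>2)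
     = expectation (\<lambda>\<omega>. (?D \<omega>)\<^sup>2 + \<xi> (Suc n) \<omega> * (2 * (?D \<omega> * f (Suc n) \<omega>)) + (f (Suc n) \<omega>)\<^sup>2)"
  proof (rule integral_cong_AE)
    show "AE \<omega> in M. (\<Sum>k=1..Suc n. \<xi> k \<omega> * f k \<omega>)\<^sup>2
      = (?D \<omega>)\<^sup>2 + \<xi> (Suc n) \<omega> * (2 * (?D \<omega> * f (Suc n) \<omega>)) + (f (Suc n) \<omega>)\<^sup>2"
      using AE_xi_sq[of "Suc n", simplified]
    proof eventually_elim
      case (elim \<omega>)
      have "(\<Sum>k=1..Suc n. \<xi> k \<omega> * f k \<omega>)\<^sup>2
        = (?D \<omega>)\<^sup>2 + \<xi> (Suc n) \<omega> * (2 * (?D \<omega> * f (Suc n) \<omega>)) + (\<xi> (Suc n) \<omega>)\<^sup>2 * (f (Suc n) \<omega>)\<^sup>2"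
        by (simp add: power2_eq_square algebra_simps)
      with elim show ?case by simp
    qed
  qed (use i1 i2 i3 i4 in auto)
  also have "\<dots> = expectation (\<lambda>\<omega>. (?D \<omega>)\<^sup>2) + expectation (\<lambda>\<omega>. (f (Suc n) \<omega>)\<^sup>2)"
    using i1 i2 i3 z by simp
  also have "expectation (\<lambda>\<omega>. (?D \<omega>)\<^sup>2) = (\<Sum>k=1..n. expectation (\<lambda>\<omega>. (f k \<omega>)\<^sup>2))"
    using Suc by simp
  finally show ?case by simp
qed simp

lemma second_moment_linear:
  "expectation (\<lambda>\<omega>. (\<Sum>i=1..n. a i * \<xi> i \<omega>)\<^sup>2) = (\<Sum>i=1..n. (a i)\<^sup>2)"
  using second_moment_transform[of n "\<lambda>i _. a i"] by (simp add: mult.commute bounded_adapted_const prob_space)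

text \<open>The transform stopped at its first exit from \<open>(-L, L)\<close> is a transform with smaller factors. If an exit occurs,
the final value of the stopped transform is the exit value, so Markov's inequality for its square gives the bound.\<close>

lemma maximal_inequality:
  assumes f: "\<And>k. 1 \<le> k \<Longrightarrow> k \<le> n \<Longrightarrow> bounded_adapted (k - 1) (f k)"
    and L: "L > 0" and V: "(\<Sum>k=1..n. expectation (\<lambda>\<omega>. (f k \<omega>)\<^sup>2)) \<le> V"
  shows "prob {\<omega>\<in>space M. \<exists>m\<in>{1..n}. \<bar>\<Sum>k=1..m. \<xi> k \<omega> * f k \<omega>\<bar> \<ge> L} \<le> V / L\<^sup>2"
proof -
  define D where "D m \<omega> = (\<Sum>k=1..m. \<xi> k \<omega> * f k \<omega>)" for m \<omega>
  have D: "bounded_adapted m (D m)" if "m \<le> n" for m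
    unfolding D_def using that f by (intro bounded_adapted_transform) auto
  \<comment> \<open>Freezing the transform after its first exit only uses the past, so the factors stay predictable.\<close>
  define g where "g k \<omega> = f k \<omega> * (if \<forall>m\<in>{1..k-1}. \<bar>D m \<omega>\<bar> < L then 1 else 0)" for k \<omega>
  have g: "bounded_adapted (k - 1) (g k)" if k: "1 \<le> k" "k \<le> n" for k
    unfolding g_def
  proof (intro bounded_adapted_mult f k bounded_adapted_indicator)
    have "{\<omega>\<in>space (F (k - 1)). \<bar>D m \<omega>\<bar> < L} \<in> sets (F (k - 1))" if m: "m \<in> {1..k-1}" for m
    proof -
      have "bounded_adapted (k - 1) (D m)"
        by (rule bounded_adapted_mono[OF D]) (use m k in auto)
      then have [measurable]: "D m \<in> borel_measurable (F (k - 1))"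
        unfolding bounded_adapted_def by (rule conjunct1)
      show ?thesis by measurable
    qed
    then have "{\<omega>\<in>space (F (k - 1)). \<forall>m\<in>{1..k-1}. \<bar>D m \<omega>\<bar> < L} \<in> sets (F (k - 1))"
      by (intro sets.sets_Collect_finite_All) auto
    then show "{\<omega>\<in>space M. \<forall>m\<in>{1..k-1}. \<bar>D m \<omega>\<bar> < L} \<in> sets (F (k - 1))" by (simp add: space_F)
  qed
  define U where "U \<omega> = (\<Sum>k=1..n. \<xi> k \<omega> * g k \<omega>)" for \<omega>
  have U: "bounded_adapted n U" unfolding U_def using g by (intro bounded_adapted_transform) auto
  have intU: "integrable M (\<lambda>\<omega>. (U \<omega>)\<^sup>2)"
    unfolding power2_eq_square using U bounded_adapted_mult bounded_adapted_integrable by blast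
  have sq: "integrable M (\<lambda>\<omega>. (h \<omega>)\<^sup>2)" if "bounded_adapted k h" for k h
    unfolding power2_eq_square using that bounded_adapted_mult bounded_adapted_integrable by blast
  have EU: "expectation (\<lambda>\<omega>. (U \<omega>)\<^sup>2) \<le> V"
  proof -
    have "expectation (\<lambda>\<omega>. (U \<omega>)\<^sup>2) = (\<Sum>k=1..n. expectation (\<lambda>\<omega>. (g k \<omega>)\<^sup>2))"
      unfolding U_def using g by (intro second_moment_transform) auto
    also have "\<dots> \<le> (\<Sum>k=1..n. expectation (\<lambda>\<omega>. (f k \<omega>)\<^sup>2))"
    proof (rule sum_mono)
      fix k assume "k \<in> {1..n}"
      then have k: "1 \<le> k" "k \<le> n" by auto
      show "expectation (\<lambda>\<omega>. (g k \<omega>)\<^sup>2) \<le> expectation (\<lambda>\<omega>. (f k \<omega>)\<^sup>2)"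
        by (intro integral_mono sq[OF f[OF k]] sq[OF g[OF k]]) (simp add: g_def)
    qed
    finally show ?thesis using V by simp
  qed
  have hit: "L\<^sup>2 \<le> (U \<omega>)\<^sup>2" if "\<exists>m\<in>{1..n}. \<bar>D m \<omega>\<bar> \<ge> L" for \<omega>
  proof -
    from that have "\<exists>m. m \<in> {1..n} \<and> \<bar>D m \<omega>\<bar> \<ge> L" by blast
    then obtain m where m: "m \<in> {1..n}" "\<bar>D m \<omega>\<bar> \<ge> L"
      and least: "\<And>j. j < m \<Longrightarrow> \<not> (j \<in> {1..n} \<and> \<bar>D j \<omega>\<bar> \<ge> L)"
      unfolding exists_least_iff[of "\<lambda>m. m \<in> {1..n} \<and> \<bar>D m \<omega>\<bar> \<ge> L"] by blast
    have before: "\<bar>D j \<omega>\<bar> < L" if "j \<in> {1..<m}" for j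
      using least[of j] that m(1) by auto
    have "U \<omega> = (\<Sum>k=1..m. \<xi> k \<omega> * g k \<omega>)"
      unfolding U_def
    proof (rule sum.mono_neutral_right)
      show "\<forall>k\<in>{1..n} - {1..m}. \<xi> k \<omega> * g k \<omega> = 0"
      proof
        fix k assume "k \<in> {1..n} - {1..m}"
        then have "m \<in> {1..k-1}" using m(1) by auto
        then have "\<not> (\<forall>m\<in>{1..k-1}. \<bar>D m \<omega>\<bar> < L)" using m(2) not_less by blast
        then show "\<xi> k \<omega> * g k \<omega> = 0" by (simp only: g_def if_False mult_zero_right)
      qed
    qed (use m in auto)
    also have "\<dots> = D m \<omega>"
      unfolding D_def by (intro sum.cong) (auto simp: g_def before)
    finally show ?thesis using m(2) L by (metis abs_le_square_iff abs_of_pos)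
  qed
  have "prob {\<omega>\<in>space M. \<exists>m\<in>{1..n}. \<bar>D m \<omega>\<bar> \<ge> L} \<le> prob {\<omega>\<in>space M. L\<^sup>2 \<le> (U \<omega>)\<^sup>2}"
  proof (rule finite_measure_mono)
    show "{\<omega>\<in>space M. \<exists>m\<in>{1..n}. \<bar>D m \<omega>\<bar> \<ge> L} \<subseteq> {\<omega>\<in>space M. L\<^sup>2 \<le> (U \<omega>)\<^sup>2}" using hit by blast
    have [measurable]: "U \<in> borel_measurable M" using U F_M by (auto simp: bounded_adapted_def)
    show "{\<omega>\<in>space M. L\<^sup>2 \<le> (U \<omega>)\<^sup>2} \<in> events" by measurable
  qed
  also have "\<dots> \<le> expectation (\<lambda>\<omega>. (U \<omega>)\<^sup>2) / L\<^sup>2"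
    using L intU by (intro integral_Markov_inequality_measure[where A="space M" and u="\<lambda>\<omega>. (U \<omega>)\<^sup>2"]) auto
  also have "\<dots> \<le> V / L\<^sup>2" using EU L by (intro divide_right_mono) auto
  finally show ?thesis by (simp add: D_def)
qed

text \<open>The diagonal part of a quadratic form in signs is deterministic and its off-diagonal part is a martingale
transform, whose second moment is at most four times the squared Frobenius norm of the Gram matrix of the columns of
\<open>a\<close>. Passing to the Gram matrix of the rows (\<open>gram_frobenius\<close>) makes the row norms enter, which for \<open>Y\<close> are bounded
by \<open>sum_J_sq_le\<close>.\<close>

lemma quadratic_form_deviation:
  fixes a b :: "nat \<Rightarrow> nat \<Rightarrow> real"
  assumes ab: "\<And>k i. k \<in> {1..m} \<Longrightarrow> i \<in> {1..n} \<Longrightarrow> \<bar>a k i\<bar> \<le> b k i"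
    and R: "\<And>k. k \<in> {1..m} \<Longrightarrow> (\<Sum>i=1..n. (b k i)\<^sup>2) \<le> R" and L: "L > 0"
  shows "prob {\<omega>\<in>space M. \<bar>(\<Sum>k=1..m. (\<Sum>i=1..n. a k i * \<xi> i \<omega>)\<^sup>2) - (\<Sum>k=1..m. \<Sum>i=1..n. (a k i)\<^sup>2)\<bar> \<ge> L}
    \<le> 4 * R * (\<Sum>i=1..n. (\<Sum>k=1..m. b k i)\<^sup>2) / L\<^sup>2"
proof (cases "n \<ge> 1")
  case False
  then show ?thesis using L by (auto simp: not_le)
next
  case n: True
  define q where "q i l = (\<Sum>k=1..m. a k i * a k l)" for i l
  define f where "f l \<omega> = 2 * (\<Sum>i=1..l-1. q i l * \<xi> i \<omega>)" for l \<omega>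
  have f: "bounded_adapted (l - 1) (f l)" for l
    unfolding f_def
    by (intro bounded_adapted_mult bounded_adapted_const bounded_adapted_sum bounded_adapted_xi) auto
  have fsq: "expectation (\<lambda>\<omega>. (f l \<omega>)\<^sup>2) = 4 * (\<Sum>i=1..l-1. (q i l)\<^sup>2)" for l
    unfolding f_def power_mult_distrib by (simp add: second_moment_linear[unfolded One_nat_def])
  have "(\<Sum>l=1..n. expectation (\<lambda>\<omega>. (f l \<omega>)\<^sup>2)) \<le> (\<Sum>l=1..n. 4 * (\<Sum>i=1..n. (q i l)\<^sup>2))"
    unfolding fsq by (intro sum_mono mult_left_mono sum_mono2) auto
  also have "\<dots> = 4 * (\<Sum>l=1..n. \<Sum>i=1..n. (q i l)\<^sup>2)" by (simp add: sum_distrib_left)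
  also have "\<dots> = 4 * (\<Sum>i=1..n. \<Sum>l=1..n. (q i l)\<^sup>2)" by (rule arg_cong[OF sum.swap])
  also have "\<dots> \<le> 4 * (R * (\<Sum>i=1..n. (\<Sum>k=1..m. b k i)\<^sup>2))"
  proof (rule mult_left_mono)
    have "(\<Sum>i=1..n. \<Sum>l=1..n. (q i l)\<^sup>2) = (\<Sum>k=1..m. \<Sum>k'=1..m. (\<Sum>i=1..n. a k i * a k' i)\<^sup>2)"
      unfolding q_def by (rule gram_frobenius)
    also have "\<dots> \<le> R * (\<Sum>i=1..n. (\<Sum>k=1..m. b k i)\<^sup>2)"
      by (rule gram_sq_le[OF ab R])
    finally show "(\<Sum>i=1..n. \<Sum>l=1..n. (q i l)\<^sup>2) \<le> R * (\<Sum>i=1..n. (\<Sum>k=1..m. b k i)\<^sup>2)" .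
  qed simp
  finally have V: "(\<Sum>l=1..n. expectation (\<lambda>\<omega>. (f l \<omega>)\<^sup>2)) \<le> 4 * R * (\<Sum>i=1..n. (\<Sum>k=1..m. b k i)\<^sup>2)" by simp
  have meas_hit: "{\<omega>\<in>space M. \<exists>j\<in>{1..n}. \<bar>\<Sum>l=1..j. \<xi> l \<omega> * f l \<omega>\<bar> \<ge> L} \<in> events"
  proof -
    have [measurable]: "(\<lambda>\<omega>. \<Sum>l=1..j. \<xi> l \<omega> * f l \<omega>) \<in> borel_measurable M" for j
      using bounded_adapted_transform[of j f] f F_M unfolding bounded_adapted_def by blast
    show ?thesis by measurable
  qed
  have "prob {\<omega>\<in>space M. \<bar>(\<Sum>k=1..m. (\<Sum>i=1..n. a k i * \<xi> i \<omega>)\<^sup>2) - (\<Sum>k=1..m. \<Sum>i=1..n. (a k i)\<^sup>2)\<bar> \<ge> L}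
     \<le> prob {\<omega>\<in>space M. \<exists>j\<in>{1..n}. \<bar>\<Sum>l=1..j. \<xi> l \<omega> * f l \<omega>\<bar> \<ge> L}"
  proof (rule finite_measure_mono_AE[OF _ meas_hit])
    show "AE \<omega> in M. \<omega> \<in> {\<omega>\<in>space M. \<bar>(\<Sum>k=1..m. (\<Sum>i=1..n. a k i * \<xi> i \<omega>)\<^sup>2) - (\<Sum>k=1..m. \<Sum>i=1..n. (a k i)\<^sup>2)\<bar> \<ge> L}
      \<longrightarrow> \<omega> \<in> {\<omega>\<in>space M. \<exists>j\<in>{1..n}. \<bar>\<Sum>l=1..j. \<xi> l \<omega> * f l \<omega>\<bar> \<ge> L}"
      using AE_sign
    proof eventually_elim
      case (elim \<omega>)
      have sq: "(a k i * \<xi> i \<omega>)\<^sup>2 = (a k i)\<^sup>2" if "i \<in> {1..n}" for k i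
        using elim that by (auto simp: power_mult_distrib dest: spec[of _ i])
      have "(\<Sum>k=1..m. (\<Sum>i=1..n. a k i * \<xi> i \<omega>)\<^sup>2)
        = (\<Sum>k=1..m. (\<Sum>i=1..n. (a k i)\<^sup>2) + (\<Sum>l=1..n. a k l * \<xi> l \<omega> * (2 * (\<Sum>i=1..l-1. a k i * \<xi> i \<omega>))))"
        unfolding square_of_sum by (intro sum.cong refl arg_cong2[of _ _ _ _ "(+)"] sq) auto
      also have "\<dots> = (\<Sum>k=1..m. \<Sum>i=1..n. (a k i)\<^sup>2)
          + (\<Sum>k=1..m. \<Sum>l=1..n. a k l * \<xi> l \<omega> * (2 * (\<Sum>i=1..l-1. a k i * \<xi> i \<omega>)))"
        by (simp add: sum.distrib)
      also have "(\<Sum>k=1..m. \<Sum>l=1..n. a k l * \<xi> l \<omega> * (2 * (\<Sum>i=1..l-1. a k i * \<xi> i \<omega>)))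
         = (\<Sum>l=1..n. \<Sum>k=1..m. a k l * \<xi> l \<omega> * (2 * (\<Sum>i=1..l-1. a k i * \<xi> i \<omega>)))"
        by (rule sum.swap)
      also have "\<dots> = (\<Sum>l=1..n. \<xi> l \<omega> * f l \<omega>)"
      proof (intro sum.cong refl)
        fix l
        have "(\<Sum>k=1..m. a k l * \<xi> l \<omega> * (2 * (\<Sum>i=1..l-1. a k i * \<xi> i \<omega>)))
           = (\<Sum>k=1..m. \<Sum>i=1..l-1. \<xi> l \<omega> * 2 * (a k i * a k l * \<xi> i \<omega>))"
          by (simp add: sum_distrib_left ac_simps)
        also have "\<dots> = (\<Sum>i=1..l-1. \<Sum>k=1..m. \<xi> l \<omega> * 2 * (a k i * a k l * \<xi> i \<omega>))"
          by (rule sum.swap)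
        also have "\<dots> = \<xi> l \<omega> * f l \<omega>"
          unfolding f_def q_def by (simp add: sum_distrib_left sum_distrib_right ac_simps)
        finally show "(\<Sum>k=1..m. a k l * \<xi> l \<omega> * (2 * (\<Sum>i=1..l-1. a k i * \<xi> i \<omega>))) = \<xi> l \<omega> * f l \<omega>" .
      qed
      finally show ?case using n by auto
    qed
  qed
  also have "\<dots> \<le> 4 * R * (\<Sum>i=1..n. (\<Sum>k=1..m. b k i)\<^sup>2) / L\<^sup>2"
    using f L V by (intro maximal_inequality) auto
  finally show ?thesis .
qed

end

section \<open>Portfolio values, stopping times and nets\<close>

lemma sum_int_Suc: "(\<Sum>k\<in>{0..int (Suc n)}. f k) = (\<Sum>k\<in>{0..int n}. f k) + f (int (Suc n))" for f :: "int \<Rightarrow> real"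
proof -
  have "{0..int (Suc n)} = insert (int (Suc n)) {0..int n}" by auto
  then show ?thesis by simp
qed

text \<open>Summation by parts. A purchase is made at the ask price, and a sale, including the final liquidation,
loses the fraction \<open>l\<close> of the value sold.\<close>

lemma liquidation_value_decomposition:
  assumes "\<phi> (-1) \<omega> = 0"
  shows "liquidation_value S l (self_financing_bond S l \<phi>) \<phi> (int n) \<omega>
    = (\<Sum>k=1..n. \<phi> (int k - 1) \<omega> * (S k \<omega> - S (k - 1) \<omega>))
      - l * ((\<Sum>k\<in>{0..int n}. max (- (\<phi> k \<omega> - \<phi> (k - 1) \<omega>)) 0 * S (nat k) \<omega>) + max (\<phi> (int n) \<omega>) 0 * S n \<omega>)"
proof -
  have pm: "max (- x) 0 = max x 0 - x" for x :: real by (auto simp: max_def)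
  have bond: "self_financing_bond S l \<phi> (int n) \<omega> + \<phi> (int n) \<omega> * S n \<omega>
     = (\<Sum>k=1..n. \<phi> (int k - 1) \<omega> * (S k \<omega> - S (k - 1) \<omega>))
      - l * (\<Sum>k\<in>{0..int n}. max (- (\<phi> k \<omega> - \<phi> (k - 1) \<omega>)) 0 * S (nat k) \<omega>)"
  proof (induction n)
    case 0
    show ?case using assms
      by (simp add: self_financing_bond_def pm[of "\<phi> 0 \<omega>"] algebra_simps)
  next
    case (Suc n)
    let ?d = "\<phi> (int (Suc n)) \<omega> - \<phi> (int n) \<omega>"
    have e: "int (Suc n) - 1 = int n" "nat (int (Suc n)) = Suc n" by auto
    have "self_financing_bond S l \<phi> (int (Suc n)) \<omega> = self_financing_bond S l \<phi> (int n) \<omega>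
      - max ?d 0 * S (Suc n) \<omega> + (1 - l) * (max (- ?d) 0 * S (Suc n) \<omega>)"
      unfolding self_financing_bond_def sum_int_Suc e by (simp only: distrib_left)
    also have "\<dots> = self_financing_bond S l \<phi> (int n) \<omega>
      - ?d * S (Suc n) \<omega> - l * (max (- ?d) 0 * S (Suc n) \<omega>)"
      unfolding pm by (simp add: algebra_simps)
    finally have b: "self_financing_bond S l \<phi> (int (Suc n)) \<omega> = \<dots>" .
    have "(\<Sum>k=1..Suc n. \<phi> (int k - 1) \<omega> * (S k \<omega> - S (k - 1) \<omega>))
       = (\<Sum>k=1..n. \<phi> (int k - 1) \<omega> * (S k \<omega> - S (k - 1) \<omega>)) + \<phi> (int n) \<omega> * (S (Suc n) \<omega> - S n \<omega>)"
      by simp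
    with Suc show ?case unfolding b sum_int_Suc e by (simp add: algebra_simps)
  qed
  have "liquidation_value S l (self_financing_bond S l \<phi>) \<phi> (int n) \<omega>
     = self_financing_bond S l \<phi> (int n) \<omega> + \<phi> (int n) \<omega> * S n \<omega> - l * (max (\<phi> (int n) \<omega>) 0 * S n \<omega>)"
    unfolding liquidation_value_def pm by (simp add: algebra_simps)
  also note bond
  finally show ?thesis by (simp add: algebra_simps)
qed

text \<open>Every trade has value at most \<open>3 * d\<close>: the new position is worth at most \<open>d\<close> and the old one, as the price at
most doubles, at most \<open>2 * d\<close>.\<close>

lemma liquidation_value_ge:
  assumes l: "0 \<le> l" and n: "n \<le> N" "1 \<le> N"
    and S: "\<And>k. k \<le> N \<Longrightarrow> S k \<omega> > 0" "\<And>k. 1 \<le> k \<Longrightarrow> k \<le> N \<Longrightarrow> S k \<omega> \<le> 2 * S (k - 1) \<omega>"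
    and \<phi>: "\<phi> (-1) \<omega> = 0" "\<phi> 0 \<omega> = 0" "\<And>k. 1 \<le> k \<Longrightarrow> k \<le> N \<Longrightarrow> \<bar>\<phi> (int k) \<omega>\<bar> * S k \<omega> \<le> d"
    and d: "d \<ge> 0"
  shows "liquidation_value S l (self_financing_bond S l \<phi>) \<phi> (int n) \<omega>
    \<ge> (\<Sum>k=1..n. \<phi> (int k - 1) \<omega> * (S k \<omega> - S (k - 1) \<omega>)) - 4 * (l * real N * d)"
proof -
  have bnd: "\<bar>\<phi> (int k) \<omega>\<bar> * S k \<omega> \<le> d" if "k \<le> N" for k
    using that \<phi>(2) \<phi>(3)[of k] d by (cases "k = 0") auto
  have step: "(\<Sum>k\<in>{0..int m}. max (- (\<phi> k \<omega> - \<phi> (k - 1) \<omega>)) 0 * S (nat k) \<omega>) \<le> real m * (3 * d)" if "m \<le> N" for m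
    using that
  proof (induction m)
    case 0
    then show ?case using \<phi> by simp
  next
    case (Suc m)
    have e: "int (Suc m) - 1 = int m" "nat (int (Suc m)) = Suc m" by auto
    have "max (- (\<phi> (int (Suc m)) \<omega> - \<phi> (int m) \<omega>)) 0 * S (Suc m) \<omega>
      \<le> (\<bar>\<phi> (int (Suc m)) \<omega>\<bar> + \<bar>\<phi> (int m) \<omega>\<bar>) * S (Suc m) \<omega>"
      using S(1)[of "Suc m"] Suc.prems by (intro mult_right_mono) auto
    also have "\<dots> = \<bar>\<phi> (int (Suc m)) \<omega>\<bar> * S (Suc m) \<omega> + \<bar>\<phi> (int m) \<omega>\<bar> * S (Suc m) \<omega>"
      by (simp add: distrib_right)
    also have "\<dots> \<le> d + \<bar>\<phi> (int m) \<omega>\<bar> * (2 * S m \<omega>)"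
      using bnd[of "Suc m"] S(2)[of "Suc m"] Suc.prems by (intro add_mono mult_left_mono) auto
    also have "\<dots> \<le> d + 2 * d" using bnd[of m] Suc.prems by simp
    finally have "max (- (\<phi> (int (Suc m)) \<omega> - \<phi> (int m) \<omega>)) 0 * S (Suc m) \<omega> \<le> 3 * d" by simp
    then show ?case using Suc unfolding sum_int_Suc e by (simp add: algebra_simps)
  qed
  have "max (\<phi> (int n) \<omega>) 0 * S n \<omega> \<le> \<bar>\<phi> (int n) \<omega>\<bar> * S n \<omega>"
    using S(1)[of n] n by (intro mult_right_mono) auto
  also have "\<dots> \<le> d" using bnd n by simp
  finally have "(\<Sum>k\<in>{0..int n}. max (- (\<phi> k \<omega> - \<phi> (k - 1) \<omega>)) 0 * S (nat k) \<omega>) + max (\<phi> (int n) \<omega>) 0 * S n \<omega>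
     \<le> real n * (3 * d) + d"
    using step[OF n(1)] by simp
  also have "\<dots> \<le> real N * (3 * d) + real N * d"
    using n d by (intro add_mono mult_right_mono) (auto intro: order_trans[OF _ mult_right_mono[of 1 "real N" d]])
  finally have "l * ((\<Sum>k\<in>{0..int n}. max (- (\<phi> k \<omega> - \<phi> (k - 1) \<omega>)) 0 * S (nat k) \<omega>) + max (\<phi> (int n) \<omega>) 0 * S n \<omega>)
     \<le> l * (real N * (3 * d) + real N * d)" using l by (rule mult_left_mono)
  also have "\<dots> = 4 * (l * real N * d)" by (simp add: algebra_simps)
  finally show ?thesis unfolding liquidation_value_decomposition[of \<phi> \<omega>, OF \<phi>(1)] by simp
qed

lemma less_INF_finite:
  fixes f :: "'b \<Rightarrow> ereal"
  assumes "finite A" "x < \<infinity>"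
  shows "x < (INF k\<in>A. f k) \<longleftrightarrow> (\<forall>k\<in>A. x < f k)"
  using assms(1) by (induction A rule: finite_induct) (use assms(2) in \<open>auto simp: top_ereal_def\<close>)

lemma less_hitting_time_iff:
  "ereal x < hitting_time H \<sigma> \<xi> N i \<omega> \<longleftrightarrow>
    (\<forall>j\<in>{1..N}. x \<ge> real j \<longrightarrow> - eps H N \<le> theta_sum H \<sigma> \<xi> i j \<omega> / real N)"
  unfolding hitting_time_def by (subst less_INF_finite) (auto simp: not_le not_less)

lemma less_hitting_time_minus_iff:
  "ereal x < hitting_time H \<sigma> \<xi> N i \<omega> - 1 \<longleftrightarrow>
    (\<forall>j\<in>{1..N}. x + 1 \<ge> real j \<longrightarrow> - eps H N \<le> theta_sum H \<sigma> \<xi> i j \<omega> / real N)"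
proof -
  have "ereal x < t - 1 \<longleftrightarrow> ereal (x + 1) < t" for t :: ereal
    by (cases t) (auto simp: one_ereal_def)
  then show ?thesis by (simp add: less_hitting_time_iff)
qed

definition no_hit :: "real \<Rightarrow> real \<Rightarrow> (nat \<Rightarrow> 'a \<Rightarrow> real) \<Rightarrow> nat \<Rightarrow> nat \<Rightarrow> nat \<Rightarrow> 'a \<Rightarrow> bool" where
  "no_hit H \<sigma> \<xi> N i j \<omega> \<longleftrightarrow> - eps H N \<le> theta_sum H \<sigma> \<xi> i j \<omega> / real N"

text \<open>The hitting times of the sums \<open>3\<close> and \<open>4\<close> are anticipated by one step. Adaptedness is not lost, because
\<open>theta\<close> with index \<open>3\<close> or \<open>4\<close> at time \<open>k + 1\<close> only involves the signs up to time \<open>k\<close>.\<close>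

lemma less_stop_time_iff:
  "ereal (real_of_int k) < stop_time H \<sigma> \<xi> N \<omega> \<longleftrightarrow>
    (\<forall>j\<in>{1..N}. (int j \<le> k \<longrightarrow> no_hit H \<sigma> \<xi> N 1 j \<omega> \<and> no_hit H \<sigma> \<xi> N 2 j \<omega>)
      \<and> (int j \<le> k + 1 \<longrightarrow> no_hit H \<sigma> \<xi> N 3 j \<omega> \<and> no_hit H \<sigma> \<xi> N 4 j \<omega>))"
proof -
  have 1: "real j \<le> real_of_int k \<longleftrightarrow> int j \<le> k" for j by linarith
  have 2: "real j \<le> real_of_int k + 1 \<longleftrightarrow> int j \<le> k + 1" for j by linarith
  show ?thesis
    unfolding stop_time_def min_less_iff_conj less_hitting_time_iff less_hitting_time_minus_iff 1 2 no_hit_def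
    by (simp only: ball_conj_distrib) (auto 0 3)
qed

lemma stopped_sum:
  fixes a :: "nat \<Rightarrow> real"
  assumes mono: "\<And>k m. P m \<Longrightarrow> k \<le> m \<Longrightarrow> P k"
  shows "\<exists>m\<le>n. (m = 0 \<or> P (m - 1)) \<and> (\<Sum>k=1..n. if P (k - 1) then a k else 0) = (\<Sum>k=1..m. a k)"
proof (induction n)
  case (Suc n)
  show ?case
  proof (cases "P n")
    case True
    then have "(\<Sum>k=1..Suc n. if P (k - 1) then a k else 0) = (\<Sum>k=1..Suc n. a k)"
      by (intro sum.cong) (auto intro: mono[OF True])
    with True show ?thesis by (intro exI[of _ "Suc n"]) auto
  next
    case False
    then show ?thesis using Suc by (auto intro: le_SucI)
  qed
qed simp

text \<open>Since \<open>A\<close> and \<open>B\<close> increase, \<open>A n - B n\<close> is at least \<open>A\<close> at the preceding net point minus \<open>B\<close> at the following one.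
The deviations allowed there are proportional to the net points, with a factor so small that, up to a multiple of
\<open>h\<close>, they use up only half of the drift \<open>\<nu> * n\<close>.\<close>

lemma net_lower_bound:
  fixes A B dA dB :: "nat \<Rightarrow> real"
  assumes mono: "mono A" "mono B"
    and gap: "\<And>n. dA n - dB n \<ge> \<nu> * (real n - 2)"
    and dB: "\<And>m n. m \<le> n \<Longrightarrow> dB n - dB m \<le> C * real (n - m)"
    and h: "h \<ge> 1" and \<nu>: "\<nu> > 0"
    and A: "\<bar>A (n div h * h) - dA (n div h * h)\<bar> \<le> \<nu> / 4 * real (n div h * h)"
    and B: "\<bar>B ((n div h + 1) * h) - dB ((n div h + 1) * h)\<bar> \<le> \<nu> / 4 * real ((n div h + 1) * h)"
  shows "A n - B n \<ge> \<nu> / 2 * real n - (C + 3 * \<nu>) * real h"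
proof -
  define s where "s = n div h * h"
  have s: "s \<le> n" "n \<le> s + h"
    unfolding s_def using h div_mult_mod_eq[of n h] mod_less_divisor[of h n] by linarith+
  have eq: "(n div h + 1) * h = s + h" by (simp add: s_def)
  have "A s \<le> A n" "B n \<le> B (s + h)" using mono s by (auto dest: monoD)
  moreover have "dB (s + h) - dB s \<le> C * real h" using dB[of s "s + h"] by simp
  moreover have "\<nu> * real s - 2 * \<nu> \<le> dA s - dB s" using gap[of s] by (simp add: algebra_simps)
  moreover have "\<nu> * real n \<le> \<nu> * real s + \<nu> * real h"
    using s \<nu> by (simp flip: distrib_left of_nat_add)
  moreover have "\<nu> \<le> \<nu> * real h" using h \<nu> by simp
  moreover have "dA s - A s \<le> \<nu> * real s / 4" using abs_le_D2[OF A[folded s_def]] by simp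
  moreover have "B (s + h) - dB (s + h) \<le> (\<nu> * real s + \<nu> * real h) / 4"
    using abs_le_D1[OF B[unfolded eq]] by (simp add: algebra_simps)
  ultimately have "\<nu> * real n / 2 - (C * real h + 3 * (\<nu> * real h)) \<le> A n - B n" using \<nu> by argo
  then show ?thesis by (simp add: algebra_simps)
qed

section \<open>The binary market along a single path\<close>

locale binary_market = fractional_kernel H \<sigma> + rademacher M \<xi>
  for H \<sigma> :: real and M :: "'a measure" and \<xi> :: "nat \<Rightarrow> 'a \<Rightarrow> real" +
  fixes s0 :: real
  assumes s0_pos: "s0 > 0"
begin

abbreviation g :: "nat \<Rightarrow> real" where "g \<equiv> gcoef H \<sigma>"
abbreviation Y :: "nat \<Rightarrow> 'a \<Rightarrow> real" where "Y \<equiv> Yproc H \<sigma> \<xi>"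
abbreviation X :: "nat \<Rightarrow> 'a \<Rightarrow> real" where "X \<equiv> Xproc H \<sigma> \<xi>"
abbreviation S :: "nat \<Rightarrow> nat \<Rightarrow> 'a \<Rightarrow> real" where "S \<equiv> stock H \<sigma> s0 \<xi>"
abbreviation \<theta> :: "nat \<Rightarrow> nat \<Rightarrow> 'a \<Rightarrow> real" where "\<theta> \<equiv> theta H \<sigma> \<xi>"
abbreviation \<theta>s :: "nat \<Rightarrow> nat \<Rightarrow> 'a \<Rightarrow> real" where "\<theta>s \<equiv> theta_sum H \<sigma> \<xi>"

lemma Y_eq_J: assumes "k \<le> n + 1" shows "Y k \<omega> = (\<Sum>i=1..n. J k i * \<xi> i \<omega>)"
  unfolding Yproc_def using assms by (intro sum.mono_neutral_cong_left) (auto simp: J_def)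

definition X_const :: real where "X_const = row_sum_const + coef_const"

lemma row_sum_const_nonneg: "row_sum_const \<ge> 0"
  using coef_const_pos H_gt H_lt by (simp add: row_sum_const_def)

lemma X_const_pos: "X_const > 0" using coef_const_pos row_sum_const_nonneg by (simp add: X_const_def)

lemma abs_X_le:
  assumes sgn: "\<forall>i\<ge>1. \<xi> i \<omega> = 1 \<or> \<xi> i \<omega> = -1" and n: "n \<ge> 1"
  shows "\<bar>X n \<omega>\<bar> \<le> X_const * real n powr (H - 1/2)"
proof -
  have abs1: "\<bar>\<xi> i \<omega>\<bar> = 1" if "i \<ge> 1" for i using sgn that by auto
  have "\<bar>Y n \<omega>\<bar> \<le> (\<Sum>i=1..<n. \<bar>jcoef H \<sigma> n i * \<xi> i \<omega>\<bar>)" unfolding Yproc_def by (rule sum_abs)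
  also have "\<dots> = (\<Sum>i=1..<n. jcoef H \<sigma> n i)"
    by (intro sum.cong) (auto simp: abs_mult abs1 jcoef_nonneg)
  also have "\<dots> \<le> row_sum_const * real n powr (H - 1/2)" by (rule sum_jcoef_le[OF n])
  finally have Y: "\<bar>Y n \<omega>\<bar> \<le> row_sum_const * real n powr (H - 1/2)" .
  have "\<bar>g n * \<xi> n \<omega>\<bar> \<le> coef_const * 1"
    unfolding abs_mult abs1[OF n] using gcoef_le[OF n] gcoef_nonneg[of n] by simp
  also have "\<dots> \<le> coef_const * real n powr (H - 1/2)"
    using coef_const_pos n H_gt by (intro mult_left_mono ge_one_powr_ge_zero) auto
  finally show ?thesis using Y unfolding Xproc_def X_const_def by (simp add: distrib_right abs_le_iff)
qed

lemma return_bounds: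
  assumes sgn: "\<forall>i\<ge>1. \<xi> i \<omega> = 1 \<or> \<xi> i \<omega> = -1" and k: "1 \<le> k" "k \<le> N"
    and N: "X_const / real N powr (1/2) \<le> 1/2"
  shows "\<bar>X k \<omega> / real N powr H\<bar> \<le> 1/2"
proof -
  have N1: "real N > 0" using k by simp
  have "\<bar>X k \<omega> / real N powr H\<bar> \<le> X_const * real N powr (H - 1/2) / real N powr H"
  proof -
    have "\<bar>X k \<omega>\<bar> \<le> X_const * real k powr (H - 1/2)" by (rule abs_X_le[OF sgn k(1)])
    also have "\<dots> \<le> X_const * real N powr (H - 1/2)"
      using X_const_pos k H_gt by (intro mult_left_mono powr_mono2) auto
    finally show ?thesis by (simp add: divide_right_mono)
  qed
  also have "\<dots> = X_const / real N powr (1/2)"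
    using N1 by (simp add: powr_diff)
  finally show ?thesis using N by (rule order_trans)
qed

text \<open>All one-period returns lie between \<open>-1/2\<close> and \<open>1/2\<close> once \<open>N\<close> is large.\<close>

lemma stock_bounds:
  assumes sgn: "\<forall>i\<ge>1. \<xi> i \<omega> = 1 \<or> \<xi> i \<omega> = -1" and N: "X_const / real N powr (1/2) \<le> 1/2"
  shows "k \<le> N \<Longrightarrow> S N k \<omega> > 0" and "1 \<le> k \<Longrightarrow> k \<le> N \<Longrightarrow> S N k \<omega> \<le> 2 * S N (k - 1) \<omega>"
proof -
  have pos: "S N k \<omega> > 0" if "k \<le> N" for k
    using that
  proof (induction k)
    case (Suc k)
    have "\<bar>X (Suc k) \<omega> / real N powr H\<bar> \<le> 1/2"
      by (rule return_bounds[OF sgn _ Suc.prems N]) simp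
    then have "1 + X (Suc k) \<omega> / real N powr H > 0" by linarith
    with Suc show ?case by simp
  qed (simp add: s0_pos)
  show "k \<le> N \<Longrightarrow> S N k \<omega> > 0" by (rule pos)
  assume k: "1 \<le> k" "k \<le> N"
  then obtain j where j: "k = Suc j" by (cases k) auto
  have "S N k \<omega> = (1 + X k \<omega> / real N powr H) * S N j \<omega>" using j by simp
  also have "\<dots> \<le> 2 * S N j \<omega>"
  proof (rule mult_right_mono)
    show "1 + X k \<omega> / real N powr H \<le> 2" using return_bounds[OF sgn k N] by linarith
  qed (use pos[of j] k j in auto)
  finally show "S N k \<omega> \<le> 2 * S N (k - 1) \<omega>" using j by simp
qed

lemma theta_total:
  assumes "k \<ge> 2"
  shows "\<theta> 1 k \<omega> + \<theta> 2 k \<omega> + \<theta> 3 k \<omega> + \<theta> 4 k \<omega> = X (k - 1) \<omega> * X k \<omega>"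
  using assms by (simp add: theta_def Xproc_def algebra_simps)

abbreviation active :: "nat \<Rightarrow> int \<Rightarrow> 'a \<Rightarrow> bool" where
  "active N k \<omega> \<equiv> ereal (real_of_int k) < stop_time H \<sigma> \<xi> N \<omega>"

text \<open>The relative price increment is \<open>X k / N powr H\<close> and the position is proportional to
\<open>N powr (H - 1) * X (k - 1) / S (k - 1)\<close>, so that the price cancels.\<close>

lemma gain_eq:
  assumes S: "\<And>k. k \<le> N \<Longrightarrow> S N k \<omega> > 0" and n: "n \<le> N"
  shows "(\<Sum>k=1..n. psi_stock H \<sigma> s0 \<xi> C1 C2 N (int k - 1) \<omega> * (S N k \<omega> - S N (k - 1) \<omega>))
    = 1 / sqrt (c_hat H C1 C2 N) / real N *
      (\<Sum>k=1..n. if active N (int (k - 1)) \<omega> then \<theta> 1 k \<omega> + \<theta> 2 k \<omega> + \<theta> 3 k \<omega> + \<theta> 4 k \<omega> else 0)"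
  unfolding sum_distrib_left
proof (rule sum.cong[OF refl])
  fix k assume "k \<in> {1..n}"
  then have k: "1 \<le> k" "k \<le> N" using n by auto
  then have N: "real N > 0" by simp
  show "psi_stock H \<sigma> s0 \<xi> C1 C2 N (int k - 1) \<omega> * (S N k \<omega> - S N (k - 1) \<omega>)
    = 1 / sqrt (c_hat H C1 C2 N) / real N *
      (if active N (int (k - 1)) \<omega> then \<theta> 1 k \<omega> + \<theta> 2 k \<omega> + \<theta> 3 k \<omega> + \<theta> 4 k \<omega> else 0)"
  proof (cases "k = 1")
    case True
    then show ?thesis by (simp add: psi_stock_def phi_stock_def theta_def)
  next
    case False
    with k obtain j where j: "k = Suc j" "j \<ge> 1" by (cases k) auto
    have Sj: "S N j \<omega> \<noteq> 0" using S[of j] k j by simp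
    have ij: "int k - 1 = int j" "k - 1 = j" "nat (int j) = j" using j by auto
    have "real N powr H = real N powr (H - 1) * real N"
      using N by (simp flip: powr_add add: powr_mult_base) (simp add: powr_diff)
    moreover have "S N k \<omega> - S N j \<omega> = X k \<omega> / real N powr H * S N j \<omega>"
      using j by (simp add: algebra_simps)
    ultimately have key: "real N powr (H - 1) * (X j \<omega> / S N j \<omega>) * (S N k \<omega> - S N j \<omega>) = X j \<omega> * X k \<omega> / real N"
      using Sj N by simp
    have tt: "\<theta> 1 k \<omega> + \<theta> 2 k \<omega> + \<theta> 3 k \<omega> + \<theta> 4 k \<omega> = X j \<omega> * X k \<omega>"
      using theta_total[of k \<omega>] j by simp
    have "psi_stock H \<sigma> s0 \<xi> C1 C2 N (int j) \<omega> * (S N k \<omega> - S N j \<omega>)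
       = 1 / sqrt (c_hat H C1 C2 N) * (if active N (int j) \<omega> then 1 else 0)
         * (real N powr (H - 1) * (X j \<omega> / S N j \<omega>) * (S N k \<omega> - S N j \<omega>))"
      using j unfolding psi_stock_def phi_stock_def ij by simp
    then show ?thesis unfolding key tt ij by simp
  qed
qed

lemma active_mono: "active N k \<omega> \<Longrightarrow> l \<le> k \<Longrightarrow> active N l \<omega>"
  by (rule le_less_trans) auto

text \<open>At the last active step the sums \<open>1\<close> and \<open>2\<close> may fall below \<open>- N * eps\<close> by one summand, which is what \<open>C1\<close> and
\<open>C2\<close> in \<open>c_hat\<close> account for; the sums \<open>3\<close> and \<open>4\<close> are already stopped one step before.\<close>

lemma stopped_gain_ge:
  assumes N: "N \<ge> 1" and n: "n \<le> N" and e: "eps H N \<ge> 0" and C: "C1 \<ge> 0" "C2 \<ge> 0"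
    and t1: "\<forall>n\<in>{1..N}. \<bar>\<theta> 1 n \<omega>\<bar> \<le> C1 * real N powr (H - 1/2)"
    and t2: "\<forall>n\<in>{1..N}. \<bar>\<theta> 2 n \<omega>\<bar> \<le> C2 * real N powr (H - 1/2)"
  shows "(\<Sum>k=1..n. if active N (int (k - 1)) \<omega> then \<theta> 1 k \<omega> + \<theta> 2 k \<omega> + \<theta> 3 k \<omega> + \<theta> 4 k \<omega> else 0) / real N
    \<ge> - c_hat H C1 C2 N"
proof -
  obtain m where m: "m \<le> n" "m = 0 \<or> active N (int (m - 1)) \<omega>"
    and eq: "(\<Sum>k=1..n. if active N (int (k - 1)) \<omega> then \<theta> 1 k \<omega> + \<theta> 2 k \<omega> + \<theta> 3 k \<omega> + \<theta> 4 k \<omega> else 0)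
      = (\<Sum>k=1..m. \<theta> 1 k \<omega> + \<theta> 2 k \<omega> + \<theta> 3 k \<omega> + \<theta> 4 k \<omega>)"
    using stopped_sum[of "\<lambda>k. active N (int k) \<omega>" n "\<lambda>k. \<theta> 1 k \<omega> + \<theta> 2 k \<omega> + \<theta> 3 k \<omega> + \<theta> 4 k \<omega>"]
    by (metis (no_types, lifting) active_mono of_nat_mono)
  have "(\<Sum>k=1..m. \<theta> 1 k \<omega> + \<theta> 2 k \<omega> + \<theta> 3 k \<omega> + \<theta> 4 k \<omega>) = \<theta>s 1 m \<omega> + \<theta>s 2 m \<omega> + \<theta>s 3 m \<omega> + \<theta>s 4 m \<omega>"
    by (simp add: theta_sum_def sum.distrib)
  with eq have eq: "(\<Sum>k=1..n. if active N (int (k - 1)) \<omega> then \<theta> 1 k \<omega> + \<theta> 2 k \<omega> + \<theta> 3 k \<omega> + \<theta> 4 k \<omega> else 0)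
      / real N = \<theta>s 1 m \<omega> / real N + \<theta>s 2 m \<omega> / real N + \<theta>s 3 m \<omega> / real N + \<theta>s 4 m \<omega> / real N"
    by (simp add: add_divide_distrib)
  have pw: "C * real N powr (H - 1/2) / real N = C / real N powr (3/2 - H)" for C
  proof -
    have "real N powr (H - 1/2) * real N powr (3/2 - H) = real N"
      using N by (simp flip: powr_add)
    then show ?thesis using N by (simp add: field_simps)
  qed
  have ch: "c_hat H C1 C2 N = 4 * eps H N + C1 / real N powr (3/2 - H) + C2 / real N powr (3/2 - H)"
    by (simp add: c_hat_def add_divide_distrib)
  show ?thesis
  proof (cases "m = 0")
    case True
    then show ?thesis unfolding eq ch using e C
      by (simp add: theta_sum_def) (smt (verit) divide_nonneg_nonneg powr_ge_zero)
  next
    case False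
    with m have act: "active N (int (m - 1)) \<omega>" by simp
    note nh = act[unfolded less_stop_time_iff]
    have m1: "m \<in> {1..N}" using False m n by auto
    have 34: "- eps H N \<le> \<theta>s 3 m \<omega> / real N" "- eps H N \<le> \<theta>s 4 m \<omega> / real N"
      using nh m1 by (auto simp: no_hit_def)
    have 12: "- eps H N \<le> \<theta>s i (m - 1) \<omega> / real N" if "i = 1 \<or> i = 2" for i
    proof (cases "m = 1")
      case True
      then show ?thesis using e by (simp add: theta_sum_def)
    next
      case False
      then have "m - 1 \<in> {1..N}" using m1 by auto
      with nh that show ?thesis by (auto simp: no_hit_def)
    qed
    have "\<theta>s i m \<omega> = \<theta>s i (m - 1) \<omega> + \<theta> i m \<omega>" for i
      using False by (cases m) (auto simp: theta_sum_def)
    then have d: "\<theta>s i m \<omega> / real N = \<theta>s i (m - 1) \<omega> / real N + \<theta> i m \<omega> / real N" for i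
      by (simp add: add_divide_distrib)
    have low: "- (C / real N powr (3/2 - H)) \<le> t / real N" if "\<bar>t\<bar> \<le> C * real N powr (H - 1/2)" for C t
    proof -
      have "- (C * real N powr (H - 1/2)) / real N \<le> t / real N"
        using that by (intro divide_right_mono) (simp_all add: abs_le_iff)
      then show ?thesis by (simp add: pw)
    qed
    from low t1 m1 have "- (C1 / real N powr (3/2 - H)) \<le> \<theta> 1 m \<omega> / real N" by blast
    moreover from low t2 m1 have "- (C2 / real N powr (3/2 - H)) \<le> \<theta> 2 m \<omega> / real N" by blast
    ultimately show ?thesis unfolding eq ch
      using 34 12[of 1] 12[of 2] d[of 1] d[of 2] by simp
  qed
qed

section \<open>Adaptedness of the strategies\<close>

lemma bounded_adapted_Y: "k \<le> n + 1 \<Longrightarrow> bounded_adapted n (Y k)"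
  unfolding Yproc_def
  by (intro bounded_adapted_sum bounded_adapted_mult bounded_adapted_const bounded_adapted_xi) auto

lemma Y_F: "k \<le> n + 1 \<Longrightarrow> Y k \<in> borel_measurable (F n)"
  using bounded_adapted_Y unfolding bounded_adapted_def by blast

lemma X_F: assumes "1 \<le> k" "k \<le> n" shows "X k \<in> borel_measurable (F n)"
proof -
  have [measurable]: "Y k \<in> borel_measurable (F n)" "\<xi> k \<in> borel_measurable (F n)"
    using assms Y_F xi_F by auto
  show ?thesis unfolding Xproc_def[abs_def] by measurable
qed

lemma S_F: "k \<le> n \<Longrightarrow> S N k \<in> borel_measurable (F n)"
proof (induction k)
  case 0
  then show ?case by (simp cong: measurable_cong)
next
  case (Suc k)
  have [measurable]: "X (Suc k) \<in> borel_measurable (F n)" "S N k \<in> borel_measurable (F n)"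
    using Suc X_F[of "Suc k" n] by auto
  have "S N (Suc k) = (\<lambda>\<omega>. (1 + X (Suc k) \<omega> / real N powr H) * S N k \<omega>)" by (rule ext) simp
  then show ?case by simp
qed

lemma theta_F:
  assumes "k \<le> n \<or> i \<noteq> 1 \<and> i \<noteq> 2 \<and> k \<le> n + 1"
  shows "\<theta> i k \<in> borel_measurable (F n)"
proof (cases "k < 2")
  case True
  then have "\<theta> i k = (\<lambda>\<omega>. 0)" by (auto simp: theta_def)
  then show ?thesis by simp
next
  case False
  have k: "k \<le> n + 1" using assms by auto
  have [measurable]: "Y k \<in> borel_measurable (F n)" "Y (k - 1) \<in> borel_measurable (F n)"
    "\<xi> (k - 1) \<in> borel_measurable (F n)"
    using False k by (auto intro!: Y_F xi_F)
  show ?thesis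
  proof (cases "i = 1 \<or> i = 2")
    case True
    then have [measurable]: "\<xi> k \<in> borel_measurable (F n)" using assms False by (auto intro!: xi_F)
    from True show ?thesis using False unfolding theta_def[abs_def] by auto
  next
    case i: False
    then show ?thesis using False unfolding theta_def[abs_def] by simp
  qed
qed

lemma no_hit_F:
  assumes "k \<le> n \<or> i \<noteq> 1 \<and> i \<noteq> 2 \<and> k \<le> n + 1"
  shows "{\<omega>\<in>space (F n). no_hit H \<sigma> \<xi> N i k \<omega>} \<in> sets (F n)"
proof -
  have "\<theta> i j \<in> borel_measurable (F n)" if "j \<in> {1..k}" for j
    using assms that by (intro theta_F) auto
  then have [measurable]: "\<theta>s i k \<in> borel_measurable (F n)"
    unfolding theta_sum_def[abs_def] by (rule borel_measurable_sum)
  show ?thesis unfolding no_hit_def by measurable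
qed

lemma active_F:
  assumes "k \<ge> 0"
  shows "{\<omega>\<in>space (F (nat k)). active N k \<omega>} \<in> sets (F (nat k))"
  unfolding less_stop_time_iff
proof (intro sets.sets_Collect_finite_All sets.sets_Collect_conj)
  fix j
  show "{\<omega>\<in>space (F (nat k)). int j \<le> k \<longrightarrow> no_hit H \<sigma> \<xi> N 1 j \<omega> \<and> no_hit H \<sigma> \<xi> N 2 j \<omega>} \<in> sets (F (nat k))"
  proof (cases "int j \<le> k")
    case True
    then have "j \<le> nat k" by linarith
    with True show ?thesis
      by (simp only: simp_thms) (intro sets.sets_Collect_conj no_hit_F; simp)
  qed simp
  show "{\<omega>\<in>space (F (nat k)). int j \<le> k + 1 \<longrightarrow> no_hit H \<sigma> \<xi> N 3 j \<omega> \<and> no_hit H \<sigma> \<xi> N 4 j \<omega>} \<in> sets (F (nat k))"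
  proof (cases "int j \<le> k + 1")
    case True
    then have "j \<le> nat k + 1" using assms by linarith
    with True show ?thesis
      by (simp only: simp_thms) (intro sets.sets_Collect_conj no_hit_F; simp)
  qed simp
qed simp

lemma psi_stock_nonpos: "k \<le> 0 \<Longrightarrow> psi_stock H \<sigma> s0 \<xi> C1 C2 N k \<omega> = 0"
  by (simp add: psi_stock_def phi_stock_def)

lemma psi_stock_F: "psi_stock H \<sigma> s0 \<xi> C1 C2 N k \<in> borel_measurable (F (nat k))"
proof (cases "k \<le> 0")
  case True
  then have "psi_stock H \<sigma> s0 \<xi> C1 C2 N k = (\<lambda>\<omega>. 0)" using psi_stock_nonpos by blast
  then show ?thesis by simp
next
  case False
  then have k: "k \<ge> 1" by simp
  have [measurable]: "X (nat k) \<in> borel_measurable (F (nat k))" "S N (nat k) \<in> borel_measurable (F (nat k))"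
    using k by (auto intro!: X_F S_F)
  have [measurable]: "(\<lambda>\<omega>. if active N k \<omega> then 1 else 0 :: real) \<in> borel_measurable (F (nat k))"
    using active_F[of k N] k by (intro measurable_If) auto
  have "phi_stock H \<sigma> s0 \<xi> N k = (\<lambda>\<omega>. real N powr (H - 1) * (X (nat k) \<omega> / S N (nat k) \<omega>))"
    using k by (auto simp: phi_stock_def)
  then have [measurable]: "phi_stock H \<sigma> s0 \<xi> N k \<in> borel_measurable (F (nat k))" by simp
  show ?thesis unfolding psi_stock_def[abs_def] by measurable
qed

lemma psi_bond_F: "psi_bond H \<sigma> s0 \<xi> C1 C2 lam N n \<in> borel_measurable (F (nat n))"
proof -
  have 1: "psi_stock H \<sigma> s0 \<xi> C1 C2 N k \<in> borel_measurable (F (nat n))"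
    "psi_stock H \<sigma> s0 \<xi> C1 C2 N (k - 1) \<in> borel_measurable (F (nat n))"
    "S N (nat k) \<in> borel_measurable (F (nat n))" if "k \<in> {0..n}" for k
  proof -
    from that show "psi_stock H \<sigma> s0 \<xi> C1 C2 N k \<in> borel_measurable (F (nat n))"
      by (intro F_mono[OF _ psi_stock_F]) (auto intro: nat_mono)
    from that show "psi_stock H \<sigma> s0 \<xi> C1 C2 N (k - 1) \<in> borel_measurable (F (nat n))"
      by (intro F_mono[OF _ psi_stock_F]) (auto intro: nat_mono)
    from that show "S N (nat k) \<in> borel_measurable (F (nat n))"
      by (intro S_F) (auto intro: nat_mono)
  qed
  show ?thesis unfolding psi_bond_def self_financing_bond_def[abs_def]
    by (intro borel_measurable_add borel_measurable_uminus borel_measurable_times borel_measurable_const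
        borel_measurable_sum borel_measurable_max borel_measurable_diff 1)
qed

lemma psi_self_financing:
  "self_financing M F (S N) N (lam N) (psi_bond H \<sigma> s0 \<xi> C1 C2 lam N) (psi_stock H \<sigma> s0 \<xi> C1 C2 N)"
  unfolding self_financing_def
proof (intro conjI ballI)
  fix n \<omega> assume "n \<in> {0..int N}"
  then have "{0..n} = insert n {0..n - 1}" by auto
  then have s: "(\<Sum>k\<in>{0..n}. f k) = f n + (\<Sum>k\<in>{0..n-1}. f k)" for f :: "int \<Rightarrow> real" by simp
  show "psi_bond H \<sigma> s0 \<xi> C1 C2 lam N n \<omega> - psi_bond H \<sigma> s0 \<xi> C1 C2 lam N (n - 1) \<omega>
      \<le> - max (psi_stock H \<sigma> s0 \<xi> C1 C2 N n \<omega> - psi_stock H \<sigma> s0 \<xi> C1 C2 N (n - 1) \<omega>) 0 * S N (nat n) \<omega>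
        + (1 - lam N) * max (- (psi_stock H \<sigma> s0 \<xi> C1 C2 N n \<omega> - psi_stock H \<sigma> s0 \<xi> C1 C2 N (n - 1) \<omega>)) 0 * S N (nat n) \<omega>"
    unfolding psi_bond_def self_financing_bond_def s by (simp add: algebra_simps)
qed (rule psi_bond_F psi_stock_F)+

lemma psi_zero_endowment:
  "zero_endowment M (psi_bond H \<sigma> s0 \<xi> C1 C2 lam N) (psi_stock H \<sigma> s0 \<xi> C1 C2 N)"
  unfolding zero_endowment_def psi_bond_def self_financing_bond_def by (simp add: psi_stock_nonpos)

section \<open>Fluctuations of the four sums\<close>

lemma g_sq_le: "n \<ge> 1 \<Longrightarrow> (g n)\<^sup>2 \<le> coef_const\<^sup>2"
  by (intro power_mono gcoef_le gcoef_nonneg)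

text \<open>A bound on the second moments of the factors that multiply \<open>\<xi> k\<close> in the martingale parts of
the sums \<open>1\<close>, \<open>2\<close> and \<open>3\<close>.\<close>

definition factor_const :: real where "factor_const = coef_const\<^sup>2 * coef_const\<^sup>2 + coef_const\<^sup>2 * row_sq_const"

lemma row_sq_const_nonneg: "row_sq_const \<ge> 0"
  using sum_J_sq_le[of 0 0] by simp

lemma factor_const_nonneg: "factor_const \<ge> 0" by (simp add: factor_const_def row_sq_const_nonneg)

lemma theta1_deviation:
  assumes "L > 0"
  shows "prob {\<omega>\<in>space M. \<exists>m\<in>{1..N}. \<bar>\<theta>s 1 m \<omega>\<bar> \<ge> L} \<le> real N * factor_const / L\<^sup>2"
proof -
  define f where "f k \<omega> = (if k < 2 then 0 else g (k - 1) * g k) * \<xi> (k - 1) \<omega>" for k \<omega>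
  have f: "bounded_adapted (k - 1) (f k)" for k
  proof (cases "k < 2")
    case True
    then have "f k = (\<lambda>_. 0)" by (auto simp: f_def)
    then show ?thesis by (simp add: bounded_adapted_const)
  next
    case False
    then show ?thesis unfolding f_def
      by (intro bounded_adapted_mult bounded_adapted_const bounded_adapted_xi) auto
  qed
  have E: "expectation (\<lambda>\<omega>. (f k \<omega>)\<^sup>2) \<le> factor_const" for k
  proof (rule integral_le_const)
    show "integrable M (\<lambda>\<omega>. (f k \<omega>)\<^sup>2)" unfolding power2_eq_square
      by (rule bounded_adapted_integrable[OF bounded_adapted_mult[OF f f]])
    show "AE \<omega> in M. (f k \<omega>)\<^sup>2 \<le> factor_const"
      using AE_sign
    proof eventually_elim
      case (elim \<omega>)
      show ?case
      proof (cases "k < 2")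
        case True
        then show ?thesis using factor_const_nonneg by (simp add: f_def)
      next
        case False
        then have "k - 1 \<ge> 1" by simp
        then have "(\<xi> (k - 1) \<omega>)\<^sup>2 = 1" using elim by force
        then have "(f k \<omega>)\<^sup>2 = (g (k - 1))\<^sup>2 * (g k)\<^sup>2" using False by (simp add: f_def power_mult_distrib)
        also have "\<dots> \<le> coef_const\<^sup>2 * coef_const\<^sup>2" using False by (intro mult_mono g_sq_le) auto
        also have "\<dots> \<le> factor_const" by (simp add: factor_const_def row_sq_const_nonneg)
        finally show ?thesis .
      qed
    qed
  qed
  have eq: "\<theta>s 1 m \<omega> = (\<Sum>k=1..m. \<xi> k \<omega> * f k \<omega>)" for m \<omega>
    unfolding theta_sum_def by (intro sum.cong) (auto simp: theta_def f_def)
  have "(\<Sum>k=1..N. expectation (\<lambda>\<omega>. (f k \<omega>)\<^sup>2)) \<le> (\<Sum>k=1..N. factor_const)" by (intro sum_mono E)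
  then show ?thesis unfolding eq by (intro maximal_inequality f assms) simp
qed

lemma linear_second_moment_le:
  assumes "k \<le> n + 1" "c\<^sup>2 \<le> coef_const\<^sup>2" and "A \<subseteq> {1..n}"
  shows "expectation (\<lambda>\<omega>. (c * (\<Sum>i\<in>A. J k i * \<xi> i \<omega>))\<^sup>2) \<le> factor_const"
proof -
  have "(\<Sum>i\<in>A. J k i * \<xi> i \<omega>) = (\<Sum>i=1..n. (if i \<in> A then J k i else 0) * \<xi> i \<omega>)" for \<omega>
    using assms(3) by (intro sum.mono_neutral_cong_left) auto
  then have "expectation (\<lambda>\<omega>. (c * (\<Sum>i\<in>A. J k i * \<xi> i \<omega>))\<^sup>2) = c\<^sup>2 * (\<Sum>i=1..n. (if i \<in> A then J k i else 0)\<^sup>2)"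
    by (simp add: power_mult_distrib second_moment_linear del: One_nat_def)
  also have "\<dots> \<le> c\<^sup>2 * (\<Sum>i=1..n+1. (J k i)\<^sup>2)"
    by (intro mult_left_mono order_trans[OF sum_mono[of _ _ "\<lambda>i. (J k i)\<^sup>2"] sum_mono2]) auto
  also have "\<dots> \<le> coef_const\<^sup>2 * row_sq_const"
    using assms by (intro mult_mono sum_J_sq_le) (auto intro!: sum_nonneg add_nonneg_nonneg)
  also have "\<dots> \<le> factor_const" by (simp add: factor_const_def)
  finally show ?thesis .
qed

lemma theta2_deviation:
  assumes "L > 0"
  shows "prob {\<omega>\<in>space M. \<exists>m\<in>{1..N}. \<bar>\<theta>s 2 m \<omega>\<bar> \<ge> L} \<le> real N * factor_const / L\<^sup>2"
proof -
  define f where "f k \<omega> = (if k < 2 then 0 else g k) * Y (k - 1) \<omega>" for k \<omega>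
  have f: "bounded_adapted (k - 1) (f k)" for k
    unfolding f_def by (intro bounded_adapted_mult bounded_adapted_const bounded_adapted_Y) auto
  have E: "expectation (\<lambda>\<omega>. (f k \<omega>)\<^sup>2) \<le> factor_const" for k
  proof -
    have Y: "Y (k - 1) \<omega> = (\<Sum>i\<in>{1..k}. J (k - 1) i * \<xi> i \<omega>)" for \<omega>
      by (rule Y_eq_J) simp
    show ?thesis unfolding f_def Y by (rule linear_second_moment_le) (auto intro: g_sq_le)
  qed
  have eq: "\<theta>s 2 m \<omega> = (\<Sum>k=1..m. \<xi> k \<omega> * f k \<omega>)" for m \<omega>
    unfolding theta_sum_def by (intro sum.cong) (auto simp: theta_def f_def)
  have "(\<Sum>k=1..N. expectation (\<lambda>\<omega>. (f k \<omega>)\<^sup>2)) \<le> (\<Sum>k=1..N. factor_const)" by (intro sum_mono E)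
  then show ?thesis unfolding eq by (intro maximal_inequality f assms) simp
qed

text \<open>In \<open>theta\<close> with index \<open>3\<close> at time \<open>k + 1\<close>, that is \<open>g k * \<xi> k * Y (k + 1)\<close>, the variable \<open>Y (k + 1)\<close> contains
\<open>\<xi> k\<close> itself. This is the factor of \<open>\<xi> k\<close> that is left when that term is removed from \<open>Y (k + 1)\<close>.\<close>

definition theta3_factor :: "nat \<Rightarrow> 'a \<Rightarrow> real" where
  "theta3_factor k \<omega> = g k * (\<Sum>i=1..k-1. J (k + 1) i * \<xi> i \<omega>)"

text \<open>The term that is removed in \<open>theta3_factor\<close> contributes \<open>g k * J (k + 1) k * (\<xi> k)\<^sup>2\<close>, a nonnegative drift.\<close>

lemma theta3_ge:
  assumes sgn: "\<forall>i\<ge>1. \<xi> i \<omega> = 1 \<or> \<xi> i \<omega> = -1"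
  shows "\<theta>s 3 (Suc m) \<omega> \<ge> (\<Sum>k=1..m. \<xi> k \<omega> * theta3_factor k \<omega>)"
proof (induction m)
  case 0
  then show ?case by (simp add: theta_sum_def theta_def)
next
  case (Suc m)
  define k where "k = Suc m"
  have sq: "\<xi> k \<omega> * \<xi> k \<omega> = 1" using sgn by (auto simp: k_def dest: spec[of _ "Suc m"])
  have "Y (k + 1) \<omega> = (\<Sum>i=1..k. J (k + 1) i * \<xi> i \<omega>)" by (rule Y_eq_J) simp
  also have "\<dots> = (\<Sum>i=1..k-1. J (k + 1) i * \<xi> i \<omega>) + J (k + 1) k * \<xi> k \<omega>"
    by (simp add: k_def)
  finally have Y: "Y (k + 1) \<omega> = \<dots>" .
  have "\<theta> 3 (k + 1) \<omega> = g k * \<xi> k \<omega> * Y (k + 1) \<omega>" by (simp add: theta_def k_def)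
  also have "\<dots> = \<xi> k \<omega> * theta3_factor k \<omega> + g k * J (k + 1) k * (\<xi> k \<omega> * \<xi> k \<omega>)"
    unfolding Y theta3_factor_def by (simp add: algebra_simps)
  also have "\<dots> \<ge> \<xi> k \<omega> * theta3_factor k \<omega>"
    unfolding sq by (simp add: gcoef_nonneg J_nonneg)
  finally have "\<theta> 3 (Suc (Suc m)) \<omega> \<ge> \<xi> (Suc m) \<omega> * theta3_factor (Suc m) \<omega>" by (simp add: k_def)
  with Suc show ?case by (simp add: theta_sum_def)
qed

lemma theta3_deviation:
  assumes "L > 0"
  shows "prob {\<omega>\<in>space M. \<exists>m\<in>{1..N}. \<bar>\<Sum>k=1..m. \<xi> k \<omega> * theta3_factor k \<omega>\<bar> \<ge> L} \<le> real N * factor_const / L\<^sup>2"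
proof -
  have h: "bounded_adapted (k - 1) (theta3_factor k)" for k
    unfolding theta3_factor_def
    by (intro bounded_adapted_mult bounded_adapted_const bounded_adapted_sum bounded_adapted_xi) auto
  have E: "expectation (\<lambda>\<omega>. (theta3_factor k \<omega>)\<^sup>2) \<le> factor_const" if "k \<ge> 1" for k
    unfolding theta3_factor_def using that by (intro linear_second_moment_le[of _ k] g_sq_le) auto
  have "(\<Sum>k=1..N. expectation (\<lambda>\<omega>. (theta3_factor k \<omega>)\<^sup>2)) \<le> (\<Sum>k=1..N. factor_const)" by (intro sum_mono E) auto
  then show ?thesis by (intro maximal_inequality h assms) simp
qed

text \<open>For \<open>e = 1\<close> and \<open>e = -1\<close> these are the increasing processes that arise from polarising the products
\<open>Y (k - 1) * Y k\<close>.\<close>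

definition polar_sum :: "real \<Rightarrow> nat \<Rightarrow> 'a \<Rightarrow> real" where
  "polar_sum e n \<omega> = (\<Sum>k=1..n. ((Y k \<omega> + e * Y (k - 1) \<omega>) / 2)\<^sup>2)"

text \<open>The mean of \<open>polar_sum\<close>, that is, its diagonal part as a quadratic form in the signs.\<close>

definition polar_mean :: "real \<Rightarrow> nat \<Rightarrow> real" where
  "polar_mean e n = (\<Sum>k=1..n. \<Sum>i=1..k. ((J k i + e * J (k - 1) i) / 2)\<^sup>2)"

lemma theta4_eq: "\<theta>s 4 n \<omega> = polar_sum 1 n \<omega> - polar_sum (-1) n \<omega>"
  unfolding theta_sum_def polar_sum_def sum_subtractf[symmetric]
proof (rule sum.cong[OF refl])
  fix k assume k: "k \<in> {1..n}"
  show "\<theta> 4 k \<omega> = ((Y k \<omega> + 1 * Y (k - 1) \<omega>) / 2)\<^sup>2 - ((Y k \<omega> + - 1 * Y (k - 1) \<omega>) / 2)\<^sup>2"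
  proof (cases "k < 2")
    case True
    with k have "k = 1" by auto
    then show ?thesis by (simp add: theta_def Yproc_def)
  next
    case False
    then show ?thesis by (simp add: theta_def power2_eq_square field_simps)
  qed
qed

lemma mono_polar_sum: "mono (\<lambda>n. polar_sum e n \<omega>)"
  by (rule incseq_SucI) (simp add: polar_sum_def)

lemma polar_mean_columns: "polar_mean e n = (\<Sum>k=1..n. \<Sum>i=1..n. ((J k i + e * J (k - 1) i) / 2)\<^sup>2)"
  unfolding polar_mean_def
proof (rule sum.cong[OF refl])
  fix k assume "k \<in> {1..n}"
  then show "(\<Sum>i=1..k. ((J k i + e * J (k - 1) i) / 2)\<^sup>2) = (\<Sum>i=1..n. ((J k i + e * J (k - 1) i) / 2)\<^sup>2)"
    by (intro sum.mono_neutral_left) (auto simp: J_zero)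
qed

lemma sum_J_pair_sq_le:
  assumes "k \<le> n"
  shows "(\<Sum>i=1..n. (J k i + J (k - 1) i)\<^sup>2) \<le> 4 * row_sq_const"
proof -
  have "(\<Sum>i=1..n. (J k i + J (k - 1) i)\<^sup>2) \<le> (\<Sum>i=1..n. 2 * (J k i)\<^sup>2 + 2 * (J (k - 1) i)\<^sup>2)"
  proof (rule sum_mono)
    fix i
    have "0 \<le> (J k i - J (k - 1) i)\<^sup>2" by simp
    then show "(J k i + J (k - 1) i)\<^sup>2 \<le> 2 * (J k i)\<^sup>2 + 2 * (J (k - 1) i)\<^sup>2"
      by (simp add: power2_eq_square algebra_simps)
  qed
  also have "\<dots> = 2 * (\<Sum>i=1..n. (J k i)\<^sup>2) + 2 * (\<Sum>i=1..n. (J (k - 1) i)\<^sup>2)"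
    by (simp add: sum.distrib sum_distrib_left)
  also have "\<dots> \<le> 2 * row_sq_const + 2 * row_sq_const"
    using assms by (intro add_mono mult_left_mono sum_J_sq_le) auto
  finally show ?thesis by simp
qed

lemma abs_J_pair_le:
  assumes "\<bar>e\<bar> = 1"
  shows "\<bar>(J k i + e * J (k - 1) i) / 2\<bar> \<le> J k i + J (k - 1) i"
proof -
  have "\<bar>J k i + e * J (k - 1) i\<bar> \<le> \<bar>J k i\<bar> + \<bar>e * J (k - 1) i\<bar>" by (rule abs_triangle_ineq)
  also have "\<dots> = J k i + J (k - 1) i" using assms by (simp add: abs_mult J_nonneg)
  finally have "\<bar>J k i + e * J (k - 1) i\<bar> \<le> J k i + J (k - 1) i" .
  moreover have "0 \<le> J k i + J (k - 1) i" by (simp add: J_nonneg)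
  ultimately show ?thesis by simp
qed

text \<open>The order \<open>n powr (2 * H)\<close>, which stems from \<open>sum_J_col_sq_le\<close>, is \<open>o(n\<^sup>2)\<close>. Deviations that are proportional to \<open>n\<close>
are therefore unlikely.\<close>

lemma polar_sum_deviation:
  assumes e: "\<bar>e\<bar> = 1" and L: "L > 0"
  shows "prob {\<omega>\<in>space M. \<bar>polar_sum e n \<omega> - polar_mean e n\<bar> \<ge> L} \<le> 16 * row_sq_const * col_sq_const * real n powr (2 * H) / L\<^sup>2"
proof -
  have eq: "polar_sum e n \<omega> = (\<Sum>k=1..n. (\<Sum>i=1..n. ((J k i + e * J (k - 1) i) / 2) * \<xi> i \<omega>)\<^sup>2)" for \<omega>
    unfolding polar_sum_def
  proof (rule sum.cong[OF refl])
    fix k assume "k \<in> {1..n}"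
    then have Y: "Y k \<omega> = (\<Sum>i=1..n. J k i * \<xi> i \<omega>)" "Y (k - 1) \<omega> = (\<Sum>i=1..n. J (k - 1) i * \<xi> i \<omega>)"
      by (auto intro!: Y_eq_J simp del: One_nat_def)
    have "(Y k \<omega> + e * Y (k - 1) \<omega>) / 2 = (\<Sum>i=1..n. ((J k i + e * J (k - 1) i) / 2) * \<xi> i \<omega>)"
      unfolding Y sum_distrib_left sum.distrib[symmetric] sum_divide_distrib
      by (intro sum.cong) (simp_all add: field_simps)
    then show "((Y k \<omega> + e * Y (k - 1) \<omega>) / 2)\<^sup>2 = (\<Sum>i=1..n. ((J k i + e * J (k - 1) i) / 2) * \<xi> i \<omega>)\<^sup>2" by simp
  qed
  have "prob {\<omega>\<in>space M. \<bar>polar_sum e n \<omega> - polar_mean e n\<bar> \<ge> L}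
     \<le> 4 * (4 * row_sq_const) * (\<Sum>i=1..n. (\<Sum>k=1..n. J k i + J (k - 1) i)\<^sup>2) / L\<^sup>2"
    unfolding eq polar_mean_columns
  proof (rule quadratic_form_deviation[OF abs_J_pair_le[OF e] _ L])
    fix k assume "k \<in> {1..n}"
    then show "(\<Sum>i=1..n. (J k i + J (k - 1) i)\<^sup>2) \<le> 4 * row_sq_const" by (intro sum_J_pair_sq_le) auto
  qed
  also have "\<dots> \<le> 4 * (4 * row_sq_const) * (col_sq_const * real n powr (2 * H)) / L\<^sup>2"
    using row_sq_const_nonneg by (intro divide_right_mono mult_left_mono sum_J_col_sq_le) auto
  finally show ?thesis by (simp add: ac_simps)
qed

text \<open>The difference is the sum of the covariances of \<open>Y (k - 1)\<close> and \<open>Y k\<close>. For \<open>k \<ge> 3\<close> the common sign \<open>\<xi> (k - 2)\<close>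
contributes at least \<open>coef_low\<^sup>2\<close>, and no common sign contributes negatively.\<close>

lemma polar_mean_gap: "polar_mean 1 n - polar_mean (-1) n \<ge> coef_low\<^sup>2 * (real n - 2)"
proof -
  have "polar_mean 1 n - polar_mean (-1) n = (\<Sum>k=1..n. \<Sum>i=1..k. J k i * J (k - 1) i)"
    unfolding polar_mean_def sum_subtractf[symmetric]
    by (intro sum.cong refl) (simp add: power2_eq_square field_simps)
  also have "\<dots> \<ge> (\<Sum>k=1..n. if k \<ge> 3 then coef_low\<^sup>2 else 0)"
  proof (rule sum_mono)
    fix k
    show "(if k \<ge> 3 then coef_low\<^sup>2 else 0) \<le> (\<Sum>i=1..k. J k i * J (k - 1) i)"
    proof (cases "k \<ge> 3")
      case True
      then have "coef_low \<le> J k (k - 2)" "coef_low \<le> J (k - 1) (k - 2)"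
        using jcoef_ge[of "k - 2" k] jcoef_ge[of "k - 2" "k - 1"] by (auto simp: J_def)
      then have "coef_low\<^sup>2 \<le> J k (k - 2) * J (k - 1) (k - 2)"
        unfolding power2_eq_square using coef_low_pos by (intro mult_mono) (auto simp: J_nonneg)
      also have "\<dots> \<le> (\<Sum>i=1..k. J k i * J (k - 1) i)"
        using True by (intro member_le_sum) (auto simp: J_nonneg)
      finally show ?thesis using True by simp
    qed (auto intro!: sum_nonneg simp: J_nonneg)
  qed
  also have "(\<Sum>k=1..n. if k \<ge> 3 then coef_low\<^sup>2 else 0) = (\<Sum>k\<in>{3..n}. coef_low\<^sup>2)"
    by (intro sum.mono_neutral_cong_right) auto
  also have "\<dots> \<ge> coef_low\<^sup>2 * (real n - 2)"
  proof (cases "n \<ge> 2")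
    case False
    then have "coef_low\<^sup>2 * (real n - 2) \<le> 0" by (intro mult_nonneg_nonpos) auto
    also have "0 \<le> (\<Sum>k\<in>{3..n}. coef_low\<^sup>2)" by (intro sum_nonneg) auto
    finally show ?thesis .
  qed (auto simp: of_nat_diff algebra_simps)
  finally show ?thesis .
qed

lemma polar_mean_increment:
  assumes "m \<le> n"
  shows "polar_mean (-1) n - polar_mean (-1) m \<le> row_sq_const * real (n - m)"
proof -
  have "{1..n} = {1..m} \<union> {m<..n}" using assms by auto
  then have "polar_mean (-1) n = polar_mean (-1) m + (\<Sum>k\<in>{m<..n}. \<Sum>i=1..k. ((J k i + -1 * J (k - 1) i) / 2)\<^sup>2)"
    unfolding polar_mean_def by (simp add: sum.union_disjoint ivl_disj_int del: One_nat_def)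
  also have "(\<Sum>k\<in>{m<..n}. \<Sum>i=1..k. ((J k i + -1 * J (k - 1) i) / 2)\<^sup>2) \<le> (\<Sum>k\<in>{m<..n}. row_sq_const)"
  proof (rule sum_mono)
    fix k
    have "(\<Sum>i=1..k. ((J k i + -1 * J (k - 1) i) / 2)\<^sup>2) \<le> (\<Sum>i=1..k. (J k i + J (k - 1) i)\<^sup>2 / 4)"
    proof (rule sum_mono)
      fix i
      have "0 \<le> J k i * J (k - 1) i" by (simp add: J_nonneg)
      then show "((J k i + -1 * J (k - 1) i) / 2)\<^sup>2 \<le> (J k i + J (k - 1) i)\<^sup>2 / 4"
        by (simp add: power2_eq_square field_simps)
    qed
    also have "\<dots> = (\<Sum>i=1..k. (J k i + J (k - 1) i)\<^sup>2) / 4" by (simp add: sum_divide_distrib)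
    also have "\<dots> \<le> row_sq_const" using sum_J_pair_sq_le[of k k] by simp
    finally show "(\<Sum>i=1..k. ((J k i + -1 * J (k - 1) i) / 2)\<^sup>2) \<le> row_sq_const" .
  qed
  finally show ?thesis by (simp add: mult.commute)
qed

definition net_const :: real where "net_const = 2 * (16 * row_sq_const * col_sq_const / (coef_low\<^sup>2 / 4)\<^sup>2) / (2 * H - 1)"

lemma col_sq_const_nonneg: "col_sq_const \<ge> 0" unfolding col_sq_const_def using H_lt by simp

lemma net_const_nonneg: "net_const \<ge> 0" unfolding net_const_def using H_gt row_sq_const_nonneg col_sq_const_nonneg by simp

text \<open>The exceptional event for the net of the multiples of \<open>h\<close>, as required by \<open>net_lower_bound\<close> for
\<open>\<nu> = coef_low\<^sup>2\<close>.\<close>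

definition net_fails :: "nat \<Rightarrow> nat \<Rightarrow> 'a set" where
  "net_fails h r = {\<omega>\<in>space M. \<exists>s\<in>{1..r}.
     \<bar>polar_sum 1 (s * h) \<omega> - polar_mean 1 (s * h)\<bar> \<ge> coef_low\<^sup>2 / 4 * real (s * h) \<or>
     \<bar>polar_sum (-1) (s * h) \<omega> - polar_mean (-1) (s * h)\<bar> \<ge> coef_low\<^sup>2 / 4 * real (s * h)}"

lemma polar_sum_measurable [measurable]: "polar_sum e n \<in> borel_measurable M"
proof -
  have [measurable]: "Y k \<in> borel_measurable M" for k
    by (rule F_M[OF Y_F[of k k]]) simp
  show ?thesis unfolding polar_sum_def[abs_def] by measurable
qed

lemma net_fails_event: "net_fails h r \<in> events"
  unfolding net_fails_def by measurable

text \<open>At the net point \<open>s * h\<close> the deviation bound is of order \<open>(s * h) powr (2 * H) / (s * h)\<^sup>2\<close>; as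
\<open>2 * H - 2 > -1\<close>, the sum over \<open>s\<close> is governed by its length \<open>r\<close>.\<close>

lemma net_fails_prob:
  assumes h: "h \<ge> 1" and r: "r \<ge> 1"
  shows "prob (net_fails h r) \<le> net_const * real (r * h) powr (2 * H - 1) / real h"
proof -
  define B where "B e s = {\<omega>\<in>space M. \<bar>polar_sum e (s * h) \<omega> - polar_mean e (s * h)\<bar> \<ge> coef_low\<^sup>2 / 4 * real (s * h)}" for e s
  have Bev: "B e s \<in> events" for e s unfolding B_def by measurable
  define c where "c = 16 * row_sq_const * col_sq_const / (coef_low\<^sup>2 / 4)\<^sup>2"
  have c: "c \<ge> 0" unfolding c_def using row_sq_const_nonneg col_sq_const_nonneg by simp
  have PB: "prob (B e s) \<le> c * (real h powr (2 * H - 2) * real s powr (2 * H - 2))"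
    if e: "\<bar>e\<bar> = 1" and s: "s \<in> {1..r}" for e s
  proof -
    have sh: "real (s * h) > 0" using s h by simp
    have "prob (B e s) \<le> 16 * row_sq_const * col_sq_const * real (s * h) powr (2 * H) / (coef_low\<^sup>2 / 4 * real (s * h))\<^sup>2"
      unfolding B_def using e coef_low_pos sh by (intro polar_sum_deviation) auto
    also have "\<dots> = c * (real (s * h) powr (2 * H) / (real (s * h))\<^sup>2)"
      unfolding c_def power_mult_distrib[of _ "real (s * h)"] by simp
    also have "real (s * h) powr (2 * H) / (real (s * h))\<^sup>2 = real (s * h) powr (2 * H - 2)"
      using sh by (simp add: powr_diff)
    also have "\<dots> = real h powr (2 * H - 2) * real s powr (2 * H - 2)"
      by (simp add: powr_mult)
    finally show ?thesis .
  qed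
  have "net_fails h r = (\<Union>s\<in>{1..r}. B 1 s \<union> B (-1) s)"
    unfolding net_fails_def B_def by auto
  then have "prob (net_fails h r) \<le> (\<Sum>s=1..r. prob (B 1 s \<union> B (-1) s))"
    using Bev by (simp only:) (intro finite_measure_subadditive_finite; auto)
  also have "\<dots> \<le> (\<Sum>s=1..r. prob (B 1 s) + prob (B (-1) s))"
    using Bev by (intro sum_mono measure_Un_le) auto
  also have "\<dots> \<le> (\<Sum>s=1..r. 2 * (c * (real h powr (2 * H - 2) * real s powr (2 * H - 2))))"
  proof (rule sum_mono)
    fix s assume s: "s \<in> {1..r}"
    show "prob (B 1 s) + prob (B (-1) s) \<le> 2 * (c * (real h powr (2 * H - 2) * real s powr (2 * H - 2)))"
      using PB[OF _ s, of 1] PB[OF _ s, of "-1"] by simp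
  qed
  also have "\<dots> = 2 * c * real h powr (2 * H - 2) * (\<Sum>s=1..r. real s powr (2 * H - 2))"
    by (simp add: sum_distrib_left mult.assoc)
  also have "\<dots> \<le> 2 * c * real h powr (2 * H - 2) * (real r powr (2 * H - 2 + 1) / (2 * H - 2 + 1))"
    using c H_gt H_lt by (intro mult_left_mono sum_powr_le) auto
  also have "\<dots> = net_const * (real r powr (2 * H - 1) * real h powr (2 * H - 2))"
    unfolding net_const_def c_def by simp
  also have "real h powr (2 * H - 2) = real h powr (2 * H - 1) / real h"
    using h by (simp add: powr_diff power2_eq_square)
  finally show ?thesis by (simp add: powr_mult ac_simps)
qed

lemma theta4_ge:
  assumes h: "h \<ge> 1" and \<omega>: "\<omega> \<in> space M - net_fails h (N div h + 1)" and n: "n \<le> N"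
  shows "\<theta>s 4 n \<omega> \<ge> coef_low\<^sup>2 / 2 * real n - (row_sq_const + 3 * coef_low\<^sup>2) * real h"
  unfolding theta4_eq
proof (rule net_lower_bound[where dA = "polar_mean 1" and dB = "polar_mean (-1)"])
  have good: "\<bar>polar_sum e (s * h) \<omega> - polar_mean e (s * h)\<bar> \<le> coef_low\<^sup>2 / 4 * real (s * h)"
    if e: "e = 1 \<or> e = -1" and s: "s \<le> N div h + 1" for e s
  proof (cases "s = 0")
    case True
    then show ?thesis by (simp add: polar_sum_def polar_mean_def)
  next
    case False
    with s have "s \<in> {1..N div h + 1}" by auto
    then show ?thesis using \<omega> e unfolding net_fails_def by force
  qed
  have "n div h \<le> N div h" using n by (rule div_le_mono)
  then have "n div h \<le> N div h + 1" "n div h + 1 \<le> N div h + 1" by simp_all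
  then show "\<bar>polar_sum 1 (n div h * h) \<omega> - polar_mean 1 (n div h * h)\<bar> \<le> coef_low\<^sup>2 / 4 * real (n div h * h)"
    "\<bar>polar_sum (-1) ((n div h + 1) * h) \<omega> - polar_mean (-1) ((n div h + 1) * h)\<bar> \<le> coef_low\<^sup>2 / 4 * real ((n div h + 1) * h)"
    by (simp_all only: good simp_thms)
qed (use h coef_low_pos mono_polar_sum polar_mean_gap polar_mean_increment in auto)

section \<open>The event without stopping\<close>

abbreviation eps_exponent :: real where "eps_exponent \<equiv> min (1/2) (2 - 2 * H)"

lemma eps_eq: "eps H N = ln (real N) / real N powr eps_exponent" by (simp add: eps_def)

definition spacing_const :: real where "spacing_const = row_sq_const + 3 * coef_low\<^sup>2"

lemma spacing_const_pos: "spacing_const > 0" using row_sq_const_nonneg coef_low_pos by (simp add: spacing_const_def add_nonneg_pos)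

definition failure_const :: real where "failure_const = 3 * factor_const + 4 * spacing_const * net_const"

text \<open>The spacing \<open>h\<close> of the net is proportional to \<open>N * eps\<close>: the error \<open>spacing_const * h\<close> of the net then stays
below \<open>N * eps\<close>, and the net fails with probability of order \<open>N powr (2 * H - 1) / (N * eps)\<close>. Since the exponent in
\<open>eps\<close> is at most \<open>2 - 2 * H\<close>, this is at most of order \<open>1 / ln N\<close>. Since it is at most \<open>1/2\<close> as well, the same order
bounds the failure probabilities \<open>N / (N * eps)\<^sup>2\<close> of the martingale parts.\<close>

lemma good_event:
  assumes N: "N \<ge> 3" and big: "real N * eps H N \<ge> 2 * spacing_const" and small: "eps H N \<le> spacing_const"
  obtains G where "G \<in> events" "prob G \<ge> 1 - failure_const / ln (real N)"
    "\<And>\<omega> m. \<omega> \<in> G \<Longrightarrow> \<forall>i\<ge>1. \<xi> i \<omega> = 1 \<or> \<xi> i \<omega> = -1 \<Longrightarrow> m \<in> {1..N} \<Longrightarrow>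
       no_hit H \<sigma> \<xi> N 1 m \<omega> \<and> no_hit H \<sigma> \<xi> N 2 m \<omega> \<and> no_hit H \<sigma> \<xi> N 3 m \<omega> \<and> no_hit H \<sigma> \<xi> N 4 m \<omega>"
    "\<And>\<omega>. \<omega> \<in> G \<Longrightarrow> \<theta>s 4 N \<omega> / real N \<ge> coef_low\<^sup>2 / 2 - eps H N"
proof -
  define L where "L = real N * eps H N"
  obtain q where q: "eps H N = ln (real N) / real N powr q" "q \<le> 1/2" "q \<le> 2 - 2 * H"
    using eps_eq by (metis min.cobounded1 min.cobounded2)
  have N0: "real N > 0" and N1: "real N \<ge> 1" using N by auto
  have "exp 1 \<le> real N" using N by (intro order_trans[OF exp_le]) simp
  then have ln1: "ln (real N) \<ge> 1" using N0 by (simp add: ln_ge_iff)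
  then have eps_pos: "eps H N > 0" unfolding q(1) using N0 ln1 by (intro divide_pos_pos[OF less_le_trans[OF zero_less_one ln1]]) simp
  then have L: "L > 0" unfolding L_def using N0 by simp
  have mart: "real N * factor_const / L\<^sup>2 \<le> factor_const / ln (real N)"
  proof -
    have "real N powr (q + q) \<le> real N powr 1" using N1 q(2) by (intro powr_mono) auto
    then have le: "real N powr q * real N powr q \<le> real N" using N0 unfolding powr_add by simp
    have "real N * factor_const / L\<^sup>2 = factor_const * (real N powr q * real N powr q) / (real N * (ln (real N))\<^sup>2)"
      unfolding L_def q(1) using N0 ln1 by (simp add: power2_eq_square field_simps)
    also have "\<dots> \<le> factor_const * real N / (real N * (ln (real N))\<^sup>2)"
      using le factor_const_nonneg N0 by (intro divide_right_mono mult_left_mono) auto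
    also have "\<dots> = factor_const / (ln (real N))\<^sup>2" using N0 by simp
    also have "\<dots> \<le> factor_const / ln (real N)"
      using ln1 factor_const_nonneg by (intro divide_left_mono) (auto simp: power2_eq_square)
    finally show ?thesis .
  qed
  define h where "h = nat \<lfloor>L / spacing_const\<rfloor>"
  have Lc: "L / spacing_const \<ge> 2" using big spacing_const_pos by (simp add: L_def field_simps)
  have hr: "real h \<le> L / spacing_const" "real h \<ge> L / spacing_const - 1" "real h \<ge> 1"
    unfolding h_def using Lc by linarith+
  then have h1: "h \<ge> 1" by simp
  have hL: "spacing_const * real h \<le> L" using hr(1) spacing_const_pos by (simp add: field_simps)
  have h2: "real h \<ge> L / (2 * spacing_const)"
  proof -
    have "z / 2 \<le> z - 1" if "2 \<le> z" for z :: real using that by simp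
    from this[OF Lc] have "L / spacing_const / 2 \<le> real h" using hr(2) by (rule order_trans)
    then show ?thesis by (simp add: field_simps)
  qed
  have "real h \<le> real N"
  proof -
    have "L / spacing_const \<le> real N" using small spacing_const_pos N0 by (simp add: L_def field_simps)
    then show ?thesis using hr(1) by simp
  qed
  then have hN: "h \<le> N" by simp
  \<comment> \<open>The net has to extend to the first multiple of \<open>h\<close> beyond \<open>N\<close>.\<close>
  define r where "r = N div h + 1"
  have rh: "real (r * h) \<le> 2 * real N"
  proof -
    have "r * h \<le> N + h" unfolding r_def by (simp add: div_times_less_eq_dividend)
    then show ?thesis using hN by linarith
  qed
  have net: "prob (net_fails h r) \<le> 4 * spacing_const * net_const / ln (real N)"
  proof -
    have "prob (net_fails h r) \<le> net_const * real (r * h) powr (2 * H - 1) / real h"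
      by (rule net_fails_prob[OF h1]) (simp add: r_def)
    also have "\<dots> \<le> net_const * (2 * real N) powr (2 * H - 1) / real h"
      using rh H_gt net_const_nonneg by (intro divide_right_mono mult_left_mono powr_mono2) auto
    also have "\<dots> \<le> net_const * (2 * real N powr (2 * H - 1)) / real h"
    proof (intro divide_right_mono mult_left_mono)
      have "(2::real) powr (2 * H - 1) \<le> 2 powr 1" using H_lt by (intro powr_mono) auto
      then show "(2 * real N) powr (2 * H - 1) \<le> 2 * real N powr (2 * H - 1)"
        unfolding powr_mult by (simp add: mult_right_mono)
    qed (use net_const_nonneg in auto)
    also have "\<dots> \<le> net_const * (2 * real N powr (2 * H - 1)) / (L / (2 * spacing_const))"
      using h2 net_const_nonneg L spacing_const_pos hr by (intro divide_left_mono mult_nonneg_nonneg) auto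
    also have "\<dots> = 4 * spacing_const * net_const * (real N powr (2 * H - 1) / L)" by (simp add: field_simps)
    also have "real N powr (2 * H - 1) / L = real N powr (2 * H - 2 + q) / ln (real N)"
    proof -
      have "real N powr (2 * H - 1) = real N powr (2 * H - 2) * real N"
        using N0 powr_add[of "real N" "2 * H - 2" 1] by simp
      then show ?thesis unfolding L_def q(1) powr_add using N0 ln1 by simp
    qed
    also have "4 * spacing_const * net_const * \<dots> \<le> 4 * spacing_const * net_const * (1 / ln (real N))"
    proof (intro mult_left_mono divide_right_mono)
      have "real N powr (2 * H - 2 + q) \<le> real N powr 0" using N1 q(3) by (intro powr_mono) auto
      then show "real N powr (2 * H - 2 + q) \<le> 1" using N0 by simp
    qed (use spacing_const_pos net_const_nonneg ln1 in auto)
    finally show ?thesis by simp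
  qed
  define B1 where "B1 = {\<omega>\<in>space M. \<exists>m\<in>{1..N}. \<bar>\<theta>s 1 m \<omega>\<bar> \<ge> L}"
  define B2 where "B2 = {\<omega>\<in>space M. \<exists>m\<in>{1..N}. \<bar>\<theta>s 2 m \<omega>\<bar> \<ge> L}"
  define B3 where "B3 = {\<omega>\<in>space M. \<exists>m\<in>{1..N}. \<bar>\<Sum>k=1..m. \<xi> k \<omega> * theta3_factor k \<omega>\<bar> \<ge> L}"
  have ts[measurable]: "\<theta>s i m \<in> borel_measurable M" for i m
    unfolding theta_sum_def[abs_def] by (intro borel_measurable_sum F_M[OF theta_F]) auto
  have hs[measurable]: "(\<lambda>\<omega>. \<Sum>k=1..m. \<xi> k \<omega> * theta3_factor k \<omega>) \<in> borel_measurable M" for m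
    unfolding theta3_factor_def
    by (intro borel_measurable_sum borel_measurable_times borel_measurable_const xi_measurable) auto
  have ev: "B1 \<in> events" "B2 \<in> events" "B3 \<in> events" "net_fails h r \<in> events"
    using net_fails_event unfolding B1_def B2_def B3_def by measurable
  define G where "G = space M - (B1 \<union> B2 \<union> B3 \<union> net_fails h r)"
  have Gev: "G \<in> events" unfolding G_def using ev by auto
  have "prob (B1 \<union> B2 \<union> B3 \<union> net_fails h r) \<le> prob B1 + prob B2 + prob B3 + prob (net_fails h r)"
    using ev by (auto intro!: order_trans[OF measure_Un_le] add_mono)
  also have "\<dots> \<le> factor_const / ln (real N) + factor_const / ln (real N) + factor_const / ln (real N) + 4 * spacing_const * net_const / ln (real N)"
    unfolding B1_def B2_def B3_def
    by (intro add_mono net order_trans[OF theta1_deviation[OF L] mart]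
        order_trans[OF theta2_deviation[OF L] mart] order_trans[OF theta3_deviation[OF L] mart])
  also have "\<dots> = failure_const / ln (real N)" by (simp add: failure_const_def add_divide_distrib)
  finally have PG: "prob G \<ge> 1 - failure_const / ln (real N)"
    unfolding G_def using ev by (subst prob_compl) auto
  have low: "no_hit H \<sigma> \<xi> N i m \<omega>" if "\<theta>s i m \<omega> \<ge> - L" for i m \<omega>
    using that N0 unfolding no_hit_def L_def by (simp add: field_simps)
  have t4: "\<theta>s 4 m \<omega> \<ge> coef_low\<^sup>2 / 2 * real m - L" if "\<omega> \<in> G" "m \<le> N" for \<omega> m
  proof -
    have "\<omega> \<in> space M - net_fails h (N div h + 1)" using that by (auto simp: G_def r_def)
    from theta4_ge[OF h1 this that(2)] show ?thesis using hL by (simp add: spacing_const_def)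
  qed
  show ?thesis
  proof (rule that[OF Gev PG])
    fix \<omega> m assume \<omega>: "\<omega> \<in> G" and sgn: "\<forall>i\<ge>1. \<xi> i \<omega> = 1 \<or> \<xi> i \<omega> = -1" and m: "m \<in> {1..N}"
    have 1: "\<bar>\<theta>s 1 m \<omega>\<bar> < L" "\<bar>\<theta>s 2 m \<omega>\<bar> < L"
      using \<omega> m unfolding G_def B1_def B2_def by (auto simp: not_le)
    obtain m' where m': "m = Suc m'" using m by (cases m) auto
    have 3: "\<theta>s 3 m \<omega> \<ge> - L"
    proof (cases "m' = 0")
      case True
      then show ?thesis using L m' by (simp add: theta_sum_def theta_def)
    next
      case False
      then have "m' \<in> {1..N}" using m m' by auto
      then have "\<bar>\<Sum>k=1..m'. \<xi> k \<omega> * theta3_factor k \<omega>\<bar> < L"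
        using \<omega> unfolding G_def B3_def by (auto simp: not_le)
      then show ?thesis using theta3_ge[OF sgn, of m'] unfolding m' by linarith
    qed
    have "0 \<le> coef_low\<^sup>2 / 2 * real m" by simp
    moreover have "coef_low\<^sup>2 / 2 * real m - L \<le> \<theta>s 4 m \<omega>" using m by (intro t4[OF \<omega>]) auto
    ultimately have 4: "\<theta>s 4 m \<omega> \<ge> - L" by linarith
    show "no_hit H \<sigma> \<xi> N 1 m \<omega> \<and> no_hit H \<sigma> \<xi> N 2 m \<omega> \<and> no_hit H \<sigma> \<xi> N 3 m \<omega> \<and> no_hit H \<sigma> \<xi> N 4 m \<omega>"
      using 1 3 4 by (intro conjI low) (auto simp: abs_less_iff)
  next
    fix \<omega> assume \<omega>: "\<omega> \<in> G"
    have "\<theta>s 4 N \<omega> / real N \<ge> (coef_low\<^sup>2 / 2 * real N - L) / real N"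
      using t4[OF \<omega> order_refl] by (intro divide_right_mono) auto
    also have "(coef_low\<^sup>2 / 2 * real N - L) / real N = coef_low\<^sup>2 / 2 - eps H N"
      unfolding L_def using N0 by (simp add: diff_divide_distrib)
    finally show "\<theta>s 4 N \<omega> / real N \<ge> coef_low\<^sup>2 / 2 - eps H N" .
  qed
qed

section \<open>Asymptotics of the thresholds and of the costs\<close>

lemma eps_tendsto_0: "eps H \<longlonglongrightarrow> 0"
  unfolding eps_def[abs_def] using H_lt by (intro lim_ln_over_power) auto

lemma c_hat_tendsto_0: "c_hat H C1 C2 \<longlonglongrightarrow> 0"
proof -
  have "(\<lambda>N. real N powr (- (3/2 - H))) \<longlonglongrightarrow> 0"
    using H_lt by (intro tendsto_neg_powr filterlim_real_sequentially) auto
  then have "(\<lambda>N. 4 * eps H N + (C1 + C2) * real N powr (- (3/2 - H))) \<longlonglongrightarrow> 4 * 0 + (C1 + C2) * 0"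
    by (intro tendsto_intros eps_tendsto_0)
  then show ?thesis unfolding c_hat_def[abs_def] powr_minus_divide by simp
qed

lemma N_eps_at_top: "filterlim (\<lambda>N. real N * eps H N) at_top sequentially"
proof (rule filterlim_at_top_mono)
  show "filterlim (\<lambda>N. ln (real N)) at_top sequentially"
    by (intro filterlim_compose[OF ln_at_top] filterlim_real_sequentially)
  show "\<forall>\<^sub>F N in sequentially. ln (real N) \<le> real N * eps H N"
    using eventually_ge_at_top[of 1]
  proof eventually_elim
    case (elim N)
    then have N: "real N \<ge> 1" by simp
    have "real N powr eps_exponent \<le> real N powr 1" using N by (intro powr_mono) auto
    then have "real N powr eps_exponent * ln (real N) \<le> real N * ln (real N)" using N by (intro mult_right_mono) auto
    then show ?case using N by (simp add: eps_eq field_simps)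
  qed
qed

text \<open>A bound on the total transaction costs along almost every path: of order \<open>N\<close> trades, each worth at most a multiple of
\<open>N powr (H - 1) * \<bar>X k\<bar> / sqrt (c_hat N)\<close>, with \<open>\<bar>X k\<bar>\<close> of order \<open>N powr (H - 1/2)\<close>.\<close>

definition cost :: "real \<Rightarrow> real \<Rightarrow> (nat \<Rightarrow> real) \<Rightarrow> nat \<Rightarrow> real" where
  "cost C1 C2 lam N = 4 * X_const * lam N * real N powr (2 * H - 1/2) / sqrt (c_hat H C1 C2 N)"

text \<open>As \<open>c_hat \<ge> 4 * eps\<close>, division by \<open>sqrt c_hat\<close> contributes at most the power \<open>min (1/4) (1 - H)\<close> of \<open>N\<close> and the
factor \<open>1 / (2 * sqrt (ln N))\<close>. The resulting power
\<open>2 * H - 1/2 + min (1/4) (1 - H) = min (2 * H - 1/4) (H + 1/2)\<close> is that in the assumption on \<open>lam\<close>.\<close>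

lemma cost_tendsto_0:
  assumes C: "C1 \<ge> 0" "C2 \<ge> 0" and lam: "\<And>N. N \<ge> 1 \<Longrightarrow> 0 \<le> lam N"
    and o: "lam \<in> o(\<lambda>N. sqrt (ln (real N)) / real N powr (min (2 * H - 1/4) (H + 1/2)))"
  shows "cost C1 C2 lam \<longlonglongrightarrow> 0"
proof -
  let ?q = "min (2 * H - 1/4) (H + 1/2)"
  let ?G = "\<lambda>N. sqrt (ln (real N)) / real N powr ?q"
  have "(\<lambda>N. lam N / ?G N) \<longlonglongrightarrow> 0" by (rule smalloD_tendsto[OF o])
  then have lim: "(\<lambda>N. 2 * X_const * (lam N / ?G N)) \<longlonglongrightarrow> 0" by (rule tendsto_mult_right_zero)
  show ?thesis
  proof (rule tendsto_sandwich[OF _ _ tendsto_const lim])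
    show "\<forall>\<^sub>F N in sequentially. 0 \<le> cost C1 C2 lam N"
      using eventually_ge_at_top[of 1]
    proof eventually_elim
      case (elim N)
      have "eps H N \<ge> 0" using elim by (simp add: eps_def)
      then have "c_hat H C1 C2 N \<ge> 0" using C by (simp add: c_hat_def)
      then show ?case using lam[OF elim] X_const_pos by (simp add: cost_def)
    qed
    show "\<forall>\<^sub>F N in sequentially. cost C1 C2 lam N \<le> 2 * X_const * (lam N / ?G N)"
      using eventually_ge_at_top[of 2]
    proof eventually_elim
      case (elim N)
      have N: "real N > 1" using elim by simp
      then have ln: "ln (real N) > 0" by simp
      have "c_hat H C1 C2 N \<ge> 4 * eps H N" using C by (simp add: c_hat_def)
      then have "sqrt (c_hat H C1 C2 N) \<ge> sqrt (4 * eps H N)" by simp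
      also have "sqrt (4 * eps H N) = 2 * (sqrt (ln (real N)) / real N powr (eps_exponent / 2))"
      proof -
        have "sqrt (real N powr eps_exponent) = real N powr (eps_exponent / 2)"
          using N by (simp add: powr_half_sqrt[symmetric] powr_powr)
        then show ?thesis by (simp add: eps_eq real_sqrt_mult real_sqrt_divide)
      qed
      finally have s: "2 * (sqrt (ln (real N)) / real N powr (eps_exponent / 2)) \<le> sqrt (c_hat H C1 C2 N)" .
      have "cost C1 C2 lam N \<le> 4 * X_const * lam N * real N powr (2 * H - 1/2) / (2 * (sqrt (ln (real N)) / real N powr (eps_exponent / 2)))"
      proof -
        have pos: "0 < 2 * (sqrt (ln (real N)) / real N powr (eps_exponent / 2))" using ln N by simp
        show ?thesis unfolding cost_def
          by (rule divide_left_mono[OF s])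
             (use mult_pos_pos[OF less_le_trans[OF pos s] pos] lam[of N] elim X_const_pos in auto)
      qed
      also have "\<dots> = 2 * X_const * lam N * (real N powr (2 * H - 1/2) * real N powr (eps_exponent / 2)) / sqrt (ln (real N))"
        by simp
      also have "real N powr (2 * H - 1/2) * real N powr (eps_exponent / 2) = real N powr ?q"
      proof -
        have "2 * H - 1/2 + eps_exponent / 2 = ?q" by (cases "H \<le> 3/4") (simp_all add: min_def field_simps)
        then show ?thesis by (simp flip: powr_add)
      qed
      finally show ?case by simp
    qed
  qed
qed

lemma value_ge:
  assumes sgn: "\<forall>i\<ge>1. \<xi> i \<omega> = 1 \<or> \<xi> i \<omega> = -1" and N: "N \<ge> 1" "X_const / real N powr (1/2) \<le> 1/2"
    and n: "n \<le> N" and lam: "0 \<le> lam N" and ch: "c_hat H C1 C2 N > 0"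
  shows "liquidation_value (S N) (lam N) (psi_bond H \<sigma> s0 \<xi> C1 C2 lam N) (psi_stock H \<sigma> s0 \<xi> C1 C2 N) (int n) \<omega>
    \<ge> 1 / sqrt (c_hat H C1 C2 N) *
      ((\<Sum>k=1..n. if active N (int (k - 1)) \<omega> then \<theta> 1 k \<omega> + \<theta> 2 k \<omega> + \<theta> 3 k \<omega> + \<theta> 4 k \<omega> else 0) / real N)
      - cost C1 C2 lam N"
proof -
  define d where "d = X_const * (real N powr (H - 1) * real N powr (H - 1/2)) / sqrt (c_hat H C1 C2 N)"
  have N0: "real N > 0" using N by simp
  note Sb = stock_bounds[OF sgn N(2)]
  have small: "\<bar>psi_stock H \<sigma> s0 \<xi> C1 C2 N (int k) \<omega>\<bar> * S N k \<omega> \<le> d" if k: "1 \<le> k" "k \<le> N" for k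
  proof -
    have "\<bar>psi_stock H \<sigma> s0 \<xi> C1 C2 N (int k) \<omega>\<bar> * S N k \<omega>
      \<le> 1 / sqrt (c_hat H C1 C2 N) * (real N powr (H - 1) * (\<bar>X k \<omega>\<bar> / S N k \<omega>)) * S N k \<omega>"
      using Sb(1)[OF k(2)] ch k
      by (intro mult_right_mono) (auto simp: psi_stock_def phi_stock_def abs_mult)
    also have "\<dots> = 1 / sqrt (c_hat H C1 C2 N) * (real N powr (H - 1) * \<bar>X k \<omega>\<bar>)"
      using Sb(1)[OF k(2)] by simp
    also have "\<dots> \<le> 1 / sqrt (c_hat H C1 C2 N) * (real N powr (H - 1) * (X_const * real N powr (H - 1/2)))"
    proof (intro mult_left_mono)
      have "\<bar>X k \<omega>\<bar> \<le> X_const * real k powr (H - 1/2)" by (rule abs_X_le[OF sgn k(1)])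
      also have "\<dots> \<le> X_const * real N powr (H - 1/2)"
        using X_const_pos k H_gt by (intro mult_left_mono powr_mono2) auto
      finally show "\<bar>X k \<omega>\<bar> \<le> X_const * real N powr (H - 1/2)" .
    qed (use ch in auto)
    finally show ?thesis by (simp add: d_def ac_simps)
  qed
  have d: "d \<ge> 0" unfolding d_def using X_const_pos ch by simp
  have cost: "4 * (lam N * real N * d) = cost C1 C2 lam N"
  proof -
    have "real N * (real N powr (H - 1) * real N powr (H - 1/2)) = real N powr (2 * H - 1/2)"
      using N0 powr_add[of "real N" 1 "2 * H - 3/2"] by (simp flip: powr_add)
    then have "cost C1 C2 lam N = 4 * X_const * lam N * (real N * (real N powr (H - 1) * real N powr (H - 1/2))) / sqrt (c_hat H C1 C2 N)"
      by (simp add: cost_def)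
    then show ?thesis by (simp add: d_def)
  qed
  have "liquidation_value (S N) (lam N) (psi_bond H \<sigma> s0 \<xi> C1 C2 lam N) (psi_stock H \<sigma> s0 \<xi> C1 C2 N) (int n) \<omega>
    \<ge> (\<Sum>k=1..n. psi_stock H \<sigma> s0 \<xi> C1 C2 N (int k - 1) \<omega> * (S N k \<omega> - S N (k - 1) \<omega>)) - 4 * (lam N * real N * d)"
    unfolding psi_bond_def
    using lam n N Sb small d psi_stock_nonpos by (intro liquidation_value_ge) auto
  also have "(\<Sum>k=1..n. psi_stock H \<sigma> s0 \<xi> C1 C2 N (int k - 1) \<omega> * (S N k \<omega> - S N (k - 1) \<omega>))
    = 1 / sqrt (c_hat H C1 C2 N) / real N *
      (\<Sum>k=1..n. if active N (int (k - 1)) \<omega> then \<theta> 1 k \<omega> + \<theta> 2 k \<omega> + \<theta> 3 k \<omega> + \<theta> 4 k \<omega> else 0)"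
    using Sb(1) n by (rule gain_eq)
  finally show ?thesis unfolding cost by (simp only: times_divide_eq_right times_divide_eq_left)
qed

end

section \<open>Strong asymptotic arbitrage\<close>

text \<open>The losses are bounded by \<open>c = sqrt c_hat + cost\<close>. On the event of \<open>good_event\<close> nothing is stopped, and the
fourth sum outweighs the other three by \<open>N * \<eta>\<close>, hence the profit \<open>C = \<eta> / sqrt c_hat - 1\<close>, where \<open>1\<close> bounds the
cost.\<close>

lemma (in binary_market) psi_provides_SAA:
  assumes C: "C1 > 0" "C2 > 0"
    and t1: "\<And>N. N \<ge> 1 \<Longrightarrow> AE \<omega> in M. \<forall>n\<in>{1..N}. \<bar>\<theta> 1 n \<omega>\<bar> \<le> C1 * real N powr (H - 1/2)"
    and t2: "\<And>N. N \<ge> 1 \<Longrightarrow> AE \<omega> in M. \<forall>n\<in>{1..N}. \<bar>\<theta> 2 n \<omega>\<bar> \<le> C2 * real N powr (H - 1/2)"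
    and lam: "\<And>N. N \<ge> 1 \<Longrightarrow> 0 \<le> lam N"
    and o: "lam \<in> o(\<lambda>N. sqrt (ln (real N)) / real N powr (min (2 * H - 1/4) (H + 1/2)))"
  shows "\<exists>N0\<ge>1. (\<forall>N\<ge>N0. AE \<omega> in M. \<forall>k\<le>N. S N k \<omega> > 0) \<and>
           provides_SAA M F S lam (\<lambda>m. N0 + m) (psi_bond H \<sigma> s0 \<xi> C1 C2 lam) (psi_stock H \<sigma> s0 \<xi> C1 C2)"
proof -
  define ch where "ch = c_hat H C1 C2"
  define co where "co = cost C1 C2 lam"
  \<comment> \<open>Half of the guaranteed drift \<open>coef_low\<^sup>2 / 2\<close>; the other half covers four times \<open>eps\<close>.\<close>
  define \<eta> where "\<eta> = coef_low\<^sup>2 / 4"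
  have \<eta>: "\<eta> > 0" using coef_low_pos by (simp add: \<eta>_def)
  have ch0: "ch \<longlonglongrightarrow> 0" unfolding ch_def by (rule c_hat_tendsto_0)
  have co0: "co \<longlonglongrightarrow> 0" unfolding co_def using C lam o by (intro cost_tendsto_0) auto
  have ch_pos: "ch N > 0" if "N \<ge> 1" for N
  proof -
    have "eps H N \<ge> 0" using that by (simp add: eps_def)
    moreover have "(C1 + C2) / real N powr (3/2 - H) > 0" using C that by (intro divide_pos_pos) auto
    ultimately show ?thesis unfolding ch_def c_hat_def by linarith
  qed
  have sq0: "(\<lambda>N. sqrt (ch N)) \<longlonglongrightarrow> 0" using tendsto_real_sqrt[OF ch0] by simp
  have "(\<lambda>N. X_const * real N powr - (1/2)) \<longlonglongrightarrow> X_const * 0"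
    by (intro tendsto_intros tendsto_neg_powr filterlim_real_sequentially) auto
  then have "(\<lambda>N. X_const / real N powr (1/2)) \<longlonglongrightarrow> 0" unfolding powr_minus_divide by simp
  then have e1: "\<forall>\<^sub>F N in sequentially. X_const / real N powr (1/2) < 1/2" by (rule order_tendstoD) simp
  have e2: "\<forall>\<^sub>F N in sequentially. real N * eps H N \<ge> 2 * spacing_const"
    using N_eps_at_top unfolding filterlim_at_top by blast
  have e3: "\<forall>\<^sub>F N in sequentially. eps H N < min spacing_const (\<eta> / 4)"
    using spacing_const_pos \<eta> by (intro order_tendstoD(2)[OF eps_tendsto_0]) simp
  have e4: "\<forall>\<^sub>F N in sequentially. co N < 1" using co0 by (rule order_tendstoD) simp
  have e5: "\<forall>\<^sub>F N in sequentially. sqrt (ch N) < \<eta> / 2" using sq0 by (rule order_tendstoD) (use \<eta> in simp)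
  have "\<forall>\<^sub>F N in sequentially. N \<ge> 3 \<and> X_const / real N powr (1/2) \<le> 1/2 \<and> real N * eps H N \<ge> 2 * spacing_const
    \<and> eps H N \<le> spacing_const \<and> eps H N \<le> \<eta> / 4 \<and> co N < 1 \<and> sqrt (ch N) < \<eta> / 2"
    using e1 e2 e3 e4 e5 eventually_ge_at_top[of 3] by eventually_elim auto
  then obtain N0 where N0: "\<And>N. N \<ge> N0 \<Longrightarrow> N \<ge> 3 \<and> X_const / real N powr (1/2) \<le> 1/2 \<and> real N * eps H N \<ge> 2 * spacing_const
    \<and> eps H N \<le> spacing_const \<and> eps H N \<le> \<eta> / 4 \<and> co N < 1 \<and> sqrt (ch N) < \<eta> / 2"
    unfolding eventually_sequentially by blast
  have co_nonneg: "co N \<ge> 0" if "N \<ge> 1" for N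
    unfolding co_def cost_def using that lam[of N] X_const_pos ch_pos[of N] by (simp add: ch_def)
  let ?V = "\<lambda>N i \<omega>. liquidation_value (S N) (lam N) (psi_bond H \<sigma> s0 \<xi> C1 C2 lam N) (psi_stock H \<sigma> s0 \<xi> C1 C2 N) i \<omega>"
  let ?A = "\<lambda>N n \<omega>. \<Sum>k=1..n. if active N (int (k - 1)) \<omega> then \<theta> 1 k \<omega> + \<theta> 2 k \<omega> + \<theta> 3 k \<omega> + \<theta> 4 k \<omega> else 0"
  have V: "?V N (int n) \<omega> \<ge> 1 / sqrt (ch N) * (?A N n \<omega> / real N) - co N"
    if "N \<ge> N0" "n \<le> N" "\<forall>i\<ge>1. \<xi> i \<omega> = 1 \<or> \<xi> i \<omega> = -1" for N n \<omega>
    unfolding ch_def co_def using that N0[of N] ch_pos[of N] lam[of N]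
    by (intro value_ge) (auto simp: ch_def)
  have pos: "AE \<omega> in M. \<forall>k\<le>N. S N k \<omega> > 0" if "N \<ge> N0" for N
    using AE_sign
  proof eventually_elim
    case (elim \<omega>)
    then show ?case using stock_bounds(1)[of \<omega> N] N0[OF that] by blast
  qed
  have lower: "AE \<omega> in M. \<forall>i\<in>{0..int N}. ?V N i \<omega> \<ge> - (sqrt (ch N) + co N)" if N: "N \<ge> N0" for N
  proof -
    have N1: "N \<ge> 1" using N0[OF N] by simp
    show ?thesis using AE_sign t1[OF N1] t2[OF N1]
    proof eventually_elim
      case (elim \<omega>)
      show ?case
      proof
        fix i assume i: "i \<in> {0..int N}"
        then obtain n where n: "i = int n" "n \<le> N"
          by (metis atLeastAtMost_iff nonneg_int_cases of_nat_le_iff)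
        have "eps H N \<ge> 0" using N1 by (simp add: eps_def)
        then have "?A N n \<omega> / real N \<ge> - ch N"
          unfolding ch_def using N1 n(2) C elim by (intro stopped_gain_ge) auto
        then have "1 / sqrt (ch N) * (?A N n \<omega> / real N) \<ge> 1 / sqrt (ch N) * (- ch N)"
          using ch_pos[OF N1] by (intro mult_left_mono) auto
        also have "1 / sqrt (ch N) * (- ch N) = - sqrt (ch N)"
          using ch_pos[OF N1] by (simp add: real_div_sqrt)
        finally show "?V N i \<omega> \<ge> - (sqrt (ch N) + co N)"
          using V[OF N n(2) elim(1)] n(1) by simp
      qed
    qed
  qed
  have V_meas: "{\<omega>\<in>space M. ?V N (int N) \<omega> \<ge> c} \<in> events" for N c
  proof -
    have [measurable]: "psi_bond H \<sigma> s0 \<xi> C1 C2 lam N (int N) \<in> borel_measurable M"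
      "psi_stock H \<sigma> s0 \<xi> C1 C2 N (int N) \<in> borel_measurable M" "S N N \<in> borel_measurable M"
      by (rule F_M[OF psi_bond_F] F_M[OF psi_stock_F] F_M[OF S_F[OF order_refl]])+
    show ?thesis unfolding liquidation_value_def nat_int by measurable
  qed
  have profit: "prob {\<omega>\<in>space M. ?V N (int N) \<omega> \<ge> \<eta> / sqrt (ch N) - 1} \<ge> 1 - failure_const / ln (real N)" if N: "N \<ge> N0" for N
  proof -
    note large = N0[OF N]
    then have N3: "N \<ge> 3" and N1: "N \<ge> 1" by auto
    obtain G where G: "G \<in> events" "prob G \<ge> 1 - failure_const / ln (real N)"
      and nh: "\<And>\<omega> m. \<omega> \<in> G \<Longrightarrow> \<forall>i\<ge>1. \<xi> i \<omega> = 1 \<or> \<xi> i \<omega> = -1 \<Longrightarrow> m \<in> {1..N} \<Longrightarrow>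
         no_hit H \<sigma> \<xi> N 1 m \<omega> \<and> no_hit H \<sigma> \<xi> N 2 m \<omega> \<and> no_hit H \<sigma> \<xi> N 3 m \<omega> \<and> no_hit H \<sigma> \<xi> N 4 m \<omega>"
      and g4: "\<And>\<omega>. \<omega> \<in> G \<Longrightarrow> \<theta>s 4 N \<omega> / real N \<ge> coef_low\<^sup>2 / 2 - eps H N"
      using good_event[of N] large by blast
    have "prob G \<le> prob {\<omega>\<in>space M. ?V N (int N) \<omega> \<ge> \<eta> / sqrt (ch N) - 1}"
    proof (rule finite_measure_mono_AE[OF _ V_meas])
      show "AE \<omega> in M. \<omega> \<in> G \<longrightarrow> \<omega> \<in> {\<omega>\<in>space M. ?V N (int N) \<omega> \<ge> \<eta> / sqrt (ch N) - 1}"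
        using AE_sign AE_space
      proof eventually_elim
        case (elim \<omega>)
        show ?case
        proof (intro impI CollectI conjI elim(2))
          assume \<omega>: "\<omega> \<in> G"
          note nh = nh[OF \<omega> elim(1)]
          have "active N (int (k - 1)) \<omega>" for k
            unfolding less_stop_time_iff using nh by blast
          then have "?A N N \<omega> = \<theta>s 1 N \<omega> + \<theta>s 2 N \<omega> + \<theta>s 3 N \<omega> + \<theta>s 4 N \<omega>"
            unfolding theta_sum_def sum.distrib[symmetric] by (intro sum.cong refl if_P)
          then have "?A N N \<omega> / real N = \<theta>s 1 N \<omega> / real N + \<theta>s 2 N \<omega> / real N + \<theta>s 3 N \<omega> / real N + \<theta>s 4 N \<omega> / real N"
            by (simp add: add_divide_distrib)
          also have "\<dots> \<ge> \<eta>"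
          proof -
            have "- eps H N \<le> \<theta>s 1 N \<omega> / real N" "- eps H N \<le> \<theta>s 2 N \<omega> / real N" "- eps H N \<le> \<theta>s 3 N \<omega> / real N"
              using nh[of N] N1 by (simp_all add: no_hit_def)
            moreover have "2 * \<eta> - eps H N \<le> \<theta>s 4 N \<omega> / real N" using g4[OF \<omega>] by (simp add: \<eta>_def)
            moreover have "eps H N \<le> \<eta> / 4" using large by blast
            ultimately show ?thesis by linarith
          qed
          finally have "1 / sqrt (ch N) * (?A N N \<omega> / real N) \<ge> 1 / sqrt (ch N) * \<eta>"
            using ch_pos[OF N1] by (intro mult_left_mono) auto
          then show "?V N (int N) \<omega> \<ge> \<eta> / sqrt (ch N) - 1"
            using V[OF N order_refl elim(1)] large by simp
        qed
      qed
    qed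
    with G(2) show ?thesis by simp
  qed
  have N0_1: "N0 \<ge> 1" using N0[of N0] by simp
  define r where "r m = N0 + m" for m :: nat
  have r: "strict_mono r" "\<And>m. r m \<ge> N0" by (auto simp: r_def strict_mono_def)
  have r_lim: "filterlim r at_top sequentially" using r(1) by (rule filterlim_subseq)
  have r1: "r m \<ge> 1" for m using N0_1 r(2)[of m] by linarith
  have "provides_SAA M F S lam r (psi_bond H \<sigma> s0 \<xi> C1 C2 lam) (psi_stock H \<sigma> s0 \<xi> C1 C2)"
    unfolding provides_SAA_def
  proof (intro conjI allI)
    show "\<exists>c C :: nat \<Rightarrow> real.
        (\<forall>m. c m > 0) \<and> (\<forall>m. C m > 0) \<and> c \<longlonglongrightarrow> 0 \<and> filterlim C at_top sequentially \<and>
        (\<forall>m. AE \<omega> in M. \<forall>i\<in>{0..int (r m)}. ?V (r m) i \<omega> \<ge> - c m) \<and>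
        (\<lambda>m. prob {\<omega>\<in>space M. ?V (r m) (int (r m)) \<omega> \<ge> C m}) \<longlonglongrightarrow> 1"
    proof (intro exI conjI allI)
      fix m
      show "sqrt (ch (r m)) + co (r m) > 0"
        using ch_pos[OF r1] co_nonneg[OF r1] by (intro add_pos_nonneg) auto
      have "\<eta> / sqrt (ch (r m)) > 1"
        using ch_pos[OF r1, of m] N0[OF r(2), of m] \<eta> by (simp add: field_simps)
      then show "\<eta> / sqrt (ch (r m)) - 1 > 0" by simp
      show "AE \<omega> in M. \<forall>i\<in>{0..int (r m)}. ?V (r m) i \<omega> \<ge> - (sqrt (ch (r m)) + co (r m))"
        by (rule lower[OF r(2)])
    next
      have "(\<lambda>N. sqrt (ch N) + co N) \<longlonglongrightarrow> 0" using tendsto_add[OF sq0 co0] by simp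
      then show "(\<lambda>m. sqrt (ch (r m)) + co (r m)) \<longlonglongrightarrow> 0" by (rule filterlim_compose[OF _ r_lim])
    next
      have "filterlim (\<lambda>m. sqrt (ch (r m))) (at_right 0) sequentially"
        unfolding filterlim_at
      proof
        show "\<forall>\<^sub>F m in sequentially. sqrt (ch (r m)) \<in> {0<..} \<and> sqrt (ch (r m)) \<noteq> 0"
          using ch_pos[OF r1] by (intro always_eventually) (auto simp: less_imp_neq[symmetric])
        show "(\<lambda>m. sqrt (ch (r m))) \<longlonglongrightarrow> 0" by (rule filterlim_compose[OF sq0 r_lim])
      qed
      then have "filterlim (\<lambda>m. inverse (sqrt (ch (r m)))) at_top sequentially"
        by (rule filterlim_compose[OF filterlim_inverse_at_top_right])
      then have "filterlim (\<lambda>m. \<eta> * inverse (sqrt (ch (r m)))) at_top sequentially"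
        using \<eta> by (intro filterlim_tendsto_pos_mult_at_top[OF tendsto_const]) auto
      then have "filterlim (\<lambda>m. - 1 + \<eta> * inverse (sqrt (ch (r m)))) at_top sequentially"
        by (intro filterlim_tendsto_add_at_top[OF tendsto_const])
      then show "filterlim (\<lambda>m. \<eta> / sqrt (ch (r m)) - 1) at_top sequentially"
        by (simp add: divide_inverse)
    next
      have "filterlim (\<lambda>m. ln (real (r m))) at_top sequentially"
        by (intro filterlim_compose[OF ln_at_top] filterlim_compose[OF filterlim_real_sequentially] r_lim)
      then have "(\<lambda>m. 1 - failure_const / ln (real (r m))) \<longlonglongrightarrow> 1 - 0"
        by (intro tendsto_diff tendsto_const tendsto_divide_0[OF tendsto_const] filterlim_at_top_imp_at_infinity)
      then have lim: "(\<lambda>m. 1 - failure_const / ln (real (r m))) \<longlonglongrightarrow> 1" by simp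
      show "(\<lambda>m. prob {\<omega>\<in>space M. ?V (r m) (int (r m)) \<omega> \<ge> \<eta> / sqrt (ch (r m)) - 1}) \<longlonglongrightarrow> 1"
        by (rule tendsto_sandwich[OF _ _ lim tendsto_const])
           (auto intro!: always_eventually profit[OF r(2)] prob_le_1)
    qed
  qed (use r r1 psi_self_financing psi_zero_endowment in auto)
  then show ?thesis using N0_1 pos unfolding r_def by blast
qed

theorem theorem4p1:
  fixes M :: "'a measure" and \<xi> :: "nat \<Rightarrow> 'a \<Rightarrow> real"
    and H \<sigma> s0 C1 C2 :: real and lam :: "nat \<Rightarrow> real"
  assumes "1/2 < H" and "H < 1" and "\<sigma> > 0" and "s0 > 0"
    and "prob_space M"
    and "prob_space.indep_vars M (\<lambda>_. borel) \<xi> {1..}"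
    and "\<And>i. i \<ge> 1 \<Longrightarrow> measure M {\<omega>\<in>space M. \<xi> i \<omega> = 1} = 1/2"
    and "\<And>i. i \<ge> 1 \<Longrightarrow> measure M {\<omega>\<in>space M. \<xi> i \<omega> = -1} = 1/2"
    and "C1 > 0" and "C2 > 0"
    and "\<And>N. N \<ge> 1 \<Longrightarrow>
           AE \<omega> in M. \<forall>n\<in>{1..N}. \<bar>theta H \<sigma> \<xi> 1 n \<omega>\<bar> \<le> C1 * real N powr (H - 1/2)"
    and "\<And>N. N \<ge> 1 \<Longrightarrow>
           AE \<omega> in M. \<forall>n\<in>{1..N}. \<bar>theta H \<sigma> \<xi> 2 n \<omega>\<bar> \<le> C2 * real N powr (H - 1/2)"
    and "\<And>N. N \<ge> 1 \<Longrightarrow> 0 \<le> lam N \<and> lam N \<le> 1"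
    and "lam \<in> o(\<lambda>N. sqrt (ln (real N)) / real N powr (min (2 * H - 1/4) (H + 1/2)))"
  shows "\<exists>N0\<ge>1. (\<forall>N\<ge>N0. AE \<omega> in M. \<forall>k\<le>N. stock H \<sigma> s0 \<xi> N k \<omega> > 0) \<and>
           provides_SAA M (nat_filtration M \<xi>) (stock H \<sigma> s0 \<xi>) lam (\<lambda>m. N0 + m)
             (psi_bond H \<sigma> s0 \<xi> C1 C2 lam) (psi_stock H \<sigma> s0 \<xi> C1 C2)"
proof -
  interpret prob_space M by fact
  interpret binary_market H \<sigma> M \<xi> s0
    by unfold_locales (use assms in auto)
  show ?thesis using assms by (intro psi_provides_SAA) auto
qed

end
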